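(* Let $k\ge2$ and $m\in\{0,1,2,\dots\}$ be fixed and let $\{W_i\}_{i\ge1}$ be an $m$-dependent sequence (not necessarily stationary). Suppose that for some $r\ge2$ $$\lim_{M\to\infty}\sup_n\sup_{(i_1,\dots,i_k)\in[n]^k}E\big[|\varphi(W_{i_1},\dots,W_{i_k})|^r\,1\{|\varphi(W_{i_1},\dots,W_{i_k})|>M\}\big]=0 .\qquad(\ast)$$ Then, as $n\to\infty$: (a) $\displaystyle U_{n,k}=\frac kn\sum_{i=1}^n\bar\varphi^{(1)}_{n,m,k,i}(W_i)+O_p\Big(\frac{m+1}n\Big)$; (b) $\displaystyle U_{n,k}=O_p\Big(\sqrt{\frac{m+1}n}\Big)=o_p(1)$. (c) If, in addition, $(\ast)$ holds for some $r>2$ and $\sigma_{n,m,k}\ge\lambda>0$ for a constant $\lambda$ not depending on $n$, then $\sigma_{n,m,k}^{-1}\sqrt n\,U_{n,k}\xrightarrow{d}\mathcal N(0,1)$.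
   Context: A sequence $\{W_i\}_{i\ge1}$ of random elements of a standard Borel space is $m$-dependent if for every $s\ge1$ the $\sigma$-fields $\sigma(W_1,\dots,W_s)$ and $\sigma(W_{s+m+j}:j\ge1)$ are independent. A $k$-tuple of distinct indices is lag-generic if every pair of its coordinates is more than $m$ apart. The kernel $\varphi(w_1,\dots,w_k)$ is real-valued, measurable, symmetric, and centred on lag-generic tuples: $E[\varphi(W_{i_1},\dots,W_{i_k})]=0$ for every lag-generic $(i_1,\dots,i_k)$. With $[n]=\{1,\dots,n\}$ and $\mathcal P(n,k)=n(n-1)\cdots(n-k+1)$, $U_{n,k}=\frac1{\mathcal P(n,k)}\sum\varphi(W_{i_1},\dots,W_{i_k})$, the sum over ordered $k$-tuples of distinct indices in $[n]$. For $\mathbf j=(j_2,\dots,j_k)$, $\varphi^{(1)}_{\mathbf j}(W_i)=E[\varphi(W_i,W_{j_2},\dots,W_{j_k})\mid W_i]$. $Q_i$ is the number of ordered tuples $\mathbf j$ in $[n]$ for which $(i,\mathbf j)$ is lag-generic (positive for large $n$), and $\bar\varphi^{(1)}_{n,m,k,i}(W_i)=\frac1{Q_i}\sum_{\mathbf j:\,(i,\mathbf j)\text{ lag-generic}}\varphi^{(1)}_{\mathbf j}(W_i)$. $\sigma_{n,m,k}\ge0$ is given by $\sigma_{n,m,k}^2=\frac{k^2}n\operatorname{Var}\big[\sum_{i=1}^n\bar\varphi^{(1)}_{n,m,k,i}(W_i)\big]$. *)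

theory Defs
  imports "HOL-Probability.Probability"
begin

definition standard_borel :: "'b measure \<Rightarrow> bool" where
  "standard_borel S \<longleftrightarrow> (\<exists>X. completely_metrizable_space X \<and> separable_space X \<and>
     space S = topspace X \<and> sets S = sigma_sets (topspace X) {U. openin X U})"

definition sigma_field ::
    "'a measure \<Rightarrow> 'b measure \<Rightarrow> (nat \<Rightarrow> 'a \<Rightarrow> 'b) \<Rightarrow> nat set \<Rightarrow> 'a set set" where
  "sigma_field M S W I =
     sigma_sets (space M) (\<Union>i\<in>I. {W i -` A \<inter> space M | A. A \<in> sets S})"

text \<open>Sequences are indexed by the integers \<open>i \<ge> 1\<close>; the value \<open>W 0\<close> is never used.\<close>

definition m_dependent ::
    "'a measure \<Rightarrow> 'b measure \<Rightarrow> nat \<Rightarrow> (nat \<Rightarrow> 'a \<Rightarrow> 'b) \<Rightarrow> bool" where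
  "m_dependent M S m W \<longleftrightarrow>
     (\<forall>s\<ge>1. prob_space.indep_set M (sigma_field M S W {1..s})
                                    (sigma_field M S W {s + m + j | j. 1 \<le> j}))"

text \<open>
  A \<open>k\<close>-tuple is an extensional function on \<open>{1..k}\<close>, so \<open>[n]\<^sup>k\<close> is
  \<open>{1..k} \<rightarrow>\<^sub>E {1..n}\<close>, and \<open>(j\<^sub>2, \<dots>, j\<^sub>k)\<close> is an extensional function on \<open>{2..k}\<close>,
  written \<open>js\<close>, which \<open>js(1 := i)\<close> turns into \<open>(i, j\<^sub>2, \<dots>, j\<^sub>k)\<close>.
  Being lag-generic includes having distinct coordinates, as \<open>m \<ge> 0\<close>.
\<close>

definition lag_generic :: "nat \<Rightarrow> nat \<Rightarrow> (nat \<Rightarrow> nat) \<Rightarrow> bool" where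
  "lag_generic m k i \<longleftrightarrow>
     (\<forall>a\<in>{1..k}. \<forall>b\<in>{1..k}. a \<noteq> b \<longrightarrow> int m < \<bar>int (i a) - int (i b)\<bar>)"

definition symmetric_kernel :: "'b measure \<Rightarrow> nat \<Rightarrow> ((nat \<Rightarrow> 'b) \<Rightarrow> real) \<Rightarrow> bool" where
  "symmetric_kernel S k \<phi> \<longleftrightarrow>
     (\<forall>p x. p permutes {1..k} \<longrightarrow> x \<in> space (\<Pi>\<^sub>M l\<in>{1..k}. S) \<longrightarrow> \<phi> (x \<circ> p) = \<phi> x)"

definition kernel_at ::
    "nat \<Rightarrow> ((nat \<Rightarrow> 'b) \<Rightarrow> real) \<Rightarrow> (nat \<Rightarrow> 'a \<Rightarrow> 'b) \<Rightarrow> (nat \<Rightarrow> nat) \<Rightarrow> 'a \<Rightarrow> real" where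
  "kernel_at k \<phi> W i \<omega> = \<phi> (\<lambda>l\<in>{1..k}. W (i l) \<omega>)"

definition centred_on_lag_generic ::
    "'a measure \<Rightarrow> nat \<Rightarrow> nat \<Rightarrow> ((nat \<Rightarrow> 'b) \<Rightarrow> real) \<Rightarrow> (nat \<Rightarrow> 'a \<Rightarrow> 'b) \<Rightarrow> bool" where
  "centred_on_lag_generic M m k \<phi> W \<longleftrightarrow>
     (\<forall>i \<in> {1..k} \<rightarrow>\<^sub>E {1..}. lag_generic m k i \<longrightarrow> has_bochner_integral M (kernel_at k \<phi> W i) 0)"

text \<open>The expectations are taken in \<open>[0, \<infinity>]\<close>, so that no integrability is presupposed.\<close>

definition kernel_unif_integrable ::
    "'a measure \<Rightarrow> nat \<Rightarrow> ((nat \<Rightarrow> 'b) \<Rightarrow> real) \<Rightarrow> (nat \<Rightarrow> 'a \<Rightarrow> 'b) \<Rightarrow> real \<Rightarrow> bool" where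
  "kernel_unif_integrable M k \<phi> W r \<longleftrightarrow>
     ((\<lambda>K::real. SUP n::nat. SUP i \<in> {1..k} \<rightarrow>\<^sub>E {1..n}.
         \<integral>\<^sup>+\<omega>. ennreal (\<bar>kernel_at k \<phi> W i \<omega>\<bar> powr r) *
              indicator {\<omega>. \<bar>kernel_at k \<phi> W i \<omega>\<bar> > K} \<omega> \<partial>M) \<longlongrightarrow> 0) at_top"

definition U_stat ::
    "nat \<Rightarrow> ((nat \<Rightarrow> 'b) \<Rightarrow> real) \<Rightarrow> (nat \<Rightarrow> 'a \<Rightarrow> 'b) \<Rightarrow> nat \<Rightarrow> 'a \<Rightarrow> real" where
  "U_stat k \<phi> W n \<omega> =
     1 / (\<Prod>l<k. real n - real l) *
     (\<Sum>i | i \<in> {1..k} \<rightarrow>\<^sub>E {1..n} \<and> inj_on i {1..k}. kernel_at k \<phi> W i \<omega>)"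

text \<open>A version of \<open>E[\<phi>(W\<^sub>i, W\<^bsub>j\<^sub>2\<^esub>, \<dots>, W\<^bsub>j\<^sub>k\<^esub>) | W\<^sub>i]\<close>, as a random variable.\<close>

definition proj1 ::
    "'a measure \<Rightarrow> 'b measure \<Rightarrow> nat \<Rightarrow> ((nat \<Rightarrow> 'b) \<Rightarrow> real) \<Rightarrow> (nat \<Rightarrow> 'a \<Rightarrow> 'b) \<Rightarrow>
      nat \<Rightarrow> (nat \<Rightarrow> nat) \<Rightarrow> 'a \<Rightarrow> real" where
  "proj1 M S k \<phi> W i js =
     real_cond_exp M (vimage_algebra (space M) (W i) S) (kernel_at k \<phi> W (js(1 := i)))"

definition generic_completions :: "nat \<Rightarrow> nat \<Rightarrow> nat \<Rightarrow> nat \<Rightarrow> (nat \<Rightarrow> nat) set" where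
  "generic_completions m k n i = {js \<in> {2..k} \<rightarrow>\<^sub>E {1..n}. lag_generic m k (js(1 := i))}"

text \<open>If \<open>Q\<^sub>i = 0\<close>, which is possible for small \<open>n\<close> only, the average below is \<open>0\<close>.\<close>

definition avg_proj1 ::
    "'a measure \<Rightarrow> 'b measure \<Rightarrow> nat \<Rightarrow> nat \<Rightarrow> ((nat \<Rightarrow> 'b) \<Rightarrow> real) \<Rightarrow> (nat \<Rightarrow> 'a \<Rightarrow> 'b) \<Rightarrow>
      nat \<Rightarrow> nat \<Rightarrow> 'a \<Rightarrow> real" where
  "avg_proj1 M S m k \<phi> W n i \<omega> =
     1 / real (card (generic_completions m k n i)) *
     (\<Sum>js \<in> generic_completions m k n i. proj1 M S k \<phi> W i js \<omega>)"

definition sigma_U ::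
    "'a measure \<Rightarrow> 'b measure \<Rightarrow> nat \<Rightarrow> nat \<Rightarrow> ((nat \<Rightarrow> 'b) \<Rightarrow> real) \<Rightarrow> (nat \<Rightarrow> 'a \<Rightarrow> 'b) \<Rightarrow>
      nat \<Rightarrow> real" where
  "sigma_U M S m k \<phi> W n =
     sqrt ((real k)\<^sup>2 / real n *
       prob_space.variance M (\<lambda>\<omega>. \<Sum>i=1..n. avg_proj1 M S m k \<phi> W n i \<omega>))"

text \<open>\<open>X\<^sub>n = O\<^sub>p(a\<^sub>n)\<close> and \<open>X\<^sub>n = o\<^sub>p(a\<^sub>n)\<close> as \<open>n \<rightarrow> \<infinity>\<close>.\<close>

definition bigO_p :: "'a measure \<Rightarrow> (nat \<Rightarrow> 'a \<Rightarrow> real) \<Rightarrow> (nat \<Rightarrow> real) \<Rightarrow> bool" where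
  "bigO_p M X a \<longleftrightarrow>
     (\<forall>\<epsilon>>0. \<exists>C>0. \<forall>\<^sub>F n in sequentially.
        measure M {\<omega> \<in> space M. \<bar>X n \<omega>\<bar> > C * \<bar>a n\<bar>} \<le> \<epsilon>)"

definition smallo_p :: "'a measure \<Rightarrow> (nat \<Rightarrow> 'a \<Rightarrow> real) \<Rightarrow> (nat \<Rightarrow> real) \<Rightarrow> bool" where
  "smallo_p M X a \<longleftrightarrow>
     (\<forall>\<epsilon>>0. (\<lambda>n. measure M {\<omega> \<in> space M. \<bar>X n \<omega>\<bar> > \<epsilon> * \<bar>a n\<bar>}) \<longlonglongrightarrow> 0)"

end

theory Submission
  imports Defs
begin

text \<open>
  On a lag-generic tuple the coordinates are independent, so \<open>\<phi>(W\<^sub>i)\<close> splits into the sum of its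
  projections onto the single coordinates and a degenerate part. Two degenerate parts are
  orthogonal unless at least two coordinates of the one tuple are within distance \<open>m\<close> of
  coordinates of the other, which happens for \<open>O(n\<^bsup>2k-2\<^esup>)\<close> pairs only; so their normalized sum is
  \<open>O(1/n)\<close> in \<open>L\<^sup>2\<close>. The non-generic tuples, and the difference between the weights
  \<open>Q\<^sub>i / P(n,k)\<close> and \<open>1/n\<close>, contribute \<open>O(1/n)\<close> in \<open>L\<^sup>1\<close>. This gives (a), and (b) follows since the linear
  part is a sum of \<open>m\<close>-dependent centred variables.

  For (c), the characteristic function \<open>\<psi>\<close> of the normalized linear part \<open>\<Sum>X\<^sub>i\<close> is compared with
  the Gaussian one through the differential equation \<open>\<psi>'(t) = -t \<psi>(t) + error\<close>. To obtain it,
  expand \<open>E[X\<^sub>i e\<^bsup>itS\<^esup>]\<close> twice, first around the part of the sum that is independent of \<open>X\<^sub>i\<close>, and then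
  around the part that is independent of \<open>X\<^sub>i\<close> and its \<open>m\<close>-neighbours; the moments of order
  \<open>2 + d\<close> control the error.
\<close>

section \<open>Independence of separated blocks of an m-dependent sequence\<close>

text \<open>The definition of \<open>m_dependent\<close> cuts the sequence into one past and one
  future, whereas lag-generic tuples produce interleaved index sets. Everything therefore rests on
  \<open>indep_alg\<close>, the independence of arbitrary separated finite blocks. A second obstacle
  is that \<open>proj1\<close> is an abstract conditional expectation given one coordinate, while
  orthogonality tests the kernel against variables that may sit close to that coordinate and depend
  on it. An explicit regression function, obtained by Fubini, resolves this: the other coordinates
  are independent of the pair formed by the first coordinate and the test variable. Uniform
  integrability enters only as a moment bound uniform over all tuples. For (c) the sum is normalized
  exactly for each \<open>n\<close>, so the coefficient in the differential equation is exact; the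
  normalizing factor is \<open>O(n^(-1/2))\<close> by the lower bound on sigma, and \<open>n\<close>
  local errors of orders \<open>n^(-1-d/2)\<close> and \<open>n^(-3/2)\<close> add up to
  \<open>o(1)\<close>.\<close>

definition separated :: "nat \<Rightarrow> nat set \<Rightarrow> nat set \<Rightarrow> bool" where
  "separated m I J \<longleftrightarrow> (\<forall>i\<in>I. \<forall>j\<in>J. int m < \<bar>int i - int j\<bar>)"

lemma separated_sym: "separated m I J \<Longrightarrow> separated m J I"
  unfolding separated_def by (metis abs_minus_commute)

lemma separated_mono: "separated m I J \<Longrightarrow> I' \<subseteq> I \<Longrightarrow> J' \<subseteq> J \<Longrightarrow> separated m I' J'"
  unfolding separated_def by blast

lemma separated_disjoint: assumes "separated m I J" shows "I \<inter> J = {}"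
proof -
  have "int m < \<bar>int i - int i\<bar>" if "i \<in> I" "i \<in> J" for i
    using assms that unfolding separated_def by blast
  then show ?thesis by auto
qed

locale m_dependent_sequence = prob_space M for M :: "'a measure" +
  fixes S :: "'b measure" and m :: nat and W :: "nat \<Rightarrow> 'a \<Rightarrow> 'b"
  assumes W_measurable: "\<And>i. i \<ge> 1 \<Longrightarrow> W i \<in> measurable M S"
    and m_dep: "m_dependent M S m W"
begin

text \<open>The sigma-field of a block, packaged as a measure so that measurability with respect to
  it can be written with \<open>measurable (alg I)\<close>. Only its space and sets matter.\<close>

definition alg :: "nat set \<Rightarrow> 'a measure" where
  "alg I = sigma (space M) (\<Union>i\<in>I. {W i -` A \<inter> space M | A. A \<in> sets S})"

lemma space_alg [simp]: "space (alg I) = space M"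
  unfolding alg_def by (rule space_measure_of) auto

lemma sets_alg: "sets (alg I) = sigma_field M S W I"
  unfolding alg_def sigma_field_def by (rule sets_measure_of) auto

lemma alg_mono: "I \<subseteq> J \<Longrightarrow> sets (alg I) \<subseteq> sets (alg J)"
  unfolding sets_alg sigma_field_def by (rule sigma_sets_mono') auto

lemma sets_alg_le: assumes "I \<subseteq> {1..}" shows "sets (alg I) \<subseteq> events"
  unfolding sets_alg sigma_field_def
proof (rule sets.sigma_sets_subset)
  show "(\<Union>i\<in>I. {W i -` A \<inter> space M | A. A \<in> sets S}) \<subseteq> events"
    using W_measurable assms by (auto intro!: measurable_sets)
qed

lemma measurable_alg_mono:
  assumes "f \<in> measurable (alg I) N" "I \<subseteq> J"
  shows "f \<in> measurable (alg J) N"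
  using assms alg_mono[OF assms(2)] by (auto simp: measurable_def)

lemma measurable_alg_M:
  assumes "f \<in> measurable (alg I) N" "I \<subseteq> {1..}"
  shows "f \<in> measurable M N"
  using assms sets_alg_le[OF assms(2)] by (auto simp: measurable_def)

lemma W_space: "i \<ge> 1 \<Longrightarrow> \<omega> \<in> space M \<Longrightarrow> W i \<omega> \<in> space S"
  using W_measurable by (auto dest: measurable_space)

lemma W_alg:
  assumes "i \<in> I" "I \<subseteq> {1..}"
  shows "W i \<in> measurable (alg I) S"
proof (rule measurableI)
  show "W i \<omega> \<in> space S" if "\<omega> \<in> space (alg I)" for \<omega>
    using that W_space assms by auto
  show "W i -` A \<inter> space (alg I) \<in> sets (alg I)" if "A \<in> sets S" for A
    unfolding sets_alg sigma_field_def using that assms by (auto intro!: sigma_sets.Basic)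
qed

definition cylinder :: "nat set \<Rightarrow> (nat \<Rightarrow> 'b set) \<Rightarrow> 'a set" where
  "cylinder I A = {\<omega> \<in> space M. \<forall>i\<in>I. W i \<omega> \<in> A i}"

lemma cylinder_Un: "cylinder (I \<union> J) A = cylinder I A \<inter> cylinder J A"
  unfolding cylinder_def by auto

lemma cylinder_empty [simp]: "cylinder {} A = space M"
  unfolding cylinder_def by auto

lemma cylinder_alg:
  assumes "finite I" "I \<subseteq> J" "J \<subseteq> {1..}" "\<And>i. i \<in> I \<Longrightarrow> A i \<in> sets S"
  shows "cylinder I A \<in> sets (alg J)"
proof -
  have W: "W i -` A i \<inter> space M \<in> sets (alg J)" if "i \<in> I" for i
    using measurable_sets[OF W_alg, of i J "A i"] assms that by auto
  have "space M \<in> sets (alg J)"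
    using sets.top[of "alg J"] by simp
  moreover have "(\<Inter>i\<in>I. W i -` A i \<inter> space M) \<in> sets (alg J)" if "I \<noteq> {}"
    using assms(1) W that by (intro sets.finite_INT)
  ultimately have "(\<Inter>i\<in>I. W i -` A i \<inter> space M) \<inter> space M \<in> sets (alg J)"
    by (cases "I = {}") auto
  also have "(\<Inter>i\<in>I. W i -` A i \<inter> space M) \<inter> space M = cylinder I A"
    unfolding cylinder_def by auto
  finally show ?thesis .
qed

text \<open>Past and future are split at \<open>s = Max I\<close>; everything of \<open>J\<close> beyond \<open>s\<close> is a pure future.\<close>

lemma cylinder_indep_step:
  assumes IH: "\<And>I' J'. card I' + card J' < card I + card J \<Longrightarrow> finite I' \<Longrightarrow> finite J' \<Longrightarrow>
      I' \<subseteq> {1..} \<Longrightarrow> J' \<subseteq> {1..} \<Longrightarrow> separated m I' J' \<Longrightarrow> I' \<union> J' \<subseteq> I \<union> J \<Longrightarrow>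
      prob (cylinder I' A \<inter> cylinder J' A) = prob (cylinder I' A) * prob (cylinder J' A)"
    and fin: "finite I" "finite J" and pos: "I \<subseteq> {1..}" "J \<subseteq> {1..}"
    and sep: "separated m I J" and A: "\<And>i. i \<in> I \<union> J \<Longrightarrow> A i \<in> sets S"
    and ne: "I \<noteq> {}" "J \<noteq> {}" and less: "Max I < Max J"
  shows "prob (cylinder I A \<inter> cylinder J A) = prob (cylinder I A) * prob (cylinder J A)"
proof -
  define s where "s = Max I"
  \<comment> \<open>\<open>J2\<close> joins \<open>I\<close> in the past of the cut. Since
    \<open>Max J\<close> lies in \<open>J1\<close>, the set \<open>J2\<close> is strictly smaller
    than \<open>J\<close>, so the induction hypothesis covers \<open>I\<close> and
    \<open>J2\<close>.\<close>
  define J1 where "J1 = {j\<in>J. s < j}"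
  define J2 where "J2 = {j\<in>J. j \<le> s}"
  have J: "J = J2 \<union> J1" by (auto simp: J1_def J2_def)
  have sI: "s \<in> I" and Ile: "I \<subseteq> {1..s}" using fin ne pos by (auto simp: s_def)
  \<comment> \<open>The cut \<open>s\<close> is itself a member of \<open>I\<close>, so separation
    pushes every later element of \<open>J\<close> beyond \<open>s + m\<close>, exactly where the
    future sigma-field at \<open>s\<close> begins.\<close>
  have J1far: "j > s + m" if "j \<in> J1" for j
  proof -
    have "j \<in> J" and "s < j" using that by (simp_all add: J1_def)
    then have "int m < \<bar>int s - int j\<bar>" using sep sI unfolding separated_def by blast
    with \<open>s < j\<close> show ?thesis by linarith
  qed
  have "Max J \<in> J1" using fin ne less by (auto simp: J1_def s_def)
  have "card J2 < card J"
  proof (rule psubset_card_mono[OF fin(2)])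
    have "Max J \<in> J" "Max J \<notin> J2" using \<open>Max J \<in> J1\<close> by (auto simp: J1_def J2_def)
    then show "J2 \<subset> J" by (auto simp: J2_def)
  qed
  have ind: "indep_set (sets (alg {1..s})) (sets (alg {s + m + j | j. 1 \<le> j}))"
  proof -
    have "1 \<le> s" using sI pos by auto
    then show ?thesis using m_dep unfolding m_dependent_def sets_alg by blast
  qed
  have c1: "cylinder J1 A \<in> sets (alg {s + m + j | j. 1 \<le> j})"
  proof (rule cylinder_alg)
    show "J1 \<subseteq> {s + m + j |j. 1 \<le> j}"
    proof
      fix j assume "j \<in> J1"
      then have "j = s + m + (j - s - m)" "1 \<le> j - s - m" using J1far[of j] by auto
      then show "j \<in> {s + m + j |j. 1 \<le> j}" by blast
    qed
  qed (use A fin in \<open>auto simp: J1_def\<close>)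
  \<comment> \<open>Used twice: with \<open>I' = I \<union> J2\<close> to peel \<open>J1\<close> off
    the whole event, and with \<open>I' = J2\<close> to glue \<open>J1\<close> back on after
    \<open>I\<close> and \<open>J2\<close> have been split.\<close>
  have mult: "prob (cylinder I' A \<inter> cylinder J1 A) = prob (cylinder I' A) * prob (cylinder J1 A)"
    if "I' \<subseteq> {1..s}" "I' \<subseteq> I \<union> J" for I'
  proof (rule indep_setD[OF ind _ c1], rule cylinder_alg)
    show "finite I'" using that(1) finite_subset by blast
  qed (use that A in auto)
  have J2le: "J2 \<subseteq> {1..s}" using pos by (auto simp: J2_def)
  have "prob (cylinder I A \<inter> cylinder J A) = prob (cylinder (I \<union> J2) A \<inter> cylinder J1 A)"
    by (simp add: J cylinder_Un Int_assoc)
  also have "\<dots> = prob (cylinder (I \<union> J2) A) * prob (cylinder J1 A)"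
    by (rule mult) (use Ile J2le J in auto)
  also have "prob (cylinder (I \<union> J2) A) = prob (cylinder I A) * prob (cylinder J2 A)"
    unfolding cylinder_Un
  proof (rule IH)
    show "separated m I J2" by (rule separated_mono[OF sep]) (auto simp: J2_def)
  qed (use fin pos \<open>card J2 < card J\<close> in \<open>auto simp: J2_def\<close>)
  also have "\<dots> * prob (cylinder J1 A) = prob (cylinder I A) * (prob (cylinder J2 A) * prob (cylinder J1 A))"
    by simp
  also have "prob (cylinder J2 A) * prob (cylinder J1 A) = prob (cylinder J A)"
    unfolding J cylinder_Un by (rule mult[symmetric]) (use J2le J in auto)
  finally show ?thesis .
qed

text \<open>As \<open>I\<close> and \<open>J\<close> may interleave, a single cut does not separate
  them. The induction on the total cardinality strips, from the set with the larger maximum, its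
  tail beyond the maximum of the other. Separation excludes equal maxima, and symmetry covers the
  two orders.\<close>

lemma cylinder_indep:
  assumes "finite I" "finite J" "I \<subseteq> {1..}" "J \<subseteq> {1..}" "separated m I J"
    "\<And>i. i \<in> I \<union> J \<Longrightarrow> A i \<in> sets S"
  shows "prob (cylinder I A \<inter> cylinder J A) = prob (cylinder I A) * prob (cylinder J A)"
  using assms
proof (induction "card I + card J" arbitrary: I J rule: less_induct)
  case less
  have IH: "prob (cylinder I' A \<inter> cylinder J' A) = prob (cylinder I' A) * prob (cylinder J' A)"
    if "card I' + card J' < card I + card J" "finite I'" "finite J'"
      "I' \<subseteq> {1..}" "J' \<subseteq> {1..}" "separated m I' J'" "I' \<union> J' \<subseteq> I \<union> J" for I' J'
    by (rule less.hyps) (use that less.prems in auto)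
  have space: "cylinder K A \<inter> space M = cylinder K A" "space M \<inter> cylinder K A = cylinder K A" for K
    by (auto simp: cylinder_def)
  show ?case
  proof (cases "I = {} \<or> J = {}")
    case True
    then show ?thesis by (auto simp: space prob_space)
  next
    case False
    have "Max I \<noteq> Max J"
    proof
      assume "Max I = Max J"
      moreover have "int m < \<bar>int (Max I) - int (Max J)\<bar>"
        using less.prems(5) False Max_in[OF less.prems(1)] Max_in[OF less.prems(2)]
        unfolding separated_def by blast
      ultimately show False by simp
    qed
    then consider "Max I < Max J" | "Max J < Max I" by linarith
    then show ?thesis
    proof cases
      case 1
      show ?thesis
        by (rule cylinder_indep_step[OF IH less.prems]) (use 1 False in simp_all)
    next
      case 2
      have IH': "prob (cylinder I' A \<inter> cylinder J' A) = prob (cylinder I' A) * prob (cylinder J' A)"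
        if "card I' + card J' < card J + card I" "finite I'" "finite J'"
          "I' \<subseteq> {1..}" "J' \<subseteq> {1..}" "separated m I' J'" "I' \<union> J' \<subseteq> J \<union> I" for I' J'
        by (rule IH) (use that in auto)
      have "prob (cylinder J A \<inter> cylinder I A) = prob (cylinder J A) * prob (cylinder I A)"
        by (rule cylinder_indep_step[OF IH' less.prems(2,1,4,3) separated_sym[OF less.prems(5)]])
           (use 2 False less.prems(6) in auto)
      then show ?thesis by (simp add: Int_commute mult.commute)
    qed
  qed
qed

text \<open>Unlike the preimages that define \<open>alg I\<close>, the cylinders are closed under
  intersection, which the pi-lambda argument in \<open>indep_alg\<close> requires.\<close>

lemma alg_cylinders:
  assumes "finite I" "I \<subseteq> {1..}"
  shows "sets (alg I) = sigma_sets (space M) {cylinder I A | A. \<forall>i\<in>I. A i \<in> sets S}"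
proof
  show "sigma_sets (space M) {cylinder I A | A. \<forall>i\<in>I. A i \<in> sets S} \<subseteq> sets (alg I)"
    using sets.sigma_sets_subset[of "{cylinder I A | A. \<forall>i\<in>I. A i \<in> sets S}" "alg I"]
      cylinder_alg[OF assms(1) subset_refl assms(2)] by auto
  show "sets (alg I) \<subseteq> sigma_sets (space M) {cylinder I A | A. \<forall>i\<in>I. A i \<in> sets S}"
    unfolding sets_alg sigma_field_def
  proof (rule sigma_sets_mono', safe)
    fix i A assume i: "i \<in> I" and A: "A \<in> sets S"
    have "W i -` A \<inter> space M = cylinder I (\<lambda>j. if j = i then A else space S)"
      using i assms(2) W_space by (auto simp: cylinder_def split: if_splits)
    then show "\<exists>Aa. W i -` A \<inter> space M = cylinder I Aa \<and> (\<forall>i\<in>I. Aa i \<in> sets S)"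
      using A by (intro exI[of _ "\<lambda>j. if j = i then A else space S"]) auto
  qed
qed

lemma indep_alg:
  assumes "finite I" "finite J" "I \<subseteq> {1..}" "J \<subseteq> {1..}" and sep: "separated m I J"
  shows "indep_set (sets (alg I)) (sets (alg J))"
proof -
  have stable: "Int_stable {cylinder I A | A. \<forall>i\<in>I. A i \<in> sets S}" for I
  proof (rule Int_stableI, clarify)
    fix A B assume "\<forall>i\<in>I. A i \<in> sets S" "\<forall>i\<in>I. B i \<in> sets S"
    then show "\<exists>C. cylinder I A \<inter> cylinder I B = cylinder I C \<and> (\<forall>i\<in>I. C i \<in> sets S)"
      by (intro exI[of _ "\<lambda>i. A i \<inter> B i"]) (auto simp: cylinder_def)
  qed
  have events: "cylinder K A \<in> events" if "finite K" "K \<subseteq> {1..}" "\<forall>i\<in>K. A i \<in> sets S" for K A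
    using cylinder_alg[OF that(1) subset_refl that(2)] sets_alg_le[OF that(2)] that(3) by auto
  have "indep_set {cylinder I A | A. \<forall>i\<in>I. A i \<in> sets S} {cylinder J A | A. \<forall>i\<in>J. A i \<in> sets S}"
  proof (rule indep_setI)
    fix a b
    assume "a \<in> {cylinder I A | A. \<forall>i\<in>I. A i \<in> sets S}" "b \<in> {cylinder J A | A. \<forall>i\<in>J. A i \<in> sets S}"
    then obtain A B where A: "a = cylinder I A" "\<forall>i\<in>I. A i \<in> sets S"
      and B: "b = cylinder J B" "\<forall>i\<in>J. B i \<in> sets S" by auto
    \<comment> \<open>\<open>cylinder_indep\<close> uses one family of sets for both blocks;
      disjointness of \<open>I\<close> and \<open>J\<close> allows the two families to be
      merged.\<close>
    define C where "C = (\<lambda>i. if i \<in> I then A i else B i)"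
    have "I \<inter> J = {}" using sep by (rule separated_disjoint)
    then have "a = cylinder I C" "b = cylinder J C"
      using A B by (auto simp: cylinder_def C_def)
    moreover have "\<And>i. i \<in> I \<union> J \<Longrightarrow> C i \<in> sets S" using A B by (auto simp: C_def)
    ultimately show "prob (a \<inter> b) = prob a * prob b"
      using cylinder_indep[OF assms] by auto
  qed (use events assms in auto)
  from indep_set_sigma_sets[OF this stable stable] show ?thesis
    using alg_cylinders assms by simp
qed

lemma indep_var_alg:
  assumes "finite I" "finite J" "I \<subseteq> {1..}" "J \<subseteq> {1..}" "separated m I J"
    and X: "X \<in> measurable (alg I) N1" and Y: "Y \<in> measurable (alg J) N2"
  shows "indep_var N1 X N2 Y"
proof -
  have sub: "sigma_sets (space M) {X -` A \<inter> space M | A. A \<in> sets N} \<subseteq> sets (alg I)"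
    if "X \<in> measurable (alg I) N" for X I and N :: "'c measure"
    using sets.sigma_sets_subset[of "{X -` A \<inter> space M | A. A \<in> sets N}" "alg I"]
      measurable_sets[OF that] by auto
  have sub2: "sigma_sets (space M) {Y -` A \<inter> space M | A. A \<in> sets N2} \<subseteq> sets (alg J)"
    using sets.sigma_sets_subset[of "{Y -` A \<inter> space M | A. A \<in> sets N2}" "alg J"]
      measurable_sets[OF Y] by auto
  have "indep_set (sigma_sets (space M) {X -` A \<inter> space M | A. A \<in> sets N1})
      (sigma_sets (space M) {Y -` A \<inter> space M | A. A \<in> sets N2})"
    using indep_alg[OF assms(1-5)] unfolding indep_set_def
    by (rule indep_sets_mono_sets) (use sub[OF X] sub2 in \<open>auto split: bool.splits\<close>)
  then show ?thesis
    unfolding indep_var_eq using measurable_alg_M[OF X] measurable_alg_M[OF Y] assms by auto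
qed

text \<open>Stated over a general field, since real variables occur for covariances and complex
  exponentials for characteristic functions.\<close>

lemma expectation_mult_alg:
  fixes X Y :: "'a \<Rightarrow> 'c::{real_normed_field, banach, second_countable_topology}"
  assumes "finite I" "finite J" "I \<subseteq> {1..}" "J \<subseteq> {1..}" "separated m I J"
    and "X \<in> borel_measurable (alg I)" "Y \<in> borel_measurable (alg J)"
    and "integrable M X" "integrable M Y"
  shows "integrable M (\<lambda>\<omega>. X \<omega> * Y \<omega>)" "(\<integral>\<omega>. X \<omega> * Y \<omega> \<partial>M) = integral\<^sup>L M X * integral\<^sup>L M Y"
  using indep_var_integrable[OF indep_var_alg[OF assms(1-7)] assms(8,9)]
    indep_var_lebesgue_integral[OF indep_var_alg[OF assms(1-7)] assms(8,9)] by auto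

end

section \<open>A Gaussian bound for sums of m-dependent variables\<close>

lemma norm_iexp_minus_one_le:
  fixes x d :: real assumes "0 \<le> d" "d \<le> 1"
  shows "cmod (iexp x - 1) \<le> 2 * \<bar>x\<bar> powr d"
proof (cases "\<bar>x\<bar> \<le> 1")
  case True
  have "cmod (iexp x - 1) \<le> \<bar>x\<bar>" using iexp_approx1[of x 0] by simp
  also have "\<bar>x\<bar> \<le> \<bar>x\<bar> powr d"
    using powr_mono'[of d 1 "\<bar>x\<bar>"] True assms by (cases "x = 0") auto
  finally show ?thesis using powr_ge_zero[of "\<bar>x\<bar>" d] by linarith
next
  case False
  have "cmod (iexp x - 1) \<le> 2" using iexp_approx2[of x 0] by simp
  also have "1 \<le> \<bar>x\<bar> powr d" using False assms by (intro ge_one_powr_ge_zero) auto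
  then have "2 \<le> 2 * \<bar>x\<bar> powr d" by simp
  finally show ?thesis .
qed

text \<open>Interpolates between the quadratic Taylor bound near 0 and the linear bound away from 0,
  just as the preceding lemma interpolates between a linear and a constant bound. Replacing the
  exponents 2 and 1 by \<open>1 + d\<close> and \<open>d\<close> is what lets moments of order
  \<open>2 + d\<close> stand in for third moments.\<close>

lemma norm_iexp_minus_linear_le:
  fixes x d :: real assumes "0 \<le> d" "d \<le> 1"
  shows "cmod (iexp x - 1 - \<i> * x) \<le> 2 * \<bar>x\<bar> powr (1 + d)"
proof (cases "\<bar>x\<bar> \<le> 1")
  case True
  have "cmod (iexp x - 1 - \<i> * x) \<le> \<bar>x\<bar>\<^sup>2 / 2"
    using iexp_approx1[of x 1] by (simp add: power2_eq_square algebra_simps)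
  also have "\<bar>x\<bar>\<^sup>2 \<le> \<bar>x\<bar> powr (1 + d)"
    using powr_mono'[of "1 + d" 2 "\<bar>x\<bar>"] True assms by (cases "x = 0") auto
  finally show ?thesis using powr_ge_zero[of "\<bar>x\<bar>" "1 + d"] by linarith
next
  case False
  have "cmod (iexp x - 1 - \<i> * x) \<le> 2 * \<bar>x\<bar>"
    using iexp_approx2[of x 1] by (simp add: algebra_simps)
  also have "\<bar>x\<bar> \<le> \<bar>x\<bar> powr (1 + d)"
    using powr_mono[of 1 "1 + d" "\<bar>x\<bar>"] False assms by auto
  finally show ?thesis by simp
qed

text \<open>On a probability space this dominates every lower moment by one plus the highest one, at
  the price of constants of the form \<open>1 + C\<close> throughout.\<close>

lemma le_one_plus_powr:
  fixes x p q :: real assumes "0 \<le> x" "0 \<le> q" "q \<le> p"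
  shows "x powr q \<le> 1 + x powr p"
proof (cases "x \<le> 1")
  case True
  then have "x powr q \<le> 1" using assms by (intro powr_le1) auto
  then show ?thesis using powr_ge_zero[of x p] by linarith
next
  case False
  then show ?thesis using powr_mono[of q p x] assms by linarith
qed

text \<open>The sum is at most \<open>c\<close> times its largest term, and the power of that term
  is one of the summands on the right. This needs no convexity and works for every
  \<open>p \<ge> 0\<close>.\<close>

lemma powr_sum_le:
  fixes f :: "'i \<Rightarrow> real"
  assumes "finite N" "card N \<le> c" "0 \<le> p" "\<And>j. j \<in> N \<Longrightarrow> 0 \<le> f j"
  shows "(\<Sum>j\<in>N. f j) powr p \<le> real c powr p * (\<Sum>j\<in>N. f j powr p)"
proof (cases "N = {}")
  case False
  have "Max (f ` N) \<in> f ` N" using assms(1) False by (intro Max_in) auto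
  then obtain l where "l \<in> N" "f l = Max (f ` N)" by auto
  with assms(1) have l: "l \<in> N" "\<And>j. j \<in> N \<Longrightarrow> f j \<le> f l" by auto
  have "(\<Sum>j\<in>N. f j) \<le> real (card N) * f l" using sum_bounded_above[of N f "f l"] l by simp
  also have "\<dots> \<le> real c * f l" using assms l by (intro mult_right_mono) auto
  finally have "(\<Sum>j\<in>N. f j) powr p \<le> (real c * f l) powr p"
    using assms by (intro powr_mono2 sum_nonneg) auto
  also have "\<dots> = real c powr p * f l powr p" using assms l by (simp add: powr_mult)
  also have "f l powr p \<le> (\<Sum>j\<in>N. f j powr p)" using assms l by (intro member_le_sum) auto
  finally show ?thesis by (simp add: mult_left_mono)
qed simp

lemma norm_integral_le_integral:
  fixes f :: "'a \<Rightarrow> 'b::{banach, second_countable_topology}"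
  assumes "integrable M f" "integrable M g" "\<And>x. x \<in> space M \<Longrightarrow> norm (f x) \<le> g x"
  shows "norm (\<integral>x. f x \<partial>M) \<le> (\<integral>x. g x \<partial>M)"
  using integral_norm_bound[of M f] integral_mono[OF integrable_norm[OF assms(1)] assms(2,3)]
  by linarith

section \<open>Characteristic functions and one step of the expansion\<close>

context prob_space
begin

lemma integrable_iexp [simp]:
  assumes [measurable]: "X \<in> borel_measurable M"
  shows "integrable M (\<lambda>\<omega>. iexp (X \<omega>))"
  by (rule integrable_const_bound[where B = 1]) auto

lemma norm_expectation_iexp_diff_le:
  assumes [measurable]: "X \<in> borel_measurable M" "Y \<in> borel_measurable M"
    and "integrable M L" "\<And>\<omega>. \<omega> \<in> space M \<Longrightarrow> \<bar>X \<omega> - Y \<omega>\<bar> \<le> L \<omega>"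
  shows "cmod ((\<integral>\<omega>. iexp (X \<omega>) \<partial>M) - (\<integral>\<omega>. iexp (Y \<omega>) \<partial>M)) \<le> (\<integral>\<omega>. L \<omega> \<partial>M)"
proof -
  have "cmod (\<integral>\<omega>. iexp (X \<omega>) - iexp (Y \<omega>) \<partial>M) \<le> (\<integral>\<omega>. L \<omega> \<partial>M)"
  proof (rule norm_integral_le_integral)
    fix \<omega> assume \<omega>: "\<omega> \<in> space M"
    have "iexp (X \<omega>) - iexp (Y \<omega>) = iexp (Y \<omega>) * (iexp (X \<omega> - Y \<omega>) - 1)"
      by (simp add: algebra_simps flip: exp_add)
    then have "cmod (iexp (X \<omega>) - iexp (Y \<omega>)) = cmod (iexp (X \<omega> - Y \<omega>) - 1)"
      by (simp add: norm_mult)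
    also have "\<dots> \<le> \<bar>X \<omega> - Y \<omega>\<bar>" using iexp_approx1[of "X \<omega> - Y \<omega>" 0] by simp
    finally show "cmod (iexp (X \<omega>) - iexp (Y \<omega>)) \<le> L \<omega>" using assms(4)[OF \<omega>] by simp
  qed (use assms in auto)
  then show ?thesis by simp
qed

text \<open>Differentiation under the integral through the second-order Taylor bound: pointwise the
  error is at most \<open>h^2 * X^2\<close>, so a finite second moment makes the difference quotient
  converge at rate \<open>h\<close>.\<close>

lemma has_vector_derivative_expectation_iexp:
  assumes [measurable]: "X \<in> borel_measurable M" and X2: "integrable M (\<lambda>\<omega>. (X \<omega>)\<^sup>2)"
    and X1: "integrable M X"
  shows "((\<lambda>t. \<integral>\<omega>. iexp (t * X \<omega>) \<partial>M) has_vector_derivative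
           (\<integral>\<omega>. \<i> * X \<omega> * iexp (t * X \<omega>) \<partial>M)) (at t)"
proof -
  let ?f = "\<lambda>t. \<integral>\<omega>. iexp (t * X \<omega>) \<partial>M"
  let ?D = "\<integral>\<omega>. \<i> * X \<omega> * iexp (t * X \<omega>) \<partial>M"
  have int: "integrable M (\<lambda>\<omega>. \<i> * X \<omega> * iexp (t * X \<omega>))"
    by (rule Bochner_Integration.integrable_bound[OF X1]) (auto simp: norm_mult)
  have bound: "cmod (?f (t + h) - ?f t - h *\<^sub>R ?D) \<le> h\<^sup>2 * (\<integral>\<omega>. (X \<omega>)\<^sup>2 \<partial>M)" for h
  proof -
    have 1: "integrable M (\<lambda>\<omega>. iexp ((t + h) * X \<omega>))" "integrable M (\<lambda>\<omega>. iexp (t * X \<omega>))"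
      by (rule integrable_iexp, measurable)+
    have 2: "integrable M (\<lambda>\<omega>. h *\<^sub>R (\<i> * X \<omega> * iexp (t * X \<omega>)))"
      using int by (rule integrable_scaleR_right)
    have "?f (t + h) - ?f t - h *\<^sub>R ?D =
        (\<integral>\<omega>. iexp ((t + h) * X \<omega>) - iexp (t * X \<omega>) - h *\<^sub>R (\<i> * X \<omega> * iexp (t * X \<omega>)) \<partial>M)"
      by (simp only: Bochner_Integration.integral_diff[OF Bochner_Integration.integrable_diff[OF 1] 2]
            Bochner_Integration.integral_diff[OF 1] integral_scaleR_right)
    also have "cmod \<dots> \<le> (\<integral>\<omega>. h\<^sup>2 * (X \<omega>)\<^sup>2 \<partial>M)"
    proof (rule norm_integral_le_integral)
      fix \<omega> assume "\<omega> \<in> space M"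
      have "iexp ((t + h) * X \<omega>) - iexp (t * X \<omega>) - h *\<^sub>R (\<i> * X \<omega> * iexp (t * X \<omega>))
          = iexp (t * X \<omega>) * (iexp (h * X \<omega>) - 1 - \<i> * (h * X \<omega>))"
        by (simp add: algebra_simps scaleR_conv_of_real flip: exp_add)
      then have "cmod (iexp ((t + h) * X \<omega>) - iexp (t * X \<omega>) - h *\<^sub>R (\<i> * X \<omega> * iexp (t * X \<omega>)))
          = cmod (iexp (h * X \<omega>) - 1 - \<i> * (h * X \<omega>))"
        by (simp add: norm_mult)
      also have "\<dots> \<le> \<bar>h * X \<omega>\<bar>\<^sup>2 / 2"
        using iexp_approx1[of "h * X \<omega>" 1] by (simp add: power2_eq_square algebra_simps)
      also have "\<dots> \<le> h\<^sup>2 * (X \<omega>)\<^sup>2" by (simp add: power_mult_distrib)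
      finally show "cmod (iexp ((t + h) * X \<omega>) - iexp (t * X \<omega>) - h *\<^sub>R (\<i> * X \<omega> * iexp (t * X \<omega>)))
          \<le> h\<^sup>2 * (X \<omega>)\<^sup>2" .
    qed (intro Bochner_Integration.integrable_diff 1 2 integrable_mult_right X2)+
    finally show ?thesis by simp
  qed
  have "(\<lambda>h. norm (?f (t + h) - ?f t - h *\<^sub>R ?D) / norm h) \<midarrow>0\<rightarrow> 0"
  proof (rule tendsto_sandwich)
    show "\<forall>\<^sub>F h in at 0. norm (?f (t + h) - ?f t - h *\<^sub>R ?D) / norm h \<le> \<bar>h\<bar> * (\<integral>\<omega>. (X \<omega>)\<^sup>2 \<partial>M)"
    proof (intro always_eventually allI)
      fix h :: real
      show "norm (?f (t + h) - ?f t - h *\<^sub>R ?D) / norm h \<le> \<bar>h\<bar> * (\<integral>\<omega>. (X \<omega>)\<^sup>2 \<partial>M)"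
        using divide_right_mono[OF bound[of h], of "\<bar>h\<bar>"]
        by (cases "h = 0") (simp_all add: power2_eq_square field_simps abs_mult_self_eq flip: abs_mult)
    qed
    show "\<forall>\<^sub>F h in at 0. 0 \<le> norm (?f (t + h) - ?f t - h *\<^sub>R ?D) / norm h" by simp
    show "(\<lambda>h::real. \<bar>h\<bar> * (\<integral>\<omega>. (X \<omega>)\<^sup>2 \<partial>M)) \<midarrow>0\<rightarrow> 0" by (auto intro!: tendsto_eq_intros)
  qed auto
  then show ?thesis
    unfolding has_vector_derivative_def has_derivative_at
    by (auto intro!: bounded_linear_intros)
qed

text \<open>One summand of Stein's method under local dependence: \<open>T\<close> is the part of the sum that
  depends on \<open>X\<close>, and \<open>V\<close> the part that depends on \<open>(X, T)\<close> but not on \<open>X\<close>.\<close>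

lemma stein_local_step:
  fixes X T V R L :: "'a \<Rightarrow> real"
  assumes [measurable]: "X \<in> borel_measurable M" "T \<in> borel_measurable M" "V \<in> borel_measurable M"
      "R \<in> borel_measurable M" "L \<in> borel_measurable M"
    and d: "0 < d" "d \<le> 1"
    and bd: "\<And>\<omega>. \<bar>X \<omega>\<bar> \<le> L \<omega>" "\<And>\<omega>. \<bar>T \<omega>\<bar> \<le> L \<omega>" "\<And>\<omega>. \<bar>V \<omega>\<bar> \<le> L \<omega>" "\<And>\<omega>. \<bar>T \<omega> + V \<omega>\<bar> \<le> L \<omega>"
    and Lp: "integrable M (\<lambda>\<omega>. L \<omega> powr (2 + d))"
    and X0: "(\<integral>\<omega>. X \<omega> * iexp (t * (V \<omega> + R \<omega>)) \<partial>M) = 0"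
    and XT: "(\<integral>\<omega>. (X \<omega> * T \<omega>) * iexp (t * R \<omega>) \<partial>M) =
               (\<integral>\<omega>. X \<omega> * T \<omega> \<partial>M) * (\<integral>\<omega>. iexp (t * R \<omega>) \<partial>M)"
  shows "cmod ((\<integral>\<omega>. X \<omega> * iexp (t * (T \<omega> + V \<omega> + R \<omega>)) \<partial>M)
           - \<i> * t * (\<integral>\<omega>. X \<omega> * T \<omega> \<partial>M) * (\<integral>\<omega>. iexp (t * (T \<omega> + V \<omega> + R \<omega>)) \<partial>M))
         \<le> 4 * \<bar>t\<bar> powr (1 + d) * (\<integral>\<omega>. L \<omega> powr (2 + d) \<partial>M)
             + t\<^sup>2 * (\<integral>\<omega>. (L \<omega>)\<^sup>2 \<partial>M) * (\<integral>\<omega>. L \<omega> \<partial>M)"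
proof -
  have L0: "0 \<le> L \<omega>" for \<omega> using bd(1)[of \<omega>] by simp
  have L1: "integrable M L"
    by (rule Bochner_Integration.integrable_bound[of M "\<lambda>\<omega>. 1 + L \<omega> powr (2 + d)"])
       (use Lp L0 le_one_plus_powr[of "L _" 1 "2 + d"] d in auto)
  have L2: "integrable M (\<lambda>\<omega>. (L \<omega>)\<^sup>2)"
    by (rule Bochner_Integration.integrable_bound[of M "\<lambda>\<omega>. 1 + L \<omega> powr (2 + d)"])
       (use Lp L0 le_one_plus_powr[of "L _" 2 "2 + d"] d in auto)
  have X1: "integrable M (\<lambda>\<omega>. complex_of_real (X \<omega>) * iexp (Y \<omega>))"
    if [measurable]: "Y \<in> borel_measurable M" for Y
    by (rule Bochner_Integration.integrable_bound[OF L1]) (use bd L0 in \<open>auto simp: norm_mult\<close>)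
  have LL: "\<bar>X \<omega> * T \<omega>\<bar> \<le> (L \<omega>)\<^sup>2" for \<omega>
    unfolding power2_eq_square abs_mult by (intro mult_mono bd L0) auto
  have XTint: "integrable M (\<lambda>\<omega>. X \<omega> * T \<omega>)"
    by (rule Bochner_Integration.integrable_bound[OF L2]) (use LL in \<open>auto simp: abs_mult\<close>)
  have XT1: "integrable M (\<lambda>\<omega>. complex_of_real (X \<omega> * T \<omega>) * iexp (Y \<omega>))"
    if [measurable]: "Y \<in> borel_measurable M" for Y
    by (rule Bochner_Integration.integrable_bound[OF L2]) (use LL in \<open>auto simp: norm_mult abs_mult\<close>)
  \<comment> \<open>\<open>A\<close> is the error of the first-order expansion in \<open>T\<close>,
    whose zeroth term vanishes by \<open>X0\<close>. \<open>C\<close> is the error of dropping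
    \<open>V\<close>, after which \<open>XT\<close> applies. \<open>E\<close> is the error of
    putting \<open>T + V\<close> back into the characteristic function. The quantity to bound is
    \<open>A + \<i> * t * C + \<i> * t * E[X * T] * E\<close>.\<close>
  define A where "A = (\<integral>\<omega>. X \<omega> * iexp (t * (T \<omega> + V \<omega> + R \<omega>)) - X \<omega> * iexp (t * (V \<omega> + R \<omega>))
        - \<i> * t * ((X \<omega> * T \<omega>) * iexp (t * (V \<omega> + R \<omega>))) \<partial>M)"
  define C where "C = (\<integral>\<omega>. (X \<omega> * T \<omega>) * iexp (t * (V \<omega> + R \<omega>)) - (X \<omega> * T \<omega>) * iexp (t * R \<omega>) \<partial>M)"
  define E where "E = (\<integral>\<omega>. iexp (t * R \<omega>) \<partial>M) - (\<integral>\<omega>. iexp (t * (T \<omega> + V \<omega> + R \<omega>)) \<partial>M)"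
  have Lsplit1: "L \<omega> * (2 * \<bar>t * T \<omega>\<bar> powr (1 + d)) \<le> 2 * \<bar>t\<bar> powr (1 + d) * L \<omega> powr (2 + d)" for \<omega>
  proof -
    have "\<bar>t * T \<omega>\<bar> powr (1 + d) \<le> \<bar>t\<bar> powr (1 + d) * L \<omega> powr (1 + d)"
      using bd(2)[of \<omega>] d by (simp add: abs_mult powr_mult mult_left_mono powr_mono2)
    then have "L \<omega> * (2 * \<bar>t * T \<omega>\<bar> powr (1 + d)) \<le> L \<omega> * (2 * (\<bar>t\<bar> powr (1 + d) * L \<omega> powr (1 + d)))"
      using L0 by (intro mult_left_mono) auto
    also have "\<dots> = 2 * \<bar>t\<bar> powr (1 + d) * (L \<omega> powr 1 * L \<omega> powr (1 + d))"
      using L0[of \<omega>] by simp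
    also have "L \<omega> powr 1 * L \<omega> powr (1 + d) = L \<omega> powr (2 + d)"
      unfolding powr_add[symmetric] by simp
    finally show ?thesis .
  qed
  have Lsplit2: "(L \<omega>)\<^sup>2 * (2 * \<bar>t * V \<omega>\<bar> powr d) \<le> 2 * \<bar>t\<bar> powr d * L \<omega> powr (2 + d)" for \<omega>
  proof -
    have "\<bar>t * V \<omega>\<bar> powr d \<le> \<bar>t\<bar> powr d * L \<omega> powr d"
      using bd(3)[of \<omega>] d by (simp add: abs_mult powr_mult mult_left_mono powr_mono2)
    then have "(L \<omega>)\<^sup>2 * (2 * \<bar>t * V \<omega>\<bar> powr d) \<le> (L \<omega>)\<^sup>2 * (2 * (\<bar>t\<bar> powr d * L \<omega> powr d))"
      by (intro mult_left_mono) auto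
    also have "\<dots> = 2 * \<bar>t\<bar> powr d * (L \<omega> powr 2 * L \<omega> powr d)"
      using L0[of \<omega>] by simp
    also have "L \<omega> powr 2 * L \<omega> powr d = L \<omega> powr (2 + d)"
      unfolding powr_add[symmetric] by simp
    finally show ?thesis .
  qed
  have "cmod A \<le> (\<integral>\<omega>. 2 * \<bar>t\<bar> powr (1 + d) * L \<omega> powr (2 + d) \<partial>M)"
    unfolding A_def
  proof (rule norm_integral_le_integral)
    fix \<omega>
    have "X \<omega> * iexp (t * (T \<omega> + V \<omega> + R \<omega>)) - X \<omega> * iexp (t * (V \<omega> + R \<omega>))
        - \<i> * t * ((X \<omega> * T \<omega>) * iexp (t * (V \<omega> + R \<omega>)))
        = X \<omega> * iexp (t * (V \<omega> + R \<omega>)) * (iexp (t * T \<omega>) - 1 - \<i> * (t * T \<omega>))"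
      by (simp add: algebra_simps flip: exp_add)
    then have "cmod (X \<omega> * iexp (t * (T \<omega> + V \<omega> + R \<omega>)) - X \<omega> * iexp (t * (V \<omega> + R \<omega>))
        - \<i> * t * ((X \<omega> * T \<omega>) * iexp (t * (V \<omega> + R \<omega>))))
        = \<bar>X \<omega>\<bar> * cmod (iexp (t * T \<omega>) - 1 - \<i> * (t * T \<omega>))"
      by (simp add: norm_mult)
    also have "\<dots> \<le> L \<omega> * (2 * \<bar>t * T \<omega>\<bar> powr (1 + d))"
      using norm_iexp_minus_linear_le[of d "t * T \<omega>"] d by (intro mult_mono bd L0) auto
    also have "\<dots> \<le> 2 * \<bar>t\<bar> powr (1 + d) * L \<omega> powr (2 + d)" by (rule Lsplit1)
    finally show "cmod (X \<omega> * iexp (t * (T \<omega> + V \<omega> + R \<omega>)) - X \<omega> * iexp (t * (V \<omega> + R \<omega>))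
        - \<i> * t * ((X \<omega> * T \<omega>) * iexp (t * (V \<omega> + R \<omega>)))) \<le> 2 * \<bar>t\<bar> powr (1 + d) * L \<omega> powr (2 + d)" .
  qed (intro Bochner_Integration.integrable_diff X1 XT1 integrable_mult_right Lp; measurable)+
  then have A: "cmod A \<le> 2 * \<bar>t\<bar> powr (1 + d) * (\<integral>\<omega>. L \<omega> powr (2 + d) \<partial>M)" by simp
  have "cmod C \<le> (\<integral>\<omega>. 2 * \<bar>t\<bar> powr d * L \<omega> powr (2 + d) \<partial>M)"
    unfolding C_def
  proof (rule norm_integral_le_integral)
    fix \<omega>
    have "(X \<omega> * T \<omega>) * iexp (t * (V \<omega> + R \<omega>)) - (X \<omega> * T \<omega>) * iexp (t * R \<omega>)
        = (X \<omega> * T \<omega>) * iexp (t * R \<omega>) * (iexp (t * V \<omega>) - 1)"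
      by (simp add: algebra_simps flip: exp_add)
    then have "cmod ((X \<omega> * T \<omega>) * iexp (t * (V \<omega> + R \<omega>)) - (X \<omega> * T \<omega>) * iexp (t * R \<omega>))
        = \<bar>X \<omega> * T \<omega>\<bar> * cmod (iexp (t * V \<omega>) - 1)"
      by (simp add: norm_mult abs_mult)
    also have "\<dots> \<le> (L \<omega>)\<^sup>2 * (2 * \<bar>t * V \<omega>\<bar> powr d)"
      using norm_iexp_minus_one_le[of d "t * V \<omega>"] d by (intro mult_mono LL) auto
    also have "\<dots> \<le> 2 * \<bar>t\<bar> powr d * L \<omega> powr (2 + d)" by (rule Lsplit2)
    finally show "cmod ((X \<omega> * T \<omega>) * iexp (t * (V \<omega> + R \<omega>)) - (X \<omega> * T \<omega>) * iexp (t * R \<omega>))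
        \<le> 2 * \<bar>t\<bar> powr d * L \<omega> powr (2 + d)" .
  qed (intro Bochner_Integration.integrable_diff XT1 integrable_mult_right Lp; measurable)+
  then have "\<bar>t\<bar> * cmod C \<le> \<bar>t\<bar> * (2 * \<bar>t\<bar> powr d * (\<integral>\<omega>. L \<omega> powr (2 + d) \<partial>M))"
    by (intro mult_left_mono) auto
  also have "\<dots> = 2 * (\<bar>t\<bar> powr 1 * \<bar>t\<bar> powr d) * (\<integral>\<omega>. L \<omega> powr (2 + d) \<partial>M)" by simp
  also have "\<bar>t\<bar> powr 1 * \<bar>t\<bar> powr d = \<bar>t\<bar> powr (1 + d)" unfolding powr_add[symmetric] by simp
  finally have C: "\<bar>t\<bar> * cmod C \<le> 2 * \<bar>t\<bar> powr (1 + d) * (\<integral>\<omega>. L \<omega> powr (2 + d) \<partial>M)" .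
  \<comment> \<open>The factor \<open>E[X * T]\<close> is already a separate expectation here, so
    the Lipschitz bound suffices: a product of a second and a first moment arises, not a third
    moment.\<close>
  have "cmod E \<le> (\<integral>\<omega>. \<bar>t\<bar> * L \<omega> \<partial>M)"
    unfolding E_def
  proof (rule norm_expectation_iexp_diff_le)
    fix \<omega>
    have "\<bar>t * R \<omega> - t * (T \<omega> + V \<omega> + R \<omega>)\<bar> = \<bar>t\<bar> * \<bar>T \<omega> + V \<omega>\<bar>"
      unfolding abs_mult[symmetric] by (simp add: algebra_simps abs_minus_commute)
    also have "\<dots> \<le> \<bar>t\<bar> * L \<omega>" by (intro mult_left_mono bd) auto
    finally show "\<bar>t * R \<omega> - t * (T \<omega> + V \<omega> + R \<omega>)\<bar> \<le> \<bar>t\<bar> * L \<omega>" .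
  qed (use L1 in auto)
  then have E: "cmod E \<le> \<bar>t\<bar> * (\<integral>\<omega>. L \<omega> \<partial>M)" by simp
  have xt: "\<bar>\<integral>\<omega>. X \<omega> * T \<omega> \<partial>M\<bar> \<le> (\<integral>\<omega>. (L \<omega>)\<^sup>2 \<partial>M)"
    using norm_integral_le_integral[OF XTint L2] LL by simp
  have Aeq: "A = (\<integral>\<omega>. X \<omega> * iexp (t * (T \<omega> + V \<omega> + R \<omega>)) \<partial>M)
      - \<i> * t * (\<integral>\<omega>. (X \<omega> * T \<omega>) * iexp (t * (V \<omega> + R \<omega>)) \<partial>M)"
  proof -
    have 1: "integrable M (\<lambda>\<omega>. X \<omega> * iexp (t * (T \<omega> + V \<omega> + R \<omega>)))"
        "integrable M (\<lambda>\<omega>. X \<omega> * iexp (t * (V \<omega> + R \<omega>)))"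
      by (rule X1, measurable)+
    have 2: "integrable M (\<lambda>\<omega>. \<i> * t * ((X \<omega> * T \<omega>) * iexp (t * (V \<omega> + R \<omega>))))"
      by (intro integrable_mult_right XT1) measurable
    show ?thesis
      unfolding A_def
      by (simp only: Bochner_Integration.integral_diff[OF Bochner_Integration.integrable_diff[OF 1] 2]
          Bochner_Integration.integral_diff[OF 1] X0 integral_mult_right_zero diff_zero)
  qed
  have Ceq: "C = (\<integral>\<omega>. (X \<omega> * T \<omega>) * iexp (t * (V \<omega> + R \<omega>)) \<partial>M)
      - (\<integral>\<omega>. X \<omega> * T \<omega> \<partial>M) * (\<integral>\<omega>. iexp (t * R \<omega>) \<partial>M)"
    unfolding C_def XT[symmetric]
    by (rule Bochner_Integration.integral_diff) (rule XT1, measurable)+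
  have "(\<integral>\<omega>. X \<omega> * iexp (t * (T \<omega> + V \<omega> + R \<omega>)) \<partial>M)
      - \<i> * t * (\<integral>\<omega>. X \<omega> * T \<omega> \<partial>M) * (\<integral>\<omega>. iexp (t * (T \<omega> + V \<omega> + R \<omega>)) \<partial>M)
      = A + \<i> * t * C + \<i> * t * (\<integral>\<omega>. X \<omega> * T \<omega> \<partial>M) * E"
    unfolding Aeq Ceq E_def by (simp only: algebra_simps)
  also have "cmod \<dots> \<le> cmod A + \<bar>t\<bar> * cmod C + \<bar>t\<bar> * \<bar>\<integral>\<omega>. X \<omega> * T \<omega> \<partial>M\<bar> * cmod E"
  proof -
    let ?x = "\<i> * t * C" and ?y = "\<i> * t * (\<integral>\<omega>. X \<omega> * T \<omega> \<partial>M) * E"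
    have "cmod (A + ?x + ?y) \<le> cmod A + cmod ?x + cmod ?y"
      using norm_triangle_ineq[of "A + ?x" ?y] norm_triangle_ineq[of A ?x] by linarith
    then show ?thesis by (simp only: norm_mult norm_of_real norm_ii mult_1)
  qed
  also have "\<bar>t\<bar> * \<bar>\<integral>\<omega>. X \<omega> * T \<omega> \<partial>M\<bar> * cmod E \<le> \<bar>t\<bar> * (\<integral>\<omega>. (L \<omega>)\<^sup>2 \<partial>M) * (\<bar>t\<bar> * (\<integral>\<omega>. L \<omega> \<partial>M))"
    using xt E by (intro mult_mono) auto
  also have "\<dots> = t\<^sup>2 * (\<integral>\<omega>. (L \<omega>)\<^sup>2 \<partial>M) * (\<integral>\<omega>. L \<omega> \<partial>M)"
    by (simp only: power2_eq_square abs_mult_self_eq[of t, symmetric] ac_simps)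
  finally show ?thesis using A C by simp
qed

end

text \<open>Integrating factor: \<open>exp (s^2 / 2) * \<psi> s\<close> would be constant if
  \<open>\<psi>' s = - s * \<psi> s\<close> held exactly. Its derivative is at most
  \<open>exp (t^2 / 2) * e\<close> up to \<open>t\<close>, and this exponential cancels when the
  factor is removed again.\<close>

lemma norm_diff_gaussian_le:
  fixes \<psi> \<psi>' :: "real \<Rightarrow> complex"
  assumes der: "\<And>s. (\<psi> has_vector_derivative \<psi>' s) (at s)" and "\<psi> 0 = 1"
    and bd: "\<And>s. \<bar>s\<bar> \<le> \<bar>t\<bar> \<Longrightarrow> cmod (\<psi>' s + s * \<psi> s) \<le> e"
  shows "cmod (\<psi> t - complex_of_real (exp (- (t\<^sup>2) / 2))) \<le> \<bar>t\<bar> * e"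
proof -
  define G where "G = (\<lambda>s. exp (s\<^sup>2 / 2) *\<^sub>R \<psi> s)"
  define G' where "G' = (\<lambda>s. exp (s\<^sup>2 / 2) *\<^sub>R (\<psi>' s + s * \<psi> s))"
  have "0 \<le> e" using bd[of 0] norm_ge_zero[of "\<psi>' 0 + 0 * \<psi> 0"] by (simp add: order_trans[OF norm_ge_zero])
  have G: "(G has_vector_derivative G' s) (at s)" for s
  proof -
    have "((\<lambda>s::real. exp (s\<^sup>2 / 2)) has_real_derivative exp (s\<^sup>2 / 2) * s) (at s)"
      by (auto intro!: derivative_eq_intros)
    from has_vector_derivative_scaleR[OF this der[of s]] show ?thesis
      unfolding G_def G'_def by (simp add: algebra_simps scaleR_conv_of_real)
  qed
  have "norm (G t - G 0) \<le> (exp (t\<^sup>2 / 2) * e) * norm (t - 0)"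
  \<comment> \<open>The symmetric interval contains both 0 and \<open>t\<close> whatever the sign of
    \<open>t\<close>.\<close>
  proof (rule differentiable_bound[where S = "{-\<bar>t\<bar>..\<bar>t\<bar>}" and f' = "\<lambda>s h. h *\<^sub>R G' s"])
    fix s assume s: "s \<in> {-\<bar>t\<bar>..\<bar>t\<bar>}"
    show "(G has_derivative (\<lambda>h. h *\<^sub>R G' s)) (at s within {-\<bar>t\<bar>..\<bar>t\<bar>})"
      using G[of s] unfolding has_vector_derivative_def by (rule has_derivative_at_withinI)
    have "\<bar>s\<bar> \<le> \<bar>t\<bar>" using s by auto
    then have "s\<^sup>2 \<le> t\<^sup>2" by (simp add: abs_le_square_iff)
    then have "norm (G' s) \<le> exp (t\<^sup>2 / 2) * e"
      unfolding G'_def using bd[OF \<open>\<bar>s\<bar> \<le> \<bar>t\<bar>\<close>] by (simp add: mult_mono)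
    then show "onorm (\<lambda>h. h *\<^sub>R G' s) \<le> exp (t\<^sup>2 / 2) * e"
      by (intro onorm_le) (simp add: mult.commute mult_left_mono)
  qed (auto)
  then have "norm (exp (- (t\<^sup>2) / 2) *\<^sub>R (G t - G 0)) \<le> exp (- (t\<^sup>2) / 2) * (exp (t\<^sup>2 / 2) * e * \<bar>t\<bar>)"
    by (simp add: mult_left_mono)
  also have "exp (- (t\<^sup>2) / 2) *\<^sub>R (G t - G 0) = \<psi> t - complex_of_real (exp (- (t\<^sup>2) / 2))"
    unfolding G_def using assms(2) by (simp add: algebra_simps scaleR_conv_of_real exp_of_real flip: exp_add of_real_mult)
  also have "exp (- (t\<^sup>2) / 2) * (exp (t\<^sup>2 / 2) * e * \<bar>t\<bar>) = \<bar>t\<bar> * e"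
    by (simp add: exp_minus)
  finally show ?thesis .
qed

section \<open>Square-integrable sums and index windows\<close>

lemma integrable_mult_square_integrable:
  fixes X Y :: "'a \<Rightarrow> real"
  assumes [measurable]: "X \<in> borel_measurable M" "Y \<in> borel_measurable M"
    and "integrable M (\<lambda>\<omega>. (X \<omega>)\<^sup>2)" "integrable M (\<lambda>\<omega>. (Y \<omega>)\<^sup>2)"
  shows "integrable M (\<lambda>\<omega>. X \<omega> * Y \<omega>)"
proof (rule Bochner_Integration.integrable_bound)
  show "integrable M (\<lambda>\<omega>. (X \<omega>)\<^sup>2 + (Y \<omega>)\<^sup>2)" using assms by simp
  have "\<bar>x * y\<bar> \<le> x\<^sup>2 + y\<^sup>2" for x y :: real
  proof -
    have "0 \<le> (\<bar>x\<bar> - \<bar>y\<bar>)\<^sup>2" by simp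
    then have "2 * (\<bar>x\<bar> * \<bar>y\<bar>) \<le> x\<^sup>2 + y\<^sup>2" by (simp add: power2_eq_square algebra_simps)
    moreover have "0 \<le> \<bar>x\<bar> * \<bar>y\<bar>" by simp
    ultimately show ?thesis unfolding abs_mult by linarith
  qed
  then show "AE \<omega> in M. norm (X \<omega> * Y \<omega>) \<le> norm ((X \<omega>)\<^sup>2 + (Y \<omega>)\<^sup>2)" by simp
qed simp

lemma square_integrable_sum:
  fixes X :: "'i \<Rightarrow> 'a \<Rightarrow> real"
  assumes "\<And>i. i \<in> I \<Longrightarrow> X i \<in> borel_measurable M" "\<And>i. i \<in> I \<Longrightarrow> integrable M (\<lambda>\<omega>. (X i \<omega>)\<^sup>2)"
  shows "integrable M (\<lambda>\<omega>. (\<Sum>i\<in>I. X i \<omega>)\<^sup>2)"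
  unfolding power2_eq_square sum_product
  by (intro Bochner_Integration.integrable_sum integrable_mult_square_integrable assms)

text \<open>Radius \<open>m\<close> gives the indices on which a variable at \<open>i\<close> may
  depend; radius \<open>2 * m\<close> gives those on which that whole window may depend.\<close>

definition near :: "nat \<Rightarrow> nat \<Rightarrow> nat \<Rightarrow> nat set" where
  "near n r i = {j \<in> {1..n}. \<bar>int j - int i\<bar> \<le> int r}"

lemma near_subset: "near n r i \<subseteq> {1..n}"
  by (auto simp: near_def)

lemma finite_near [simp]: "finite (near n r i)"
  using finite_subset[OF near_subset] by simp

lemma card_near_le: "card (near n r i) \<le> 2 * r + 1"
proof -
  have "card (near n r i) \<le> card {i - r..i + r}"
    by (rule card_mono) (auto simp: near_def)
  also have "\<dots> \<le> 2 * r + 1" by simp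
  finally show ?thesis .
qed

lemma separated_near: "separated m {i} ({1..n} - near n m i)"
  unfolding separated_def near_def by auto

lemma separated_near2: "separated m (near n m i) ({1..n} - near n (2 * m) i)"
  unfolding separated_def
proof (intro ballI)
  fix j l assume "j \<in> near n m i" "l \<in> {1..n} - near n (2 * m) i"
  then have "\<bar>int j - int i\<bar> \<le> int m" "\<not> \<bar>int l - int i\<bar> \<le> 2 * int m" by (auto simp: near_def)
  then show "int m < \<bar>int j - int l\<bar>" by linarith
qed

context m_dependent_sequence
begin

lemma sum_alg:
  fixes X :: "nat \<Rightarrow> 'a \<Rightarrow> real"
  assumes "\<And>i. i \<in> J \<Longrightarrow> X i \<in> borel_measurable (alg {i})"
  shows "(\<lambda>\<omega>. \<Sum>i\<in>J. X i \<omega>) \<in> borel_measurable (alg J)"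
proof (rule borel_measurable_sum)
  fix i assume "i \<in> J"
  then show "X i \<in> borel_measurable (alg J)"
    by (intro measurable_alg_mono[OF assms]) simp_all
qed

text \<open>The normalization \<open>a\<close> is kept apart from \<open>Z\<close>, so that the
  moment bound \<open>B\<close> can be uniform in \<open>n\<close> and the error shows its
  dependence on \<open>n\<close> through \<open>n * a powr (2 + d)\<close> and
  \<open>n * a ^ 3\<close> only. The number \<open>4 * m + 1\<close> bounds the size of a window of
  radius \<open>2 * m\<close>, and \<open>D\<close> bounds the moment of order \<open>2 + d\<close>
  of a sum of absolute values over such a window.\<close>

lemma m_dependent_gaussian_bound:
  fixes Z :: "nat \<Rightarrow> 'a \<Rightarrow> real" and a d B t :: real
  assumes Z: "\<And>i. i \<in> {1..n} \<Longrightarrow> Z i \<in> borel_measurable (alg {i})"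
    and d: "0 < d" "d \<le> 1" and a: "0 \<le> a"
    and Zp: "\<And>i. i \<in> {1..n} \<Longrightarrow> integrable M (\<lambda>\<omega>. \<bar>Z i \<omega>\<bar> powr (2 + d))"
    and ZB: "\<And>i. i \<in> {1..n} \<Longrightarrow> (\<integral>\<omega>. \<bar>Z i \<omega>\<bar> powr (2 + d) \<partial>M) \<le> B" and B: "0 \<le> B"
    and Z0: "\<And>i. i \<in> {1..n} \<Longrightarrow> (\<integral>\<omega>. Z i \<omega> \<partial>M) = 0"
    and var: "a\<^sup>2 * (\<integral>\<omega>. (\<Sum>i=1..n. Z i \<omega>)\<^sup>2 \<partial>M) = 1"
    and D: "D = real (4 * m + 1) powr (2 + d) * (real (4 * m + 1) * B)"
  shows "cmod ((\<integral>\<omega>. iexp (t * (a * (\<Sum>i=1..n. Z i \<omega>))) \<partial>M) - complex_of_real (exp (- (t\<^sup>2) / 2)))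
      \<le> \<bar>t\<bar> * (real n * (4 * \<bar>t\<bar> powr (1 + d) * (a powr (2 + d) * D) + t\<^sup>2 * (a ^ 3 * (1 + D)\<^sup>2)))"
proof -
  have pos: "J \<subseteq> {1..}" if "J \<subseteq> {1..n}" for J using that by auto
  have fin: "finite J" if "J \<subseteq> {1..n}" for J using that finite_subset by blast
  have ZM: "Z i \<in> borel_measurable M" if "i \<in> {1..n}" for i
    using that by (intro measurable_alg_M[OF Z]) auto
  have D0: "0 \<le> D" unfolding D using B by simp
  \<comment> \<open>A single majorant: up to the factor \<open>a\<close>, all of \<open>X\<close>,
    \<open>T\<close>, \<open>V\<close> and \<open>T + V\<close> in \<open>stein_local_step\<close>
    are sums over subsets of this window.\<close>
  define \<Lambda> where "\<Lambda> = (\<lambda>i \<omega>. \<Sum>j\<in>near n (2 * m) i. \<bar>Z j \<omega>\<bar>)"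
  have \<Lambda>0: "0 \<le> \<Lambda> i \<omega>" for i \<omega> unfolding \<Lambda>_def by (intro sum_nonneg) auto
  have \<Lambda>M [measurable]: "\<Lambda> i \<in> borel_measurable M" for i
    unfolding \<Lambda>_def by (intro borel_measurable_sum borel_measurable_abs ZM subsetD[OF near_subset])
  have \<Lambda>le: "\<Lambda> i \<omega> powr (2 + d) \<le> real (4 * m + 1) powr (2 + d) * (\<Sum>j\<in>near n (2 * m) i. \<bar>Z j \<omega>\<bar> powr (2 + d))" for i \<omega>
    unfolding \<Lambda>_def using card_near_le[of n "2 * m" i] d by (intro powr_sum_le) auto
  have sumint: "integrable M (\<lambda>\<omega>. real (4 * m + 1) powr (2 + d) * (\<Sum>j\<in>near n (2 * m) i. \<bar>Z j \<omega>\<bar> powr (2 + d)))" for i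
    using near_subset[of n "2 * m" i] by (intro integrable_mult_right Bochner_Integration.integrable_sum Zp) auto
  have \<Lambda>p: "integrable M (\<lambda>\<omega>. \<Lambda> i \<omega> powr (2 + d))" for i
    by (rule Bochner_Integration.integrable_bound[OF sumint[of i]])
       (use \<Lambda>le[of i] in \<open>auto intro!: AE_I2 order_trans[OF _ abs_ge_self]\<close>)
  have \<Lambda>D: "(\<integral>\<omega>. \<Lambda> i \<omega> powr (2 + d) \<partial>M) \<le> D" for i
  proof -
    have "(\<integral>\<omega>. \<Lambda> i \<omega> powr (2 + d) \<partial>M)
        \<le> (\<integral>\<omega>. real (4 * m + 1) powr (2 + d) * (\<Sum>j\<in>near n (2 * m) i. \<bar>Z j \<omega>\<bar> powr (2 + d)) \<partial>M)"
      by (intro integral_mono \<Lambda>p sumint \<Lambda>le)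
    also have "\<dots> = real (4 * m + 1) powr (2 + d) * (\<Sum>j\<in>near n (2 * m) i. \<integral>\<omega>. \<bar>Z j \<omega>\<bar> powr (2 + d) \<partial>M)"
      using near_subset[of n "2 * m" i] Zp by (subst integral_mult_right_zero, subst Bochner_Integration.integral_sum) auto
    also have "(\<Sum>j\<in>near n (2 * m) i. \<integral>\<omega>. \<bar>Z j \<omega>\<bar> powr (2 + d) \<partial>M) \<le> real (card (near n (2 * m) i)) * B"
      using near_subset[of n "2 * m" i] ZB by (intro sum_bounded_above) auto
    also have "\<dots> \<le> real (4 * m + 1) * B"
      using card_near_le[of n "2 * m" i] B by (intro mult_right_mono) linarith+
    finally show ?thesis unfolding D by (simp add: mult_left_mono)
  qed
  \<comment> \<open>Applied with \<open>q = 1\<close> and \<open>q = 2\<close>; the two bounds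
    multiply to the factor \<open>(1 + D)^2\<close> of the cubic error term, and their scalings to
    \<open>a ^ 3\<close>.\<close>
  have \<Lambda>low: "integrable M (\<lambda>\<omega>. \<Lambda> i \<omega> powr q)" "(\<integral>\<omega>. \<Lambda> i \<omega> powr q \<partial>M) \<le> 1 + D" if "0 \<le> q" "q \<le> 2 + d" for i q
  proof -
    have le: "\<Lambda> i \<omega> powr q \<le> 1 + \<Lambda> i \<omega> powr (2 + d)" for \<omega>
      using le_one_plus_powr[OF \<Lambda>0 that] .
    have int: "integrable M (\<lambda>\<omega>. 1 + \<Lambda> i \<omega> powr (2 + d))" using \<Lambda>p by simp
    show 1: "integrable M (\<lambda>\<omega>. \<Lambda> i \<omega> powr q)"
      by (rule Bochner_Integration.integrable_bound[OF int])
         (use le in \<open>auto intro!: AE_I2 order_trans[OF _ abs_ge_self]\<close>)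
    have "(\<integral>\<omega>. \<Lambda> i \<omega> powr q \<partial>M) \<le> (\<integral>\<omega>. 1 + \<Lambda> i \<omega> powr (2 + d) \<partial>M)"
      by (intro integral_mono 1 int le)
    also have "\<dots> \<le> 1 + D" using \<Lambda>p \<Lambda>D[of i] by (simp add: prob_space)
    finally show "(\<integral>\<omega>. \<Lambda> i \<omega> powr q \<partial>M) \<le> 1 + D" .
  qed
  have \<Lambda>1: "integrable M (\<Lambda> i)" "(\<integral>\<omega>. \<Lambda> i \<omega> \<partial>M) \<le> 1 + D" for i
    using \<Lambda>low[of 1 i] d \<Lambda>0[of i] by auto
  have \<Lambda>2: "integrable M (\<lambda>\<omega>. (\<Lambda> i \<omega>)\<^sup>2)" "(\<integral>\<omega>. (\<Lambda> i \<omega>)\<^sup>2 \<partial>M) \<le> 1 + D" for i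
    using \<Lambda>low[of 2 i] d \<Lambda>0[of i] by auto
  have mem: "i \<in> near n r i" if "i \<in> {1..n}" for i r using that by (auto simp: near_def)
  have Zle: "\<bar>Z i \<omega>\<bar> \<le> \<Lambda> i \<omega>" if "i \<in> {1..n}" for i \<omega>
    unfolding \<Lambda>_def using mem[OF that] by (intro member_le_sum) auto
  have Z2: "integrable M (\<lambda>\<omega>. (Z i \<omega>)\<^sup>2)" if "i \<in> {1..n}" for i
    by (rule Bochner_Integration.integrable_bound[OF \<Lambda>2(1)[of i]])
       (use ZM[OF that] Zle[OF that] \<Lambda>0 in \<open>auto simp: abs_le_square_iff[symmetric]\<close>)
  \<comment> \<open>Indexing the scaled partial sums by sets makes \<open>X\<close>,
    \<open>T\<close>, \<open>V\<close>, \<open>R\<close> and the full sum instances of one family,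
    so measurability, moments and additivity are shown once.\<close>
  define P where "P = (\<lambda>J \<omega>. a * (\<Sum>j\<in>J. Z j \<omega>))"
  have P_alg: "P J \<in> borel_measurable (alg J)" if "J \<subseteq> {1..n}" for J
    unfolding P_def using that Z by (intro borel_measurable_times sum_alg) auto
  have PM [measurable]: "P J \<in> borel_measurable M" if "J \<subseteq> {1..n}" for J
    using measurable_alg_M[OF P_alg[OF that] pos[OF that]] .
  have P2: "integrable M (\<lambda>\<omega>. (P J \<omega>)\<^sup>2)" if "J \<subseteq> {1..n}" for J
    unfolding P_def power_mult_distrib
    by (intro integrable_mult_right square_integrable_sum ZM Z2) (use that in auto)
  have P1: "integrable M (P J)" if "J \<subseteq> {1..n}" for J
    using square_integrable_imp_integrable[OF PM[OF that] P2[OF that]] .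
  have P0: "(\<integral>\<omega>. P J \<omega> \<partial>M) = 0" if "J \<subseteq> {1..n}" for J
  proof -
    have "integrable M (Z i)" if "i \<in> {1..n}" for i
      using square_integrable_imp_integrable[OF ZM[OF that] Z2[OF that]] .
    then have "(\<integral>\<omega>. P J \<omega> \<partial>M) = a * (\<Sum>j\<in>J. \<integral>\<omega>. Z j \<omega> \<partial>M)"
      unfolding P_def using that by (subst integral_mult_right_zero, subst Bochner_Integration.integral_sum) auto
    also have "(\<Sum>j\<in>J. \<integral>\<omega>. Z j \<omega> \<partial>M) = 0" using Z0 that by (intro sum.neutral) auto
    finally show ?thesis by simp
  qed
  have P_Un: "P (J \<union> J') \<omega> = P J \<omega> + P J' \<omega>" if "J \<subseteq> {1..n}" "J' \<subseteq> {1..n}" "J \<inter> J' = {}" for J J' \<omega>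
    unfolding P_def using sum.union_disjoint[OF fin[OF that(1)] fin[OF that(2)] that(3), of "\<lambda>j. Z j \<omega>"]
    by (simp add: distrib_left)
  have P_abs: "\<bar>P J \<omega>\<bar> \<le> a * \<Lambda> i \<omega>" if "J \<subseteq> near n (2 * m) i" for J i \<omega>
  proof -
    have "\<bar>\<Sum>j\<in>J. Z j \<omega>\<bar> \<le> (\<Sum>j\<in>J. \<bar>Z j \<omega>\<bar>)" by (rule sum_abs)
    also have "\<dots> \<le> \<Lambda> i \<omega>" unfolding \<Lambda>_def by (rule sum_mono2) (use that in auto)
    finally show ?thesis unfolding P_def abs_mult using a by (simp add: mult_left_mono)
  qed
  let ?S = "P {1..n}"
  let ?X = "\<lambda>i. P {i}" and ?T = "\<lambda>i. P (near n m i)"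
    and ?V = "\<lambda>i. P (near n (2 * m) i - near n m i)" and ?R = "\<lambda>i. P ({1..n} - near n (2 * m) i)"
  have near_mono: "near n m i \<subseteq> near n (2 * m) i" for i by (auto simp: near_def)
  have VR: "?V i \<omega> + ?R i \<omega> = P ({1..n} - near n m i) \<omega>" for i \<omega>
  proof -
    have "(near n (2 * m) i - near n m i) \<union> ({1..n} - near n (2 * m) i) = {1..n} - near n m i"
      using near_subset[of n "2 * m" i] near_mono[of i] by blast
    moreover have "near n (2 * m) i - near n m i \<subseteq> {1..n}"
      "(near n (2 * m) i - near n m i) \<inter> ({1..n} - near n (2 * m) i) = {}"
      using near_subset[of n "2 * m" i] by blast+
    ultimately show ?thesis using P_Un[OF _ Diff_subset] by metis
  qed
  have TS: "?T i \<omega> + P ({1..n} - near n m i) \<omega> = ?S \<omega>" for i \<omega>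
    using P_Un[of "near n m i" "{1..n} - near n m i" \<omega>] near_subset[of n m i] by (simp add: Un_absorb1)
  have TVR: "?T i \<omega> + ?V i \<omega> + ?R i \<omega> = ?S \<omega>" for i \<omega> using VR TS by (simp add: add.assoc)
  have TV: "?T i \<omega> + ?V i \<omega> = P (near n (2 * m) i) \<omega>" for i \<omega>
  proof -
    have "near n m i \<union> (near n (2 * m) i - near n m i) = near n (2 * m) i"
      "near n (2 * m) i - near n m i \<subseteq> {1..n}" "near n m i \<inter> (near n (2 * m) i - near n m i) = {}"
      using near_subset[of n "2 * m" i] near_mono[of i] by blast+
    then show ?thesis using P_Un[OF near_subset] by metis
  qed
  define e where "e = (\<lambda>s. 4 * \<bar>s\<bar> powr (1 + d) * (a powr (2 + d) * D) + s\<^sup>2 * (a ^ 3 * (1 + D)\<^sup>2))"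
  let ?psi = "\<lambda>s. \<integral>\<omega>. iexp (s * ?S \<omega>) \<partial>M"
  have step: "cmod ((\<integral>\<omega>. ?X i \<omega> * iexp (s * ?S \<omega>) \<partial>M) - \<i> * s * (\<integral>\<omega>. ?X i \<omega> * ?T i \<omega> \<partial>M) * ?psi s) \<le> e s"
    if i: "i \<in> {1..n}" for i s
  proof -
    have sub: "{i} \<subseteq> {1..n}" "near n m i \<subseteq> {1..n}" "near n (2 * m) i - near n m i \<subseteq> {1..n}"
        "{1..n} - near n (2 * m) i \<subseteq> {1..n}" "{1..n} - near n m i \<subseteq> {1..n}"
      using i near_subset[of n m i] near_subset[of n "2 * m" i] by auto
    have Lp: "(\<lambda>\<omega>. (a * \<Lambda> i \<omega>) powr (2 + d)) = (\<lambda>\<omega>. a powr (2 + d) * \<Lambda> i \<omega> powr (2 + d))"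
      using a \<Lambda>0 by (simp add: powr_mult)
    have "cmod ((\<integral>\<omega>. ?X i \<omega> * iexp (s * (?T i \<omega> + ?V i \<omega> + ?R i \<omega>)) \<partial>M)
           - \<i> * s * (\<integral>\<omega>. ?X i \<omega> * ?T i \<omega> \<partial>M) * (\<integral>\<omega>. iexp (s * (?T i \<omega> + ?V i \<omega> + ?R i \<omega>)) \<partial>M))
         \<le> 4 * \<bar>s\<bar> powr (1 + d) * (\<integral>\<omega>. (a * \<Lambda> i \<omega>) powr (2 + d) \<partial>M)
             + s\<^sup>2 * (\<integral>\<omega>. (a * \<Lambda> i \<omega>)\<^sup>2 \<partial>M) * (\<integral>\<omega>. a * \<Lambda> i \<omega> \<partial>M)"
    proof (rule stein_local_step[OF PM[OF sub(1)] PM[OF sub(2)] PM[OF sub(3)] PM[OF sub(4)] _ d])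
      \<comment> \<open>\<open>V + R\<close> is the sum outside the \<open>m\<close>-window of
        \<open>i\<close>, hence independent of the centred variable \<open>X\<close>.\<close>
      have "(\<integral>\<omega>. complex_of_real (?X i \<omega>) * iexp (s * P ({1..n} - near n m i) \<omega>) \<partial>M)
          = (\<integral>\<omega>. complex_of_real (?X i \<omega>) \<partial>M) * (\<integral>\<omega>. iexp (s * P ({1..n} - near n m i) \<omega>) \<partial>M)"
      proof (rule expectation_mult_alg(2)[OF _ _ _ _ separated_near])
        show "(\<lambda>\<omega>. iexp (s * P ({1..n} - near n m i) \<omega>)) \<in> borel_measurable (alg ({1..n} - near n m i))"
          using P_alg[OF sub(5)] by measurable
        show "(\<lambda>\<omega>. complex_of_real (?X i \<omega>)) \<in> borel_measurable (alg {i})"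
          using P_alg[OF sub(1)] by measurable
        show "integrable M (\<lambda>\<omega>. complex_of_real (?X i \<omega>))"
          using P1[OF sub(1)] by (rule integrable_of_real)
        show "integrable M (\<lambda>\<omega>. iexp (s * P ({1..n} - near n m i) \<omega>))"
          by (rule integrable_iexp) (use PM[OF sub(5)] in measurable)
      qed (use i in auto)
      also have "(\<integral>\<omega>. complex_of_real (?X i \<omega>) \<partial>M) = 0"
        using P0[OF sub(1)] by (simp add: integral_complex_of_real)
      finally show "(\<integral>\<omega>. ?X i \<omega> * iexp (s * (?V i \<omega> + ?R i \<omega>)) \<partial>M) = 0"
        unfolding VR by simp
      \<comment> \<open>The product \<open>X * T\<close> lives on the \<open>m\<close>-window and
        \<open>R\<close> outside the \<open>2 * m\<close>-window, so the two are separated by the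
        triangle inequality.\<close>
      have "(\<integral>\<omega>. complex_of_real (?X i \<omega> * ?T i \<omega>) * iexp (s * ?R i \<omega>) \<partial>M)
          = (\<integral>\<omega>. complex_of_real (?X i \<omega> * ?T i \<omega>) \<partial>M) * (\<integral>\<omega>. iexp (s * ?R i \<omega>) \<partial>M)"
      proof (rule expectation_mult_alg(2)[OF _ _ _ _ separated_near2])
        have "?X i \<in> borel_measurable (alg (near n m i))"
          using measurable_alg_mono[OF P_alg[OF sub(1)], of "near n m i"] mem[OF i] by auto
        then show "(\<lambda>\<omega>. complex_of_real (?X i \<omega> * ?T i \<omega>)) \<in> borel_measurable (alg (near n m i))"
          using P_alg[OF sub(2)] by measurable
        show "(\<lambda>\<omega>. iexp (s * ?R i \<omega>)) \<in> borel_measurable (alg ({1..n} - near n (2 * m) i))"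
          using P_alg[OF sub(4)] by measurable
        show "integrable M (\<lambda>\<omega>. complex_of_real (?X i \<omega> * ?T i \<omega>))"
          by (intro integrable_of_real integrable_mult_square_integrable PM P2 sub)
        show "integrable M (\<lambda>\<omega>. iexp (s * ?R i \<omega>))"
          by (rule integrable_iexp) (use PM[OF sub(4)] in measurable)
      qed (use pos[OF near_subset[of n m i]] in auto)
      then show "(\<integral>\<omega>. complex_of_real (?X i \<omega> * ?T i \<omega>) * iexp (s * ?R i \<omega>) \<partial>M)
          = complex_of_real (\<integral>\<omega>. ?X i \<omega> * ?T i \<omega> \<partial>M) * (\<integral>\<omega>. iexp (s * ?R i \<omega>) \<partial>M)"
        unfolding integral_complex_of_real .
      show "integrable M (\<lambda>\<omega>. (a * \<Lambda> i \<omega>) powr (2 + d))"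
        unfolding Lp by (intro integrable_mult_right \<Lambda>p)
      show "\<bar>?T i \<omega> + ?V i \<omega>\<bar> \<le> a * \<Lambda> i \<omega>" for \<omega> unfolding TV by (rule P_abs) auto
      show "\<bar>?X i \<omega>\<bar> \<le> a * \<Lambda> i \<omega>" for \<omega> by (rule P_abs) (use mem[OF i] in auto)
      show "\<bar>?T i \<omega>\<bar> \<le> a * \<Lambda> i \<omega>" for \<omega> by (rule P_abs) (rule near_mono)
      show "\<bar>?V i \<omega>\<bar> \<le> a * \<Lambda> i \<omega>" for \<omega> by (rule P_abs) auto
    qed measurable
    also have "\<dots> \<le> e s"
    proof -
      have "(\<integral>\<omega>. (a * \<Lambda> i \<omega>) powr (2 + d) \<partial>M) \<le> a powr (2 + d) * D"
        unfolding Lp using \<Lambda>D[of i] by (simp add: mult_left_mono)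
      then have 1: "4 * \<bar>s\<bar> powr (1 + d) * (\<integral>\<omega>. (a * \<Lambda> i \<omega>) powr (2 + d) \<partial>M) \<le> 4 * \<bar>s\<bar> powr (1 + d) * (a powr (2 + d) * D)"
        by (intro mult_left_mono) auto
      have "(\<integral>\<omega>. (a * \<Lambda> i \<omega>)\<^sup>2 \<partial>M) * (\<integral>\<omega>. a * \<Lambda> i \<omega> \<partial>M) = a ^ 3 * ((\<integral>\<omega>. (\<Lambda> i \<omega>)\<^sup>2 \<partial>M) * (\<integral>\<omega>. \<Lambda> i \<omega> \<partial>M))"
      proof -
        have "(\<integral>\<omega>. (a * \<Lambda> i \<omega>)\<^sup>2 \<partial>M) = a\<^sup>2 * (\<integral>\<omega>. (\<Lambda> i \<omega>)\<^sup>2 \<partial>M)"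
          unfolding power_mult_distrib by simp
        then show ?thesis by (simp add: power2_eq_square power3_eq_cube)
      qed
      also have "\<dots> \<le> a ^ 3 * ((1 + D) * (1 + D))"
        using \<Lambda>1[of i] \<Lambda>2[of i] D0 a \<Lambda>0 by (intro mult_left_mono mult_mono integral_nonneg) auto
      finally have "s\<^sup>2 * ((\<integral>\<omega>. (a * \<Lambda> i \<omega>)\<^sup>2 \<partial>M) * (\<integral>\<omega>. a * \<Lambda> i \<omega> \<partial>M)) \<le> s\<^sup>2 * (a ^ 3 * (1 + D)\<^sup>2)"
        by (intro mult_left_mono) (auto simp: power2_eq_square)
      with 1 show ?thesis unfolding e_def by (simp add: mult.assoc)
    qed
    finally show ?thesis unfolding TVR .
  qed
  have Xsum: "(\<Sum>i=1..n. ?X i \<omega>) = ?S \<omega>" for \<omega>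
    unfolding P_def by (simp add: sum_distrib_left)
  \<comment> \<open>Each \<open>X\<close> is uncorrelated with the part of the sum outside its
    window, so \<open>T\<close> may be replaced by the full sum. The local covariances then add up
    to the variance, which \<open>var\<close> normalizes to 1.\<close>
  have XT: "(\<Sum>i=1..n. \<integral>\<omega>. ?X i \<omega> * ?T i \<omega> \<partial>M) = 1"
  proof -
    have "(\<integral>\<omega>. ?X i \<omega> * ?T i \<omega> \<partial>M) = (\<integral>\<omega>. ?X i \<omega> * ?S \<omega> \<partial>M)" if i: "i \<in> {1..n}" for i
    proof -
      have sub: "{i} \<subseteq> {1..n}" "near n m i \<subseteq> {1..n}" "{1..n} - near n m i \<subseteq> {1..n}"
        using i near_subset[of n m i] near_subset[of n "2 * m" i] by auto
      have "(\<integral>\<omega>. ?X i \<omega> * P ({1..n} - near n m i) \<omega> \<partial>M) = 0"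
        using expectation_mult_alg(2)[OF fin[OF sub(1)] fin[OF sub(3)] pos[OF sub(1)] pos[OF sub(3)] separated_near P_alg[OF sub(1)] P_alg[OF sub(3)] P1[OF sub(1)] P1[OF sub(3)]]
          P0[OF sub(1)] i by auto
      moreover have "(\<integral>\<omega>. ?X i \<omega> * ?S \<omega> \<partial>M) = (\<integral>\<omega>. ?X i \<omega> * ?T i \<omega> \<partial>M) + (\<integral>\<omega>. ?X i \<omega> * P ({1..n} - near n m i) \<omega> \<partial>M)"
        unfolding TS[of i, symmetric] distrib_left
        by (intro Bochner_Integration.integral_add integrable_mult_square_integrable PM P2 sub)
      ultimately show ?thesis by simp
    qed
    then have "(\<Sum>i=1..n. \<integral>\<omega>. ?X i \<omega> * ?T i \<omega> \<partial>M) = (\<Sum>i=1..n. \<integral>\<omega>. ?X i \<omega> * ?S \<omega> \<partial>M)"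
      by (intro sum.cong) auto
    also have "\<dots> = (\<integral>\<omega>. (\<Sum>i=1..n. ?X i \<omega> * ?S \<omega>) \<partial>M)"
      by (intro Bochner_Integration.integral_sum[symmetric] integrable_mult_square_integrable PM P2) auto
    also have "\<dots> = (\<integral>\<omega>. a\<^sup>2 * (\<Sum>i=1..n. Z i \<omega>)\<^sup>2 \<partial>M)"
      unfolding sum_distrib_right[symmetric] Xsum by (simp add: P_def power2_eq_square mult_ac)
    also have "\<dots> = 1" using var by simp
    finally show ?thesis .
  qed
  have psi: "cmod ((\<integral>\<omega>. \<i> * ?S \<omega> * iexp (s * ?S \<omega>) \<partial>M) + s * ?psi s) \<le> real n * e s" for s
  proof -
    have int: "integrable M (\<lambda>\<omega>. complex_of_real (?X i \<omega>) * iexp (s * ?S \<omega>))" if "i \<in> {1..n}" for i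
      by (rule Bochner_Integration.integrable_bound[OF P1[of "{i}"]])
         (use that PM[of "{i}"] PM[of "{1..n}"] in \<open>auto simp: norm_mult\<close>)
    have "(\<integral>\<omega>. \<i> * ?S \<omega> * iexp (s * ?S \<omega>) \<partial>M) = (\<integral>\<omega>. \<i> * (\<Sum>i=1..n. ?X i \<omega> * iexp (s * ?S \<omega>)) \<partial>M)"
      unfolding sum_distrib_right[symmetric] of_real_sum[symmetric] Xsum by (simp add: mult.assoc)
    also have "\<dots> = \<i> * (\<Sum>i=1..n. \<integral>\<omega>. ?X i \<omega> * iexp (s * ?S \<omega>) \<partial>M)"
      using int by (subst integral_mult_right_zero, subst Bochner_Integration.integral_sum) auto
    finally have 1: "(\<integral>\<omega>. \<i> * ?S \<omega> * iexp (s * ?S \<omega>) \<partial>M) = \<i> * (\<Sum>i=1..n. \<integral>\<omega>. ?X i \<omega> * iexp (s * ?S \<omega>) \<partial>M)" .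
    \<comment> \<open>The outer \<open>\<i>\<close> comes from differentiating the exponential, the
      inner one from the expansion; their product yields the sign in the Gaussian equation.\<close>
    have "\<i> * (\<Sum>i=1..n. \<i> * s * (\<integral>\<omega>. ?X i \<omega> * ?T i \<omega> \<partial>M) * ?psi s)
        = \<i> * (\<i> * s * complex_of_real (\<Sum>i=1..n. \<integral>\<omega>. ?X i \<omega> * ?T i \<omega> \<partial>M) * ?psi s)"
      by (simp only: sum_distrib_left[symmetric] sum_distrib_right[symmetric] of_real_sum)
    also have "\<dots> = - (s * ?psi s)"
      unfolding XT
      by (simp only: of_real_1 mult_1_right mult.assoc[symmetric] i_squared mult_minus_left mult_1_left)
    finally have 2: "s * ?psi s = - (\<i> * (\<Sum>i=1..n. \<i> * s * (\<integral>\<omega>. ?X i \<omega> * ?T i \<omega> \<partial>M) * ?psi s))" by simp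
    have "(\<integral>\<omega>. \<i> * ?S \<omega> * iexp (s * ?S \<omega>) \<partial>M) + s * ?psi s
        = \<i> * (\<Sum>i=1..n. (\<integral>\<omega>. ?X i \<omega> * iexp (s * ?S \<omega>) \<partial>M) - \<i> * s * (\<integral>\<omega>. ?X i \<omega> * ?T i \<omega> \<partial>M) * ?psi s)"
      unfolding 1 by (subst 2) (simp only: sum_subtractf right_diff_distrib add_uminus_conv_diff)
    then have "cmod ((\<integral>\<omega>. \<i> * ?S \<omega> * iexp (s * ?S \<omega>) \<partial>M) + s * ?psi s)
        = cmod (\<Sum>i=1..n. (\<integral>\<omega>. ?X i \<omega> * iexp (s * ?S \<omega>) \<partial>M) - \<i> * s * (\<integral>\<omega>. ?X i \<omega> * ?T i \<omega> \<partial>M) * ?psi s)"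
      by (simp only: norm_mult norm_ii mult_1)
    also have "\<dots> \<le> (\<Sum>i=1..n. e s)"
      by (rule sum_norm_le) (rule step)
    finally show ?thesis by simp
  qed
  \<comment> \<open>\<open>norm_diff_gaussian_le\<close> asks for one bound on the whole interval,
    and the local error is largest at its endpoint.\<close>
  have e_mono: "e s \<le> e t" if "\<bar>s\<bar> \<le> \<bar>t\<bar>" for s
  proof -
    have "s\<^sup>2 \<le> t\<^sup>2" using that by (simp add: abs_le_square_iff)
    then show ?thesis unfolding e_def
      using that d a D0 by (intro add_mono mult_right_mono mult_left_mono powr_mono2) auto
  qed
  have "cmod (?psi t - complex_of_real (exp (- (t\<^sup>2) / 2))) \<le> \<bar>t\<bar> * (real n * e t)"
  proof (rule norm_diff_gaussian_le)
    fix s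
    show "(?psi has_vector_derivative (\<integral>\<omega>. \<i> * ?S \<omega> * iexp (s * ?S \<omega>) \<partial>M)) (at s)"
      by (rule has_vector_derivative_expectation_iexp) (auto intro!: P1 P2 PM)
    assume "\<bar>s\<bar> \<le> \<bar>t\<bar>"
    have "cmod ((\<integral>\<omega>. \<i> * ?S \<omega> * iexp (s * ?S \<omega>) \<partial>M) + s * ?psi s) \<le> real n * e s" by (rule psi)
    also have "\<dots> \<le> real n * e t" using e_mono[OF \<open>\<bar>s\<bar> \<le> \<bar>t\<bar>\<close>] by (intro mult_left_mono) auto
    finally show "cmod ((\<integral>\<omega>. \<i> * ?S \<omega> * iexp (s * ?S \<omega>) \<partial>M) + s * ?psi s) \<le> real n * e t" .
  qed (simp add: prob_space)
  then show ?thesis unfolding P_def e_def .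
qed

end

section \<open>Counting index tuples\<close>

lemma convex_on_abs_powr:
  assumes "1 \<le> p" shows "convex_on UNIV (\<lambda>x::real. \<bar>x\<bar> powr p)"
proof (rule convex_onI)
  fix u x y :: real assume u: "0 < u" "u < 1"
  have conv: "((1 - u) * x + u * y) powr p \<le> (1 - u) * x powr p + u * y powr p" if "0 \<le> x" "0 \<le> y" for x y
  proof -
    \<comment> \<open>This is the convexity inequality with one endpoint at 0, which reduces to
      \<open>v powr p \<le> v\<close>; it supplements the convexity on positive arguments.\<close>
    have half: "(v * x) powr p \<le> v * x powr p" if "0 \<le> x" "0 < v" "v < 1" for v x :: real
    proof -
      have "v powr p \<le> v powr 1" using that assms by (intro powr_mono') auto
      then have "v powr p * x powr p \<le> v * x powr p" using that by (intro mult_right_mono) auto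
      then show ?thesis using that by (simp add: powr_mult)
    qed
    have "x = 0 \<or> y = 0 \<or> 0 < x \<and> 0 < y" using that by linarith
    then consider "x = 0" | "y = 0" | "0 < x" "0 < y" by blast
    then show ?thesis
    proof cases
      case 3
      then show ?thesis
        using convex_onD[OF powr_convex[OF assms], of u x y] u by simp
    qed (use half[of x "1 - u"] half[of y u] u that in auto)
  qed
  have "\<bar>(1 - u) *\<^sub>R x + u *\<^sub>R y\<bar> \<le> (1 - u) * \<bar>x\<bar> + u * \<bar>y\<bar>"
    using abs_triangle_ineq[of "(1 - u) * x" "u * y"] u by (simp add: abs_mult)
  then have "\<bar>(1 - u) *\<^sub>R x + u *\<^sub>R y\<bar> powr p \<le> ((1 - u) * \<bar>x\<bar> + u * \<bar>y\<bar>) powr p"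
    using assms by (intro powr_mono2) auto
  also have "\<dots> \<le> (1 - u) * \<bar>x\<bar> powr p + u * \<bar>y\<bar> powr p" by (rule conv) auto
  finally show "\<bar>(1 - u) *\<^sub>R x + u *\<^sub>R y\<bar> powr p \<le> (1 - u) * \<bar>x\<bar> powr p + u * \<bar>y\<bar> powr p" .
qed simp

lemma abs_average_powr_le:
  fixes f :: "'i \<Rightarrow> real"
  assumes "1 \<le> p"
  shows "\<bar>1 / real (card A) * (\<Sum>a\<in>A. f a)\<bar> powr p \<le> 1 / real (card A) * (\<Sum>a\<in>A. \<bar>f a\<bar> powr p)"
proof (cases "finite A \<and> A \<noteq> {}")
  case True
  then have "\<bar>\<Sum>a\<in>A. (1 / real (card A)) *\<^sub>R f a\<bar> powr p \<le> (\<Sum>a\<in>A. 1 / real (card A) * \<bar>f a\<bar> powr p)"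
    by (intro convex_on_sum[OF _ _ convex_on_abs_powr[OF assms]]) auto
  then show ?thesis by (simp add: sum_distrib_left)
qed auto

text \<open>Once the coordinates outside \<open>D\<close> are chosen, each coordinate in
  \<open>D\<close> has at most \<open>c\<close> values left. So every constrained coordinate trades
  a factor \<open>n\<close> for a constant, which is the only counting principle behind the orders
  of magnitude below. The admissible values may depend on the free coordinates.\<close>

lemma card_constrained_PiE_le:
  fixes N :: "'i \<Rightarrow> ('i \<Rightarrow> nat) \<Rightarrow> nat set"
  assumes K: "finite K" "D \<subseteq> K"
    and N: "\<And>d g. d \<in> D \<Longrightarrow> finite (N d g)" "\<And>d g. d \<in> D \<Longrightarrow> card (N d g) \<le> c"
  shows "card {f \<in> K \<rightarrow>\<^sub>E {1..n}. \<forall>d\<in>D. f d \<in> N d (restrict f (K - D))} \<le> c ^ card D * n ^ (card K - card D)"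
proof -
  let ?A = "{f \<in> K \<rightarrow>\<^sub>E {1..n}. \<forall>d\<in>D. f d \<in> N d (restrict f (K - D))}"
  let ?B = "SIGMA g:(K - D) \<rightarrow>\<^sub>E {1..n}. (\<Pi>\<^sub>E d\<in>D. N d g)"
  have D: "finite D" using K finite_subset by blast
  have finB: "finite ((K - D) \<rightarrow>\<^sub>E {1..n})" "\<forall>g\<in>(K - D) \<rightarrow>\<^sub>E {1..n}. finite (\<Pi>\<^sub>E d\<in>D. N d g)"
    using K D N by (auto intro!: finite_PiE)
  have "card ?A \<le> card ?B"
  proof (rule card_inj_on_le)
    show "inj_on (\<lambda>f. (restrict f (K - D), restrict f D)) ?A"
    proof (rule inj_onI)
      fix f g assume f: "f \<in> ?A" and g: "g \<in> ?A"
        and eq: "(restrict f (K - D), restrict f D) = (restrict g (K - D), restrict g D)"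
      have "f x = g x" if "x \<in> K" for x
      proof (cases "x \<in> D")
        case True
        then show ?thesis using eq by (metis prod.inject restrict_apply')
      next
        case False
        then have "x \<in> K - D" using that by simp
        then show ?thesis using eq by (metis prod.inject restrict_apply')
      qed
      moreover have "f \<in> K \<rightarrow>\<^sub>E {1..n}" "g \<in> K \<rightarrow>\<^sub>E {1..n}" using f g by auto
      ultimately show "f = g" using PiE_ext by blast
    qed
    show "(\<lambda>f. (restrict f (K - D), restrict f D)) ` ?A \<subseteq> ?B" using K by auto
    show "finite ?B" using finB by (intro finite_SigmaI) auto
  qed
  also have "card ?B = (\<Sum>g\<in>(K - D) \<rightarrow>\<^sub>E {1..n}. \<Prod>d\<in>D. card (N d g))"
    using finB D by (simp add: card_PiE)
  also have "\<dots> \<le> (\<Sum>g\<in>(K - D) \<rightarrow>\<^sub>E {1..n}. c ^ card D)"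
  proof (rule sum_mono)
    fix g
    have "(\<Prod>d\<in>D. card (N d g)) \<le> (\<Prod>d\<in>D. c)" using N by (intro prod_mono) auto
    then show "(\<Prod>d\<in>D. card (N d g)) \<le> c ^ card D" by simp
  qed
  also have "\<dots> = c ^ card D * n ^ (card K - card D)"
    using K D by (simp add: card_PiE card_Diff_subset)
  finally show ?thesis .
qed

lemma nat_interval_close:
  "finite {x::nat. \<bar>int x - int y\<bar> \<le> int m}" "card {x::nat. \<bar>int x - int y\<bar> \<le> int m} \<le> 2 * m + 1"
proof -
  have sub: "{x::nat. \<bar>int x - int y\<bar> \<le> int m} \<subseteq> {y - m..y + m}" by auto
  then show "finite {x::nat. \<bar>int x - int y\<bar> \<le> int m}" using finite_subset by blast
  have "card {x::nat. \<bar>int x - int y\<bar> \<le> int m} \<le> card {y - m..y + m}"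
    using sub by (intro card_mono) auto
  then show "card {x::nat. \<bar>int x - int y\<bar> \<le> int m} \<le> 2 * m + 1" by simp
qed

lemma card_close_pair_le:
  assumes "finite K" "a \<in> K" "b \<in> K" "a \<noteq> b"
  shows "card {f \<in> K \<rightarrow>\<^sub>E {1..n}. \<bar>int (f a) - int (f b)\<bar> \<le> int m} \<le> (2 * m + 1) * n ^ (card K - 1)"
proof -
  have "{f \<in> K \<rightarrow>\<^sub>E {1..n}. \<bar>int (f a) - int (f b)\<bar> \<le> int m}
      = {f \<in> K \<rightarrow>\<^sub>E {1..n}. \<forall>d\<in>{a}. f d \<in> {x. \<bar>int x - int (restrict f (K - {a}) b)\<bar> \<le> int m}}"
    using assms by auto
  then show ?thesis
    using card_constrained_PiE_le[of K "{a}" "\<lambda>d g. {x. \<bar>int x - int (g b)\<bar> \<le> int m}" "2 * m + 1" n]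
      assms nat_interval_close by simp
qed

lemma card_close_const_le:
  assumes "finite K" "a \<in> K"
  shows "card {f \<in> K \<rightarrow>\<^sub>E {1..n}. \<bar>int (f a) - int y\<bar> \<le> int m} \<le> (2 * m + 1) * n ^ (card K - 1)"
  using card_constrained_PiE_le[of K "{a}" "\<lambda>d g. {x. \<bar>int x - int y\<bar> \<le> int m}" "2 * m + 1" n]
    assms nat_interval_close by simp

lemma card_close_two_const_le:
  assumes "finite K" "a \<in> K" "b \<in> K" "a \<noteq> b"
  shows "card {f \<in> K \<rightarrow>\<^sub>E {1..n}. \<bar>int (f a) - int y\<bar> \<le> int m \<and> \<bar>int (f b) - int z\<bar> \<le> int m}
    \<le> (2 * m + 1)\<^sup>2 * n ^ (card K - 2)"
proof -
  have "{f \<in> K \<rightarrow>\<^sub>E {1..n}. \<bar>int (f a) - int y\<bar> \<le> int m \<and> \<bar>int (f b) - int z\<bar> \<le> int m}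
      = {f \<in> K \<rightarrow>\<^sub>E {1..n}. \<forall>d\<in>{a, b}. f d \<in> {x. \<bar>int x - int (if d = a then y else z)\<bar> \<le> int m}}"
    using assms by auto
  moreover have "card {f \<in> K \<rightarrow>\<^sub>E {1..n}. \<forall>d\<in>{a, b}. f d \<in> {x. \<bar>int x - int (if d = a then y else z)\<bar> \<le> int m}}
      \<le> (2 * m + 1) ^ card {a, b} * n ^ (card K - card {a, b})"
    by (rule card_constrained_PiE_le) (use assms nat_interval_close in auto)
  moreover have "card {a, b} = 2" using assms by simp
  ultimately show ?thesis by metis
qed

lemma not_lag_generic_iff:
  "\<not> lag_generic m k i \<longleftrightarrow>
    (\<exists>a\<in>{1..k}. \<exists>b\<in>{1..k}. a \<noteq> b \<and> \<bar>int (i a) - int (i b)\<bar> \<le> int m)"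
  unfolding lag_generic_def by (simp only: not_less[symmetric]) blast

lemma lag_generic_inj: "lag_generic m k i \<Longrightarrow> inj_on i {1..k}"
proof (rule inj_onI, rule ccontr)
  fix a b assume "lag_generic m k i" "a \<in> {1..k}" "b \<in> {1..k}" "i a = i b" "a \<noteq> b"
  then have "int m < \<bar>int (i a) - int (i b)\<bar>" unfolding lag_generic_def by blast
  then show False using \<open>i a = i b\<close> by simp
qed

text \<open>Union bound over at most \<open>k^2\<close> ordered pairs of positions; closeness of one
  pair costs one free coordinate.\<close>

lemma card_not_lag_generic_le:
  "card {i \<in> {1..k} \<rightarrow>\<^sub>E {1..n}. \<not> lag_generic m k i} \<le> k\<^sup>2 * ((2 * m + 1) * n ^ (k - 1))"
proof -
  let ?P = "{ab \<in> {1..k} \<times> {1..k}. fst ab \<noteq> snd ab}"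
  let ?F = "\<lambda>ab. {i \<in> {1..k} \<rightarrow>\<^sub>E {1..n}. \<bar>int (i (fst ab)) - int (i (snd ab))\<bar> \<le> int m}"
  have fin: "finite ({1..k} \<rightarrow>\<^sub>E {1..n})" by (intro finite_PiE) auto
  have "{i \<in> {1..k} \<rightarrow>\<^sub>E {1..n}. \<not> lag_generic m k i} \<subseteq> (\<Union>ab\<in>?P. ?F ab)"
  proof
    fix i assume i: "i \<in> {i \<in> {1..k} \<rightarrow>\<^sub>E {1..n}. \<not> lag_generic m k i}"
    then have "\<not> lag_generic m k i" by simp
    then obtain a b where "a \<in> {1..k}" "b \<in> {1..k}" "a \<noteq> b" "\<bar>int (i a) - int (i b)\<bar> \<le> int m"
      unfolding not_lag_generic_iff by blast
    moreover have "i \<in> {1..k} \<rightarrow>\<^sub>E {1..n}" using i by simp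
    ultimately have "(a, b) \<in> ?P" "i \<in> ?F (a, b)" by simp_all
    then show "i \<in> (\<Union>ab\<in>?P. ?F ab)" by (rule UN_I)
  qed
  then have "card {i \<in> {1..k} \<rightarrow>\<^sub>E {1..n}. \<not> lag_generic m k i} \<le> card (\<Union>ab\<in>?P. ?F ab)"
    by (rule card_mono[rotated]) (rule finite_subset[OF _ fin], blast)
  also have "\<dots> \<le> (\<Sum>ab\<in>?P. card (?F ab))" by (rule card_UN_le) auto
  also have "\<dots> \<le> (\<Sum>ab\<in>?P. (2 * m + 1) * n ^ (k - 1))"
    by (intro sum_mono, use card_close_pair_le[of "{1..k}"] in auto)
  also have "\<dots> = card ?P * ((2 * m + 1) * n ^ (k - 1))" by simp
  also have "card ?P \<le> card ({1..k} \<times> {1..k})" by (rule card_mono) auto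
  then have "card ?P * ((2 * m + 1) * n ^ (k - 1)) \<le> k\<^sup>2 * ((2 * m + 1) * n ^ (k - 1))"
    by (intro mult_right_mono) (auto simp: power2_eq_square)
  finally show ?thesis .
qed

text \<open>With first coordinate \<open>i\<close> fixed, genericity fails if two free coordinates
  are close to each other or one of them is close to \<open>i\<close>. There are at most
  \<open>k^2\<close> such pairs and at most \<open>k \<le> k^2\<close> such positions, hence the
  factor \<open>2 * k^2\<close>. The bounds are uniform in \<open>i\<close>, including the indices
  near the ends of the range.\<close>

lemma generic_completions_bounds:
  assumes "2 \<le> k"
  shows "card (generic_completions m k n i) \<le> n ^ (k - 1)"
    and "n ^ (k - 1) \<le> card (generic_completions m k n i) + 2 * k\<^sup>2 * ((2 * m + 1) * n ^ (k - 2))"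
proof -
  let ?K = "{2..k}"
  let ?T = "?K \<rightarrow>\<^sub>E {1..n}" and ?G = "generic_completions m k n i"
  have fin: "finite ?T" by (intro finite_PiE) auto
  have cardT: "card ?T = n ^ (k - 1)" by (simp add: card_PiE)
  have sub: "?G \<subseteq> ?T" unfolding generic_completions_def by auto
  then show "card ?G \<le> n ^ (k - 1)" using card_mono[OF fin] cardT by metis
  let ?P = "{ab \<in> ?K \<times> ?K. fst ab \<noteq> snd ab}"
  let ?F1 = "\<lambda>ab. {f \<in> ?T. \<bar>int (f (fst ab)) - int (f (snd ab))\<bar> \<le> int m}"
  let ?F2 = "\<lambda>a. {f \<in> ?T. \<bar>int (f a) - int i\<bar> \<le> int m}"
  have "?T - ?G \<subseteq> (\<Union>ab\<in>?P. ?F1 ab) \<union> (\<Union>a\<in>?K. ?F2 a)"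
  proof
    fix f assume f: "f \<in> ?T - ?G"
    then have "\<not> lag_generic m k (f(1 := i))" unfolding generic_completions_def by auto
    then obtain a b where ab: "a \<in> {1..k}" "b \<in> {1..k}" "a \<noteq> b" "\<bar>int ((f(1 := i)) a) - int ((f(1 := i)) b)\<bar> \<le> int m"
      unfolding not_lag_generic_iff by blast
    consider "a = 1" | "b = 1" | "a \<noteq> 1" "b \<noteq> 1" by blast
    then show "f \<in> (\<Union>ab\<in>?P. ?F1 ab) \<union> (\<Union>a\<in>?K. ?F2 a)"
    proof cases
      case 1
      then have "\<bar>int (f b) - int i\<bar> \<le> int m" "b \<in> ?K" using ab by (auto simp: abs_minus_commute)
      then show ?thesis using f by blast
    next
      case 2
      then have "\<bar>int (f a) - int i\<bar> \<le> int m" "a \<in> ?K" using ab by auto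
      then show ?thesis using f by blast
    next
      case 3
      then have "\<bar>int (f a) - int (f b)\<bar> \<le> int m" "(a, b) \<in> ?P" using ab by auto
      then have "f \<in> (\<Union>ab\<in>?P. ?F1 ab)" using f by (intro UN_I[of "(a, b)"]) simp_all
      then show ?thesis by (rule UnI1)
    qed
  qed
  then have "card (?T - ?G) \<le> card ((\<Union>ab\<in>?P. ?F1 ab) \<union> (\<Union>a\<in>?K. ?F2 a))"
    by (rule card_mono[rotated]) (rule finite_subset[OF _ fin], blast)
  also have "\<dots> \<le> card (\<Union>ab\<in>?P. ?F1 ab) + card (\<Union>a\<in>?K. ?F2 a)" by (rule card_Un_le)
  also have "\<dots> \<le> (\<Sum>ab\<in>?P. card (?F1 ab)) + (\<Sum>a\<in>?K. card (?F2 a))"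
    by (intro add_mono card_UN_le) auto
  also have "\<dots> \<le> (\<Sum>ab\<in>?P. (2 * m + 1) * n ^ (k - 2)) + (\<Sum>a\<in>?K. (2 * m + 1) * n ^ (k - 2))"
  proof (intro add_mono sum_mono)
    have k: "card ?K - 1 = k - 2" by simp
    show "card (?F1 ab) \<le> (2 * m + 1) * n ^ (k - 2)" if "ab \<in> ?P" for ab
      using card_close_pair_le[of ?K "fst ab" "snd ab" n m] that unfolding k by auto
    show "card (?F2 a) \<le> (2 * m + 1) * n ^ (k - 2)" if "a \<in> ?K" for a
      using card_close_const_le[of ?K a n i m] that unfolding k by auto
  qed
  also have "\<dots> = (card ?P + card ?K) * ((2 * m + 1) * n ^ (k - 2))" by (simp add: algebra_simps)
  also have "\<dots> \<le> (2 * k\<^sup>2) * ((2 * m + 1) * n ^ (k - 2))"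
  proof (rule mult_right_mono)
    have "card ?P \<le> card (?K \<times> ?K)" by (rule card_mono) auto
    also have "\<dots> = (k - 1) * (k - 1)" by (simp add: card_cartesian_product)
    also have "\<dots> \<le> k * k" by (intro mult_le_mono) auto
    finally have "card ?P \<le> k\<^sup>2" by (simp add: power2_eq_square)
    moreover have "card ?K \<le> k" "k \<le> k\<^sup>2" by (simp_all add: power2_eq_square)
    ultimately show "card ?P + card ?K \<le> 2 * k\<^sup>2" by linarith
  qed simp
  finally have "card (?T - ?G) \<le> 2 * k\<^sup>2 * ((2 * m + 1) * n ^ (k - 2))" .
  moreover have "card ?T = card ?G + card (?T - ?G)"
    using card_Diff_subset[OF finite_subset[OF sub fin] sub] card_mono[OF fin sub] by simp
  ultimately show "n ^ (k - 1) \<le> card ?G + 2 * k\<^sup>2 * ((2 * m + 1) * n ^ (k - 2))"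
    using cardT by simp
qed

text \<open>Two coordinates of \<open>i\<close> are confined to windows around coordinates of the
  fixed \<open>j\<close>, so two free coordinates are lost. The factor \<open>k ^ 4\<close> counts
  the choices of the two positions in \<open>i\<close> and their partners in \<open>j\<close>, which
  may coincide.\<close>

lemma card_doubly_linked_le:
  assumes "2 \<le> k"
  shows "card {i \<in> {1..k} \<rightarrow>\<^sub>E {1..n}. \<exists>a\<in>{1..k}. \<exists>b\<in>{1..k}. a \<noteq> b \<and>
      (\<exists>c\<in>{1..k}. \<bar>int (i a) - int (j c)\<bar> \<le> int m) \<and> (\<exists>c\<in>{1..k}. \<bar>int (i b) - int (j c)\<bar> \<le> int m)}
    \<le> k ^ 4 * ((2 * m + 1)\<^sup>2 * n ^ (k - 2))" (is "card ?A \<le> _")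
proof -
  let ?T = "{1..k} \<rightarrow>\<^sub>E {1..n}"
  let ?I = "{1..k} \<times> {1..k} \<times> {1..k} \<times> {1..k}"
  let ?P = "{q \<in> ?I. case q of (a, b, c, d) \<Rightarrow> a \<noteq> b}"
  let ?F = "\<lambda>q. case q of (a, b, c, d) \<Rightarrow>
    {i \<in> ?T. \<bar>int (i a) - int (j c)\<bar> \<le> int m \<and> \<bar>int (i b) - int (j d)\<bar> \<le> int m}"
  have fin: "finite ?T" by (intro finite_PiE) auto
  have "?A \<subseteq> (\<Union>q\<in>?P. ?F q)"
  proof
    fix i assume "i \<in> ?A"
    then obtain a b c d where "i \<in> ?T" "a \<in> {1..k}" "b \<in> {1..k}" "c \<in> {1..k}" "d \<in> {1..k}" "a \<noteq> b"
      "\<bar>int (i a) - int (j c)\<bar> \<le> int m" "\<bar>int (i b) - int (j d)\<bar> \<le> int m" by blast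
    then have "(a, b, c, d) \<in> ?P" "i \<in> ?F (a, b, c, d)" by simp_all
    then show "i \<in> (\<Union>q\<in>?P. ?F q)" by (rule UN_I)
  qed
  then have "card ?A \<le> card (\<Union>q\<in>?P. ?F q)"
    by (rule card_mono[rotated]) (rule finite_subset[OF _ fin], auto)
  also have "\<dots> \<le> (\<Sum>q\<in>?P. card (?F q))" by (rule card_UN_le) auto
  also have "\<dots> \<le> (\<Sum>q\<in>?P. (2 * m + 1)\<^sup>2 * n ^ (k - 2))"
  proof (rule sum_mono)
    fix q assume "q \<in> ?P"
    then obtain a b c d where q: "q = (a, b, c, d)" "a \<in> {1..k}" "b \<in> {1..k}" "a \<noteq> b" by auto
    then show "card (?F q) \<le> (2 * m + 1)\<^sup>2 * n ^ (k - 2)"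
      using card_close_two_const_le[of "{1..k}" a b n "j c" m "j d"] by simp
  qed
  also have "\<dots> = card ?P * ((2 * m + 1)\<^sup>2 * n ^ (k - 2))" by simp
  also have "card ?P \<le> card ?I" by (rule card_mono) auto
  then have "card ?P * ((2 * m + 1)\<^sup>2 * n ^ (k - 2)) \<le> k ^ 4 * ((2 * m + 1)\<^sup>2 * n ^ (k - 2))"
    by (intro mult_right_mono) (auto simp: card_cartesian_product power4_eq_xxxx mult.assoc)
  finally show ?thesis .
qed

text \<open>The product is at least \<open>(n - k)^k\<close>, and Bernoulli's inequality for
  \<open>(1 - k/n)^k\<close> bounds the loss by \<open>k^2 * n^(k - 1)\<close>. The threshold
  \<open>2 * k^2 \<le> n\<close> makes this loss at most half of \<open>n^k\<close>.\<close>

lemma falling_factorial_bounds: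
  assumes "2 * k\<^sup>2 \<le> n"
  shows "(\<Prod>l<k. real n - real l) \<le> real n ^ k"
    and "real n ^ k \<le> (\<Prod>l<k. real n - real l) + (real k)\<^sup>2 * real n ^ (k - 1)"
    and "real n ^ k / 2 \<le> (\<Prod>l<k. real n - real l)"
proof -
  have kn: "k \<le> n" using assms by (cases k) (auto simp: power2_eq_square)
  have "(\<Prod>l<k. real n - real l) \<le> (\<Prod>l<k. real n)" using kn by (intro prod_mono) auto
  then show "(\<Prod>l<k. real n - real l) \<le> real n ^ k" by simp
  show 2: "real n ^ k \<le> (\<Prod>l<k. real n - real l) + (real k)\<^sup>2 * real n ^ (k - 1)"
  proof (cases "k = 0")
    case False
    then have n: "0 < n" using kn by simp
    have "(\<Prod>l<k. real n - real k) \<le> (\<Prod>l<k. real n - real l)" using kn by (intro prod_mono) auto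
    moreover have "real n ^ k * (1 + real k * (- (real k / real n))) \<le> real n ^ k * (1 + (- (real k / real n))) ^ k"
      using kn n by (intro mult_left_mono Bernoulli_inequality) auto
    moreover have "real n ^ k * (1 + (- (real k / real n))) ^ k = (real n - real k) ^ k"
      using n by (simp add: power_mult_distrib[symmetric] algebra_simps)
    moreover have "real n ^ k * (1 + real k * (- (real k / real n))) = real n ^ k - (real k)\<^sup>2 * real n ^ (k - 1)"
      using n False power_minus_mult[of k "real n"] by (simp add: field_simps power2_eq_square)
    ultimately show ?thesis by simp
  qed simp
  show "real n ^ k / 2 \<le> (\<Prod>l<k. real n - real l)"
  proof (cases "k = 0")
    case False
    have "2 * (real k)\<^sup>2 \<le> real n" using assms by (metis of_nat_le_iff of_nat_mult of_nat_numeral of_nat_power)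
    then have "(2 * (real k)\<^sup>2) * real n ^ (k - 1) \<le> real n * real n ^ (k - 1)" by (intro mult_right_mono) auto
    also have "\<dots> = real n ^ k" using False by (simp add: power_eq_if)
    finally show ?thesis using 2 by simp
  qed simp
qed

section \<open>The projections of the kernel\<close>

lemma permutes_transpose_1: "a \<in> {1..k} \<Longrightarrow> Transposition.transpose 1 a permutes {1..k::nat}"
  by (intro permutes_swap_id) auto

lemma lag_generic_comp_permutes:
  assumes "lag_generic m k i" "p permutes {1..k}" shows "lag_generic m k (i \<circ> p)"
  unfolding lag_generic_def
proof (intro ballI impI)
  fix a b assume "a \<in> {1..k}" "b \<in> {1..k}" "a \<noteq> b"
  moreover have "p a \<noteq> p b" using permutes_inj[OF assms(2)] \<open>a \<noteq> b\<close> by (auto dest: injD)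
  ultimately show "int m < \<bar>int ((i \<circ> p) a) - int ((i \<circ> p) b)\<bar>"
    using assms(1) permutes_in_image[OF assms(2)] unfolding lag_generic_def comp_def by blast
qed

lemma PiE_comp_permutes:
  assumes "i \<in> A \<rightarrow>\<^sub>E B" "p permutes A" shows "i \<circ> p \<in> A \<rightarrow>\<^sub>E B"
proof (rule PiE_I)
  show "(i \<circ> p) x \<in> B" if "x \<in> A" for x
    using assms(1) permutes_in_image[OF assms(2)] that by auto
  show "(i \<circ> p) x = undefined" if "x \<notin> A" for x
    using assms(1) permutes_not_in[OF assms(2) that] that by (auto simp: PiE_def extensional_def)
qed

section \<open>Joint laws of separated blocks\<close>

context m_dependent_sequence
begin

text \<open>Independence as a product law, the form that Fubini's theorem consumes in
  \<open>kernel_regression\<close>. The two targets may be of different types; there, one is a pair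
  and the other a tuple of coordinates.\<close>

lemma distr_Pair_alg:
  assumes IJ: "finite I" "finite J" "I \<subseteq> {1..}" "J \<subseteq> {1..}" "separated m I J"
    and X: "X \<in> measurable (alg I) N1" and Y: "Y \<in> measurable (alg J) N2"
  shows "distr M N1 X \<Otimes>\<^sub>M distr M N2 Y = distr M (N1 \<Otimes>\<^sub>M N2) (\<lambda>\<omega>. (X \<omega>, Y \<omega>))"
proof -
  have XM: "X \<in> measurable M N1" and YM: "Y \<in> measurable M N2"
    using measurable_alg_M X Y IJ by blast+
  interpret X: prob_space "distr M N1 X" by (rule prob_space_distr[OF XM])
  interpret Y: prob_space "distr M N2 Y" by (rule prob_space_distr[OF YM])
  have pairM: "(\<lambda>\<omega>. (X \<omega>, Y \<omega>)) \<in> measurable M (N1 \<Otimes>\<^sub>M N2)" by (rule measurable_Pair[OF XM YM])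
  show ?thesis
  proof (rule pair_measure_eqI)
    fix A B assume "A \<in> sets (distr M N1 X)" "B \<in> sets (distr M N2 Y)"
    then have A: "A \<in> sets N1" and B: "B \<in> sets N2" by simp_all
    have "prob ((X -` A \<inter> space M) \<inter> (Y -` B \<inter> space M)) = prob (X -` A \<inter> space M) * prob (Y -` B \<inter> space M)"
      using indep_setD[OF indep_alg[OF IJ]] measurable_sets[OF X A] measurable_sets[OF Y B] by simp
    moreover have "(X -` A \<inter> space M) \<inter> (Y -` B \<inter> space M) = (\<lambda>\<omega>. (X \<omega>, Y \<omega>)) -` (A \<times> B) \<inter> space M"
      by auto
    ultimately show "emeasure (distr M N1 X) A * emeasure (distr M N2 Y) B
        = emeasure (distr M (N1 \<Otimes>\<^sub>M N2) (\<lambda>\<omega>. (X \<omega>, Y \<omega>))) (A \<times> B)"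
      using A B by (simp add: emeasure_distr XM YM pairM emeasure_eq_measure ennreal_mult)
  qed (simp_all add: X.sigma_finite_measure_axioms Y.sigma_finite_measure_axioms cong: sets_pair_measure_cong)
qed

end

text \<open>Uniform integrability is replaced by a bound \<open>C\<close> on moments of order
  \<open>p\<close> over all tuples, including those with repeated or close indices. The order is a
  parameter because parts (a) and (b) use \<open>r\<close>, while part (c) uses an order
  \<open>2 + d\<close> with \<open>d \<le> 1\<close>.\<close>

locale U_statistic = m_dependent_sequence M S m W
  for M :: "'a measure" and S :: "'b measure" and m W +
  fixes k :: nat and \<phi> :: "(nat \<Rightarrow> 'b) \<Rightarrow> real" and p C :: real
  assumes k2: "2 \<le> k"
    and \<phi>_measurable: "\<phi> \<in> borel_measurable (\<Pi>\<^sub>M l\<in>{1..k}. S)"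
    and sym: "symmetric_kernel S k \<phi>"
    and centred: "centred_on_lag_generic M m k \<phi> W"
    and p2: "2 \<le> p"
    and moment_integrable: "\<And>i. i \<in> {1..k} \<rightarrow>\<^sub>E {1..} \<Longrightarrow> integrable M (\<lambda>\<omega>. \<bar>kernel_at k \<phi> W i \<omega>\<bar> powr p)"
    and moment_le: "\<And>i. i \<in> {1..k} \<rightarrow>\<^sub>E {1..} \<Longrightarrow> (\<integral>\<omega>. \<bar>kernel_at k \<phi> W i \<omega>\<bar> powr p \<partial>M) \<le> C"
begin

abbreviation tuples :: "(nat \<Rightarrow> nat) set" where
  "tuples \<equiv> {1..k} \<rightarrow>\<^sub>E {1..}"

abbreviation \<Phi> :: "(nat \<Rightarrow> nat) \<Rightarrow> 'a \<Rightarrow> real" where "\<Phi> \<equiv> kernel_at k \<phi> W"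

abbreviation sigma_W :: "nat \<Rightarrow> 'a measure" where
  "sigma_W i \<equiv> vimage_algebra (space M) (W i) S"

text \<open>Conditioning is always on the first coordinate; projections onto other coordinates are
  reached by transposing the tuple, which the symmetry of the kernel permits.\<close>

definition pr :: "(nat \<Rightarrow> nat) \<Rightarrow> 'a \<Rightarrow> real" where
  "pr i = real_cond_exp M (sigma_W (i 1)) (\<Phi> i)"

definition generic :: "(nat \<Rightarrow> nat) \<Rightarrow> bool" where
  "generic i \<longleftrightarrow> i \<in> tuples \<and> lag_generic m k i"

lemma one_in: "1 \<in> {1..k}" using k2 by auto

lemma Suc_0_in [simp]: "Suc 0 \<le> k" using k2 by auto

lemma tuple_pos: "i \<in> tuples \<Longrightarrow> A \<subseteq> {1..k} \<Longrightarrow> i ` A \<subseteq> {1..}"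
  by (auto simp: PiE_def Pi_def)

lemma C_nonneg: "0 \<le> C"
proof -
  have "restrict (\<lambda>_. 1) {1..k} \<in> {1..k} \<rightarrow>\<^sub>E {1::nat..}" by auto
  from moment_le[OF this] show ?thesis by (rule order_trans[rotated]) (auto intro!: integral_nonneg)
qed

lemma \<Phi>_alg:
  assumes "i \<in> tuples" shows "\<Phi> i \<in> borel_measurable (alg (i ` {1..k}))"
proof -
  have "(\<lambda>\<omega>. \<lambda>l\<in>{1..k}. W (i l) \<omega>) \<in> measurable (alg (i ` {1..k})) (\<Pi>\<^sub>M l\<in>{1..k}. S)"
    by (intro measurable_restrict W_alg tuple_pos[OF assms]) auto
  from measurable_comp[OF this \<phi>_measurable] show ?thesis
    unfolding comp_def kernel_at_def .
qed

lemma \<Phi>_measurable: "i \<in> tuples \<Longrightarrow> \<Phi> i \<in> borel_measurable M"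
  by (rule measurable_alg_M[OF \<Phi>_alg tuple_pos]) auto

lemma moments:
  fixes X :: "'a \<Rightarrow> real"
  assumes [measurable]: "X \<in> borel_measurable M"
    and int: "integrable M (\<lambda>\<omega>. \<bar>X \<omega>\<bar> powr p)" and le: "(\<integral>\<omega>. \<bar>X \<omega>\<bar> powr p \<partial>M) \<le> C"
  shows "integrable M (\<lambda>\<omega>. (X \<omega>)\<^sup>2)" "(\<integral>\<omega>. (X \<omega>)\<^sup>2 \<partial>M) \<le> 1 + C" "integrable M X" "(\<integral>\<omega>. \<bar>X \<omega>\<bar> \<partial>M) \<le> 1 + C"
proof -
  have int1: "integrable M (\<lambda>\<omega>. 1 + \<bar>X \<omega>\<bar> powr p)" using int by simp
  have le1: "(\<integral>\<omega>. 1 + \<bar>X \<omega>\<bar> powr p \<partial>M) \<le> 1 + C" using int le by (simp add: prob_space)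
  have 2: "(X \<omega>)\<^sup>2 \<le> 1 + \<bar>X \<omega>\<bar> powr p" for \<omega>
    using le_one_plus_powr[of "\<bar>X \<omega>\<bar>" 2 p] p2 by simp
  have 1: "\<bar>X \<omega>\<bar> \<le> 1 + \<bar>X \<omega>\<bar> powr p" for \<omega>
    using le_one_plus_powr[of "\<bar>X \<omega>\<bar>" 1 p] p2 by simp
  show X2: "integrable M (\<lambda>\<omega>. (X \<omega>)\<^sup>2)"
    by (rule Bochner_Integration.integrable_bound[OF int1]) (use 2 in \<open>auto intro!: AE_I2 order_trans[OF _ abs_ge_self]\<close>)
  show X1: "integrable M X"
    by (rule Bochner_Integration.integrable_bound[OF int1]) (use 1 in \<open>auto intro!: AE_I2 order_trans[OF _ abs_ge_self]\<close>)
  show "(\<integral>\<omega>. (X \<omega>)\<^sup>2 \<partial>M) \<le> 1 + C"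
    by (rule order_trans[OF _ le1]) (intro integral_mono X2 int1 2)
  show "(\<integral>\<omega>. \<bar>X \<omega>\<bar> \<partial>M) \<le> 1 + C"
    by (rule order_trans[OF _ le1]) (intro integral_mono integrable_abs X1 int1 1)
qed

lemma \<Phi>_moments:
  assumes i: "i \<in> tuples"
  shows "integrable M (\<lambda>\<omega>. (\<Phi> i \<omega>)\<^sup>2)" "(\<integral>\<omega>. (\<Phi> i \<omega>)\<^sup>2 \<partial>M) \<le> 1 + C"
    "integrable M (\<Phi> i)" "(\<integral>\<omega>. \<bar>\<Phi> i \<omega>\<bar> \<partial>M) \<le> 1 + C"
  using moments[OF \<Phi>_measurable[OF i] moment_integrable[OF i] moment_le[OF i]] by auto

lemma \<Phi>_centred: "generic i \<Longrightarrow> (\<integral>\<omega>. \<Phi> i \<omega> \<partial>M) = 0"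
  using centred unfolding centred_on_lag_generic_def generic_def by (auto dest: has_bochner_integral_integral_eq)

lemma \<Phi>_comp_permutes:
  assumes "i \<in> tuples" "q permutes {1..k}" "\<omega> \<in> space M"
  shows "\<Phi> (i \<circ> q) \<omega> = \<Phi> i \<omega>"
proof -
  let ?x = "\<lambda>l\<in>{1..k}. W (i l) \<omega>"
  have "?x \<in> space (\<Pi>\<^sub>M l\<in>{1..k}. S)"
    using assms by (auto simp: space_PiM PiE_def Pi_def intro!: W_space)
  then have "\<phi> (?x \<circ> q) = \<phi> ?x" using sym assms(2) unfolding symmetric_kernel_def by blast
  moreover have "?x \<circ> q = (\<lambda>l\<in>{1..k}. W ((i \<circ> q) l) \<omega>)"
    using permutes_in_image[OF assms(2)] by (auto simp: fun_eq_iff)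
  ultimately show ?thesis unfolding kernel_at_def by simp
qed

lemma sets_sigma_W_le:
  assumes "1 \<le> i" shows "sets (sigma_W i) \<subseteq> sets (alg {i})"
proof -
  have W: "W i \<in> space M \<rightarrow> space S" using W_space assms by auto
  show ?thesis
    unfolding sets_vimage_algebra2[OF W] using measurable_sets[OF W_alg[of i "{i}"]] assms by auto
qed

lemma sigma_W_finite_measure_subalgebra: "1 \<le> i \<Longrightarrow> finite_measure_subalgebra M (sigma_W i)"
  using sets_sigma_W_le[of i] sets_alg_le[of "{i}"]
  by unfold_locales (auto simp: subalgebra_def)

lemma pr_alg:
  assumes "i \<in> tuples" shows "pr i \<in> borel_measurable (alg {i 1})"
proof -
  have "1 \<le> i 1" using assms one_in by (auto simp: PiE_def Pi_def)
  have "pr i \<in> borel_measurable (sigma_W (i 1))" unfolding pr_def by (rule borel_measurable_cond_exp)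
  then show ?thesis using sets_sigma_W_le[OF \<open>1 \<le> i 1\<close>] by (auto simp: measurable_def)
qed

lemma pr_measurable: "pr i \<in> borel_measurable M"
  unfolding pr_def by (rule borel_measurable_cond_exp2)

text \<open>By conditional Jensen, conditioning does not increase moments of order \<open>p\<close>,
  so the projections inherit the same constant \<open>C\<close>.\<close>

lemma pr_powr:
  assumes i: "i \<in> tuples"
  shows "integrable M (\<lambda>\<omega>. \<bar>pr i \<omega>\<bar> powr p)" "(\<integral>\<omega>. \<bar>pr i \<omega>\<bar> powr p \<partial>M) \<le> C"
proof -
  have "1 \<le> i 1" using i one_in by (auto simp: PiE_def Pi_def)
  interpret sub: finite_measure_subalgebra M "sigma_W (i 1)"
    by (rule sigma_W_finite_measure_subalgebra) fact
  let ?q = "\<lambda>x::real. \<bar>x\<bar> powr p" and ?I = "UNIV :: real set"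
  let ?E = "real_cond_exp M (sigma_W (i 1)) (\<lambda>\<omega>. ?q (\<Phi> i \<omega>))"
  note int = moment_integrable[OF i]
  have AE: "AE \<omega> in M. ?q (pr i \<omega>) \<le> ?E \<omega>"
    unfolding pr_def
    by (rule sub.real_cond_exp_jensens_inequality(2)[where I = UNIV])
       (use \<Phi>_moments(3)[OF i] int p2 convex_on_abs_powr[of p] in auto)
  have E: "integrable M ?E" "(\<integral>\<omega>. ?E \<omega> \<partial>M) = (\<integral>\<omega>. ?q (\<Phi> i \<omega>) \<partial>M)"
    using sub.real_cond_exp_int[OF int] by auto
  show 1: "integrable M (\<lambda>\<omega>. ?q (pr i \<omega>))"
  proof (rule Bochner_Integration.integrable_bound[OF E(1)])
    show "AE \<omega> in M. norm (?q (pr i \<omega>)) \<le> norm (?E \<omega>)" using AE by eventually_elim auto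
  qed (use pr_measurable in measurable)
  have "(\<integral>\<omega>. ?q (pr i \<omega>) \<partial>M) \<le> (\<integral>\<omega>. ?E \<omega> \<partial>M)"
    by (rule integral_mono_AE[OF 1 E(1) AE])
  then show "(\<integral>\<omega>. ?q (pr i \<omega>) \<partial>M) \<le> C" using E(2) moment_le[OF i] by simp
qed

lemma pr_moments:
  assumes i: "i \<in> tuples"
  shows "integrable M (\<lambda>\<omega>. (pr i \<omega>)\<^sup>2)" "(\<integral>\<omega>. (pr i \<omega>)\<^sup>2 \<partial>M) \<le> 1 + C"
    "integrable M (pr i)" "(\<integral>\<omega>. \<bar>pr i \<omega>\<bar> \<partial>M) \<le> 1 + C"
  using moments[OF pr_measurable pr_powr[OF i]] by auto

lemma pr_centred: assumes "generic i" shows "(\<integral>\<omega>. pr i \<omega> \<partial>M) = 0"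
proof -
  have i: "i \<in> tuples" using assms unfolding generic_def by simp
  then have "1 \<le> i 1" using one_in by (auto simp: PiE_def Pi_def)
  interpret sub: finite_measure_subalgebra M "sigma_W (i 1)"
    by (rule sigma_W_finite_measure_subalgebra) fact
  show ?thesis
    using sub.real_cond_exp_int(2)[OF \<Phi>_moments(3)[OF i]] \<Phi>_centred[OF assms] unfolding pr_def by simp
qed

text \<open>The function \<open>h\<close> integrates out the coordinates \<open>2, \<dots>, k\<close>.\<close>

lemma kernel_regression:
  assumes i: "i \<in> tuples"
  shows "\<exists>h\<in>borel_measurable S. \<forall>J Y. finite J \<and> J \<subseteq> {1..} \<and> separated m (i ` {2..k}) (insert (i 1) J) \<and>
      Y \<in> borel_measurable (alg J) \<and> integrable M (\<lambda>\<omega>. \<Phi> i \<omega> * Y \<omega>) \<longrightarrow>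
      integrable M (\<lambda>\<omega>. h (W (i 1) \<omega>) * Y \<omega>) \<and>
      (\<integral>\<omega>. \<Phi> i \<omega> * Y \<omega> \<partial>M) = (\<integral>\<omega>. h (W (i 1) \<omega>) * Y \<omega> \<partial>M)"
proof -
  let ?N = "\<Pi>\<^sub>M l\<in>{2..k}. S"
  define V where "V = (\<lambda>\<omega>. \<lambda>l\<in>{2..k}. W (i l) \<omega>)"
  have sub: "{2..k} \<subseteq> {1..k}" by auto
  have i1: "1 \<le> i 1" using i one_in by (auto simp: PiE_def Pi_def)
  have V: "V \<in> measurable (alg (i ` {2..k})) ?N"
    unfolding V_def by (intro measurable_restrict W_alg tuple_pos[OF i sub]) auto
  have VM: "V \<in> measurable M ?N" by (rule measurable_alg_M[OF V tuple_pos[OF i sub]])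
  define PV where "PV = distr M ?N V"
  interpret PV: prob_space PV unfolding PV_def by (rule prob_space_distr[OF VM])
  have ins: "insert 1 {2..k} = {1..k}" using k2 by auto
  have upd: "(\<lambda>(w, v). v(1 := w)) \<in> measurable (S \<Otimes>\<^sub>M ?N) (\<Pi>\<^sub>M l\<in>{1..k}. S)"
    using measurable_comp[OF measurable_pair_swap' measurable_add_dim[of 1 "{2..k}" "\<lambda>_. S"]]
    unfolding ins by (simp add: comp_def case_prod_unfold)
  have f: "(\<lambda>(w, v). \<phi> (v(1 := w))) \<in> borel_measurable (S \<Otimes>\<^sub>M ?N)"
    using measurable_comp[OF upd \<phi>_measurable] by (simp add: comp_def case_prod_unfold)
  \<comment> \<open>Fixed before \<open>J\<close> and \<open>Y\<close>: the same function must pass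
    the indicator tests that identify it with the conditional expectation and must also serve for
    later test variables.\<close>
  define h where "h = (\<lambda>w. \<integral>v. \<phi> (v(1 := w)) \<partial>PV)"
  have f': "(\<lambda>(w, v). \<phi> (v(1 := w))) \<in> borel_measurable (S \<Otimes>\<^sub>M PV)"
    using f unfolding PV_def by simp
  have h: "h \<in> borel_measurable S"
    unfolding h_def using PV.borel_measurable_lebesgue_integral[OF f'] .
  have \<Phi>V: "\<Phi> i \<omega> = \<phi> ((V \<omega>)(1 := W (i 1) \<omega>))" for \<omega>
  proof -
    have "(\<lambda>l\<in>{1..k}. W (i l) \<omega>) = (V \<omega>)(1 := W (i 1) \<omega>)"
      using k2 by (auto simp: V_def fun_eq_iff)
    then show ?thesis unfolding kernel_at_def by simp
  qed
  show ?thesis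
  proof (intro bexI[OF _ h] allI impI, elim conjE)
    fix J and Y :: "'a \<Rightarrow> real"
    assume 1: "finite J" "J \<subseteq> {1..}" "separated m (i ` {2..k}) (insert (i 1) J)"
      "Y \<in> borel_measurable (alg J)" "integrable M (\<lambda>\<omega>. \<Phi> i \<omega> * Y \<omega>)"
    \<comment> \<open>Pairing \<open>Y\<close> with \<open>W (i 1)\<close> is the point: only the
      pair has to be independent of the remaining coordinates, so \<open>Y\<close> itself may depend
      on \<open>W (i 1)\<close>.\<close>
    let ?X = "\<lambda>\<omega>. (W (i 1) \<omega>, Y \<omega>)"
    have J': "insert (i 1) J \<subseteq> {1..}" using 1(2) i1 by auto
    have X: "?X \<in> measurable (alg (insert (i 1) J)) (S \<Otimes>\<^sub>M borel)"
      by (intro measurable_Pair W_alg measurable_alg_mono[OF 1(4)] J') auto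
    have XM: "?X \<in> measurable M (S \<Otimes>\<^sub>M borel)" by (rule measurable_alg_M[OF X J'])
    have YM: "Y \<in> borel_measurable M" by (rule measurable_alg_M[OF 1(4,2)])
    have joint: "distr M (S \<Otimes>\<^sub>M borel) ?X \<Otimes>\<^sub>M PV = distr M ((S \<Otimes>\<^sub>M borel) \<Otimes>\<^sub>M ?N) (\<lambda>\<omega>. (?X \<omega>, V \<omega>))"
      unfolding PV_def
      by (rule distr_Pair_alg[OF _ _ J' tuple_pos[OF i sub] separated_sym[OF 1(3)] X V]) (use 1(1) in auto)
    define PX where "PX = distr M (S \<Otimes>\<^sub>M borel) ?X"
    interpret PX: prob_space PX unfolding PX_def by (rule prob_space_distr[OF XM])
    interpret pair_sigma_finite PX PV ..
    let ?g = "\<lambda>((w, y), v). \<phi> (v(1 := w)) * (y::real)"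
    have g: "?g \<in> borel_measurable ((S \<Otimes>\<^sub>M borel) \<Otimes>\<^sub>M ?N)"
    proof -
      have "(\<lambda>z. (fst (fst z), snd z)) \<in> measurable ((S \<Otimes>\<^sub>M (borel :: real measure)) \<Otimes>\<^sub>M ?N) (S \<Otimes>\<^sub>M ?N)"
        by measurable
      from measurable_comp[OF this f] have [measurable]: "(\<lambda>z. \<phi> ((snd z)(1 := fst (fst z))))
          \<in> borel_measurable ((S \<Otimes>\<^sub>M (borel :: real measure)) \<Otimes>\<^sub>M ?N)"
        by (simp add: comp_def)
      show ?thesis unfolding case_prod_unfold by measurable
    qed
    have pairM: "(\<lambda>\<omega>. (?X \<omega>, V \<omega>)) \<in> measurable M ((S \<Otimes>\<^sub>M borel) \<Otimes>\<^sub>M ?N)"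
      by (intro measurable_Pair1' measurable_Pair XM VM)
    have gint: "integrable (PX \<Otimes>\<^sub>M PV) ?g"
      unfolding PX_def joint using 1(5) by (subst integrable_distr_eq[OF pairM g]) (simp add: \<Phi>V)
    have inner: "(\<integral>v. ?g (z, v) \<partial>PV) = h (fst z) * snd z" for z
      by (simp add: case_prod_unfold h_def)
    have hm: "(\<lambda>z. h (fst z) * snd z) \<in> borel_measurable (S \<Otimes>\<^sub>M (borel :: real measure))"
      using h by measurable
    have "(\<integral>\<omega>. \<Phi> i \<omega> * Y \<omega> \<partial>M) = integral\<^sup>L (PX \<Otimes>\<^sub>M PV) ?g"
      unfolding PX_def joint by (subst integral_distr[OF pairM g]) (simp add: \<Phi>V)
    also have "\<dots> = (\<integral>z. h (fst z) * snd z \<partial>PX)"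
      using integral_fst'[OF gint] unfolding inner by simp
    also have "\<dots> = (\<integral>\<omega>. h (W (i 1) \<omega>) * Y \<omega> \<partial>M)"
      unfolding PX_def by (subst integral_distr[OF XM hm]) simp
    finally have eq: "(\<integral>\<omega>. \<Phi> i \<omega> * Y \<omega> \<partial>M) = (\<integral>\<omega>. h (W (i 1) \<omega>) * Y \<omega> \<partial>M)" .
    have "integrable PX (\<lambda>z. h (fst z) * snd z)"
      using integrable_fst'[OF gint] unfolding inner .
    then have "integrable M (\<lambda>\<omega>. h (W (i 1) \<omega>) * Y \<omega>)"
      unfolding PX_def by (subst (asm) integrable_distr_eq[OF XM hm]) simp
    with eq show "integrable M (\<lambda>\<omega>. h (W (i 1) \<omega>) * Y \<omega>) \<and>
      (\<integral>\<omega>. \<Phi> i \<omega> * Y \<omega> \<partial>M) = (\<integral>\<omega>. h (W (i 1) \<omega>) * Y \<omega> \<partial>M)" by simp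
  qed
qed

lemma generic_separated_first:
  assumes "generic i" shows "separated m (i ` {2..k}) {i 1}"
  unfolding separated_def
proof clarify
  fix a assume "a \<in> {2..k}"
  then have "a \<in> {1..k}" "a \<noteq> 1" by auto
  then show "int m < \<bar>int (i a) - int (i 1)\<bar>"
    using assms one_in unfolding generic_def lag_generic_def by blast
qed

text \<open>Although \<open>pr i\<close> conditions on \<open>W (i 1)\<close> alone, it replaces the
  kernel against every \<open>Y\<close> whose block is separated from the other coordinates, even
  when that block is near or contains \<open>i 1\<close>. Given the first coordinate,
  \<open>Y\<close> carries no information about the others.\<close>

lemma expectation_kernel_eq_projection:
  assumes gen: "generic i" and J: "finite J" "J \<subseteq> {1..}" "separated m (i ` {2..k}) J"
    and Y: "Y \<in> borel_measurable (alg J)" "integrable M (\<lambda>\<omega>. \<Phi> i \<omega> * Y \<omega>)"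
  shows "(\<integral>\<omega>. \<Phi> i \<omega> * Y \<omega> \<partial>M) = (\<integral>\<omega>. pr i \<omega> * Y \<omega> \<partial>M)"
proof -
  have i: "i \<in> tuples" using gen unfolding generic_def by simp
  then have i1: "1 \<le> i 1" using one_in by (auto simp: PiE_def Pi_def)
  interpret sub: finite_measure_subalgebra M "sigma_W (i 1)"
    by (rule sigma_W_finite_measure_subalgebra) fact
  have sep1: "separated m (i ` {2..k}) (insert (i 1) J)" if "separated m (i ` {2..k}) J" for J
    using that generic_separated_first[OF gen] unfolding separated_def by blast
  obtain h where h: "h \<in> borel_measurable S"
    and reg: "\<And>J Y. finite J \<Longrightarrow> J \<subseteq> {1..} \<Longrightarrow> separated m (i ` {2..k}) (insert (i 1) J) \<Longrightarrow>
      Y \<in> borel_measurable (alg J) \<Longrightarrow> integrable M (\<lambda>\<omega>. \<Phi> i \<omega> * Y \<omega>) \<Longrightarrow>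
      integrable M (\<lambda>\<omega>. h (W (i 1) \<omega>) * Y \<omega>) \<and>
      (\<integral>\<omega>. \<Phi> i \<omega> * Y \<omega> \<partial>M) = (\<integral>\<omega>. h (W (i 1) \<omega>) * Y \<omega> \<partial>M)"
    using kernel_regression[OF i] by blast
  have hW_F: "(\<lambda>\<omega>. h (W (i 1) \<omega>)) \<in> borel_measurable (sigma_W (i 1))"
    by (rule measurable_compose[OF measurable_vimage_algebra1 h]) (use W_space i1 in auto)
  have int: "integrable M (\<Phi> i)" by (rule \<Phi>_moments(3)[OF i])
  \<comment> \<open>Regression tested with \<open>J = {i 1}\<close>: indicators of events of
    \<open>W (i 1)\<close> characterize the conditional expectation almost everywhere.\<close>
  have AE: "AE \<omega> in M. pr i \<omega> = h (W (i 1) \<omega>)"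
    unfolding pr_def
  proof (rule sub.real_cond_exp_charact[OF _ int _ hW_F])
    show "integrable M (\<lambda>\<omega>. h (W (i 1) \<omega>))"
      using reg[of "{i 1}" "\<lambda>_. 1"] int i1 generic_separated_first[OF gen] by auto
    fix A assume A: "A \<in> sets (sigma_W (i 1))"
    then have A1: "A \<in> sets (alg {i 1})" using sets_sigma_W_le[OF i1] by auto
    then have AM: "A \<in> events" using sets_alg_le[of "{i 1}"] i1 by auto
    have "(\<integral>\<omega>. \<Phi> i \<omega> * indicator A \<omega> \<partial>M) = (\<integral>\<omega>. h (W (i 1) \<omega>) * indicator A \<omega> \<partial>M)"
    proof (rule reg[THEN conjunct2])
      show "(indicator A :: 'a \<Rightarrow> real) \<in> borel_measurable (alg {i 1})"
        using A1 by (rule borel_measurable_indicator)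
      show "integrable M (\<lambda>\<omega>. \<Phi> i \<omega> * indicator A \<omega>)"
        using integrable_mult_indicator[OF AM int] by (simp add: mult.commute)
    qed (use i1 generic_separated_first[OF gen] in auto)
    then show "(\<integral>\<omega>\<in>A. \<Phi> i \<omega> \<partial>M) = (\<integral>\<omega>\<in>A. h (W (i 1) \<omega>) \<partial>M)"
      unfolding set_lebesgue_integral_def by (simp add: mult.commute)
  qed
  have "(\<integral>\<omega>. pr i \<omega> * Y \<omega> \<partial>M) = (\<integral>\<omega>. h (W (i 1) \<omega>) * Y \<omega> \<partial>M)"
  proof (rule integral_cong_AE)
    show "(\<lambda>\<omega>. pr i \<omega> * Y \<omega>) \<in> borel_measurable M"
      using pr_measurable measurable_alg_M[OF Y(1) J(2)] by measurable
    show "(\<lambda>\<omega>. h (W (i 1) \<omega>) * Y \<omega>) \<in> borel_measurable M"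
      using measurable_compose[OF W_measurable[OF i1] h] measurable_alg_M[OF Y(1) J(2)] by measurable
    show "AE \<omega> in M. pr i \<omega> * Y \<omega> = h (W (i 1) \<omega>) * Y \<omega>" using AE by eventually_elim simp
  qed
  then show ?thesis using reg[OF J(1,2) sep1[OF J(3)] Y] by simp
qed

end

section \<open>Orthogonality of the degenerate parts\<close>

text \<open>The pointwise bound \<open>\<bar>x\<bar> \<le> c + x^2 / c\<close> takes the place of
  Cauchy-Schwarz; \<open>c\<close> is the expected scale of \<open>X\<close>, and only the constant
  in front is worse.\<close>

lemma (in prob_space) L1_le_of_L2:
  fixes X :: "'a \<Rightarrow> real"
  assumes [measurable]: "X \<in> borel_measurable M" and X2: "integrable M (\<lambda>\<omega>. (X \<omega>)\<^sup>2)"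
    and le: "(\<integral>\<omega>. (X \<omega>)\<^sup>2 \<partial>M) \<le> K * c\<^sup>2" and c: "0 < c"
  shows "integrable M X" "(\<integral>\<omega>. \<bar>X \<omega>\<bar> \<partial>M) \<le> (1 + K) * c"
proof -
  show X: "integrable M X" by (rule square_integrable_imp_integrable[OF assms(1) X2])
  have bd: "\<bar>X \<omega>\<bar> \<le> c + (X \<omega>)\<^sup>2 / c" for \<omega>
  proof (cases "\<bar>X \<omega>\<bar> \<le> c")
    case False
    then have "c * \<bar>X \<omega>\<bar> \<le> \<bar>X \<omega>\<bar> * \<bar>X \<omega>\<bar>" by (intro mult_right_mono) auto
    then have "\<bar>X \<omega>\<bar> \<le> (X \<omega>)\<^sup>2 / c" using c by (simp add: field_simps power2_eq_square)
    then show ?thesis using c by simp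
  next
    case True
    moreover have "0 \<le> (X \<omega>)\<^sup>2 / c" using c by simp
    ultimately show ?thesis by linarith
  qed
  have int: "integrable M (\<lambda>\<omega>. c + (X \<omega>)\<^sup>2 / c)" using X2 by simp
  have "(\<integral>\<omega>. \<bar>X \<omega>\<bar> \<partial>M) \<le> (\<integral>\<omega>. c + (X \<omega>)\<^sup>2 / c \<partial>M)"
    by (intro integral_mono integrable_abs X int bd)
  also have "\<dots> = c + (\<integral>\<omega>. (X \<omega>)\<^sup>2 \<partial>M) / c" using X2 by (simp add: prob_space)
  also have "\<dots> \<le> c + K * c\<^sup>2 / c" using le c by (intro add_left_mono divide_right_mono) auto
  also have "\<dots> = (1 + K) * c" using c by (simp add: power2_eq_square algebra_simps)
  finally show "(\<integral>\<omega>. \<bar>X \<omega>\<bar> \<partial>M) \<le> (1 + K) * c" .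
qed

lemma integral_mult_le_of_squares:
  fixes X Y :: "'a \<Rightarrow> real"
  assumes "X \<in> borel_measurable M" "Y \<in> borel_measurable M"
    and X2: "integrable M (\<lambda>\<omega>. (X \<omega>)\<^sup>2)" "(\<integral>\<omega>. (X \<omega>)\<^sup>2 \<partial>M) \<le> K"
    and Y2: "integrable M (\<lambda>\<omega>. (Y \<omega>)\<^sup>2)" "(\<integral>\<omega>. (Y \<omega>)\<^sup>2 \<partial>M) \<le> K"
  shows "(\<integral>\<omega>. X \<omega> * Y \<omega> \<partial>M) \<le> K"
proof -
  have "x * y \<le> x\<^sup>2 / 2 + y\<^sup>2 / 2" for x y :: real
    using sum_squares_bound[of x y] by simp
  then have "(\<integral>\<omega>. X \<omega> * Y \<omega> \<partial>M) \<le> (\<integral>\<omega>. (X \<omega>)\<^sup>2 / 2 + (Y \<omega>)\<^sup>2 / 2 \<partial>M)"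
    using assms by (intro integral_mono integrable_mult_square_integrable) auto
  also have "\<dots> = (\<integral>\<omega>. (X \<omega>)\<^sup>2 \<partial>M) / 2 + (\<integral>\<omega>. (Y \<omega>)\<^sup>2 \<partial>M) / 2" using X2 Y2 by simp
  finally show ?thesis using X2 Y2 by simp
qed

text \<open>The outer sum runs over the second factor, so that the inner sums count the tuples
  linked to a fixed one.\<close>

lemma integral_sum_square:
  fixes X :: "'i \<Rightarrow> 'a \<Rightarrow> real"
  assumes "\<And>i. i \<in> I \<Longrightarrow> X i \<in> borel_measurable M" "\<And>i. i \<in> I \<Longrightarrow> integrable M (\<lambda>\<omega>. (X i \<omega>)\<^sup>2)"
  shows "(\<integral>\<omega>. (\<Sum>i\<in>I. X i \<omega>)\<^sup>2 \<partial>M) = (\<Sum>j\<in>I. \<Sum>i\<in>I. \<integral>\<omega>. X i \<omega> * X j \<omega> \<partial>M)"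
proof -
  have "(\<integral>\<omega>. (\<Sum>i\<in>I. X i \<omega>)\<^sup>2 \<partial>M) = (\<integral>\<omega>. (\<Sum>i\<in>I. \<Sum>j\<in>I. X i \<omega> * X j \<omega>) \<partial>M)"
    by (simp add: power2_eq_square sum_product)
  also have "\<dots> = (\<Sum>i\<in>I. \<integral>\<omega>. (\<Sum>j\<in>I. X i \<omega> * X j \<omega>) \<partial>M)"
    by (intro Bochner_Integration.integral_sum Bochner_Integration.integrable_sum
        integrable_mult_square_integrable assms)
  also have "\<dots> = (\<Sum>i\<in>I. \<Sum>j\<in>I. \<integral>\<omega>. X i \<omega> * X j \<omega> \<partial>M)"
    by (intro sum.cong refl Bochner_Integration.integral_sum integrable_mult_square_integrable assms)
  also have "\<dots> = (\<Sum>j\<in>I. \<Sum>i\<in>I. \<integral>\<omega>. X i \<omega> * X j \<omega> \<partial>M)" by (rule sum.swap)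
  finally show ?thesis .
qed

context U_statistic
begin

abbreviation \<tau> :: "nat \<Rightarrow> nat \<Rightarrow> nat" where "\<tau> a \<equiv> Transposition.transpose 1 a"

text \<open>The kernel minus its first-order Hoeffding projections:
  \<open>i \<circ> \<tau> a\<close> brings position \<open>a\<close> to the front, so its
  \<open>pr\<close> projects onto \<open>W (i a)\<close>. There is no constant term because the
  kernel is centred on generic tuples.\<close>

definition degenerate_part :: "(nat \<Rightarrow> nat) \<Rightarrow> 'a \<Rightarrow> real" where
  "degenerate_part i \<omega> = \<Phi> i \<omega> - (\<Sum>a\<in>{1..k}. pr (i \<circ> \<tau> a) \<omega>)"

definition generic_tuples :: "nat \<Rightarrow> (nat \<Rightarrow> nat) set" where
  "generic_tuples n = {i \<in> {1..k} \<rightarrow>\<^sub>E {1..n}. lag_generic m k i}"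

lemma finite_generic_tuples [simp]: "finite (generic_tuples n)"
  unfolding generic_tuples_def by (rule finite_subset[of _ "{1..k} \<rightarrow>\<^sub>E {1..n}"]) (auto intro: finite_PiE)

lemma card_generic_tuples_le: "card (generic_tuples n) \<le> n ^ k"
proof -
  have "card (generic_tuples n) \<le> card ({1..k} \<rightarrow>\<^sub>E {1..n})"
    unfolding generic_tuples_def by (rule card_mono) (auto intro: finite_PiE)
  then show ?thesis by (simp add: card_PiE)
qed

lemma tuples_pos: "i \<in> {1..k} \<rightarrow>\<^sub>E {1..n} \<Longrightarrow> i \<in> tuples"
  by (rule subsetD[OF PiE_mono]) auto

lemma generic_tuples_generic: "i \<in> generic_tuples n \<Longrightarrow> generic i"
  unfolding generic_tuples_def generic_def using tuples_pos by blast

lemma generic_tuple: "generic i \<Longrightarrow> i \<in> tuples"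
  unfolding generic_def by blast

lemma tuple_comp_\<tau>: "i \<in> tuples \<Longrightarrow> a \<in> {1..k} \<Longrightarrow> i \<circ> \<tau> a \<in> tuples"
  by (intro PiE_comp_permutes permutes_transpose_1)

lemma generic_comp_\<tau>: "generic i \<Longrightarrow> a \<in> {1..k} \<Longrightarrow> generic (i \<circ> \<tau> a)"
  unfolding generic_def
  by (elim conjE, intro conjI tuple_comp_\<tau> lag_generic_comp_permutes permutes_transpose_1)

lemma comp_\<tau>_image:
  assumes "a \<in> {1..k}" shows "(i \<circ> \<tau> a) ` {2..k} \<subseteq> i ` ({1..k} - {a})"
proof -
  have "\<tau> a c \<in> {1..k} - {a}" if "c \<in> {2..k}" for c
    using that assms by (auto simp: Transposition.transpose_def)
  then show ?thesis by auto
qed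

lemma pr_comp_alg:
  assumes "i \<in> tuples" "a \<in> {1..k}"
  shows "pr (i \<circ> \<tau> a) \<in> borel_measurable (alg {i a})"
  using pr_alg[OF tuple_comp_\<tau>[OF assms]] by simp

lemma degenerate_part_alg:
  assumes i: "i \<in> tuples"
  shows "degenerate_part i \<in> borel_measurable (alg (i ` {1..k}))"
proof -
  have "pr (i \<circ> \<tau> a) \<in> borel_measurable (alg (i ` {1..k}))" if "a \<in> {1..k}" for a
    by (rule measurable_alg_mono[OF pr_comp_alg[OF i that]]) (use that in auto)
  then have "(\<lambda>\<omega>. \<Phi> i \<omega> - (\<Sum>a\<in>{1..k}. pr (i \<circ> \<tau> a) \<omega>)) \<in> borel_measurable (alg (i ` {1..k}))"
    by (intro borel_measurable_diff borel_measurable_sum \<Phi>_alg[OF i])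
  then show ?thesis unfolding degenerate_part_def[abs_def] .
qed

lemma degenerate_part_measurable:
  "i \<in> tuples \<Longrightarrow> degenerate_part i \<in> borel_measurable M"
  by (rule measurable_alg_M[OF degenerate_part_alg tuple_pos]) auto

lemma degenerate_part_L2:
  assumes i: "i \<in> tuples"
  shows "integrable M (\<lambda>\<omega>. (degenerate_part i \<omega>)\<^sup>2)"
    and "(\<integral>\<omega>. (degenerate_part i \<omega>)\<^sup>2 \<partial>M) \<le> (2 + 2 * (real k)\<^sup>2) * (1 + C)"
proof -
  note pr2 = pr_moments(1,2)[OF tuple_comp_\<tau>[OF i]]
  have le: "(degenerate_part i \<omega>)\<^sup>2 \<le> 2 * (\<Phi> i \<omega>)\<^sup>2 + 2 * real k * (\<Sum>a\<in>{1..k}. (pr (i \<circ> \<tau> a) \<omega>)\<^sup>2)" for \<omega>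
  proof -
    have "(x - y)\<^sup>2 \<le> 2 * x\<^sup>2 + 2 * y\<^sup>2" for x y :: real
      using zero_le_power2[of "x + y"] by (simp add: power2_eq_square algebra_simps)
    then have "(degenerate_part i \<omega>)\<^sup>2 \<le> 2 * (\<Phi> i \<omega>)\<^sup>2 + 2 * (\<Sum>a\<in>{1..k}. pr (i \<circ> \<tau> a) \<omega>)\<^sup>2"
      unfolding degenerate_part_def .
    also have "(\<Sum>a\<in>{1..k}. pr (i \<circ> \<tau> a) \<omega>)\<^sup>2 \<le> (\<Sum>a\<in>{1..k}. (pr (i \<circ> \<tau> a) \<omega>)\<^sup>2) * real (card {1..k})"
      by (rule sum_squared_le_sum_of_squares)
    finally show ?thesis by (simp add: mult_ac)
  qed
  have int: "integrable M (\<lambda>\<omega>. 2 * (\<Phi> i \<omega>)\<^sup>2 + 2 * real k * (\<Sum>a\<in>{1..k}. (pr (i \<circ> \<tau> a) \<omega>)\<^sup>2))"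
    by (intro Bochner_Integration.integrable_add integrable_mult_right Bochner_Integration.integrable_sum
        \<Phi>_moments(1)[OF i] pr2(1))
  show 1: "integrable M (\<lambda>\<omega>. (degenerate_part i \<omega>)\<^sup>2)"
    by (rule Bochner_Integration.integrable_bound[OF int])
       (use le degenerate_part_measurable[OF i] in \<open>auto intro!: AE_I2 order_trans[OF _ abs_ge_self]\<close>)
  have "(\<integral>\<omega>. (degenerate_part i \<omega>)\<^sup>2 \<partial>M)
      \<le> (\<integral>\<omega>. 2 * (\<Phi> i \<omega>)\<^sup>2 + 2 * real k * (\<Sum>a\<in>{1..k}. (pr (i \<circ> \<tau> a) \<omega>)\<^sup>2) \<partial>M)"
    by (intro integral_mono 1 int le)
  also have "\<dots> = 2 * (\<integral>\<omega>. (\<Phi> i \<omega>)\<^sup>2 \<partial>M) + 2 * real k * (\<Sum>a\<in>{1..k}. \<integral>\<omega>. (pr (i \<circ> \<tau> a) \<omega>)\<^sup>2 \<partial>M)"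
    using \<Phi>_moments(1)[OF i] pr2(1)
    by (subst Bochner_Integration.integral_add) (auto simp: Bochner_Integration.integral_sum)
  also have "\<dots> \<le> 2 * (1 + C) + 2 * real k * (\<Sum>a\<in>{1..k}. 1 + C)"
    using \<Phi>_moments(2)[OF i] pr2(2) by (intro add_mono mult_left_mono sum_mono) auto
  also have "\<dots> = (2 + 2 * (real k)\<^sup>2) * (1 + C)" by (simp add: power2_eq_square algebra_simps)
  finally show "(\<integral>\<omega>. (degenerate_part i \<omega>)\<^sup>2 \<partial>M) \<le> (2 + 2 * (real k)\<^sup>2) * (1 + C)" .
qed

text \<open>\<open>Y\<close> can interact with position \<open>a\<close> only. Against such
  \<open>Y\<close> the kernel acts as its projection onto that position, which is subtracted, and
  the other projections are centred and independent of \<open>Y\<close>.\<close>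

lemma degenerate_part_orthogonal:
  assumes gen: "generic i" and a: "a \<in> {1..k}"
    and J: "finite J" "J \<subseteq> {1..}" "separated m (i ` ({1..k} - {a})) J"
    and Y: "Y \<in> borel_measurable (alg J)" "integrable M (\<lambda>\<omega>. (Y \<omega>)\<^sup>2)"
  shows "(\<integral>\<omega>. degenerate_part i \<omega> * Y \<omega> \<partial>M) = 0"
proof -
  have i: "i \<in> tuples" using gen by (rule generic_tuple)
  have YM: "Y \<in> borel_measurable M" by (rule measurable_alg_M[OF Y(1) J(2)])
  have int\<Phi>: "integrable M (\<lambda>\<omega>. \<Phi> j \<omega> * Y \<omega>)" if "j \<in> tuples" for j
    by (rule integrable_mult_square_integrable[OF \<Phi>_measurable[OF that] YM \<Phi>_moments(1)[OF that] Y(2)])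
  have intpr: "integrable M (\<lambda>\<omega>. pr (i \<circ> \<tau> c) \<omega> * Y \<omega>)" if "c \<in> {1..k}" for c
    by (rule integrable_mult_square_integrable[OF pr_measurable YM pr_moments(1)[OF tuple_comp_\<tau>[OF i that]] Y(2)])
  have "(\<integral>\<omega>. \<Phi> i \<omega> * Y \<omega> \<partial>M) = (\<integral>\<omega>. \<Phi> (i \<circ> \<tau> a) \<omega> * Y \<omega> \<partial>M)"
    by (intro Bochner_Integration.integral_cong refl)
       (simp only: \<Phi>_comp_permutes[OF i permutes_transpose_1[OF a]])
  also have "\<dots> = (\<integral>\<omega>. pr (i \<circ> \<tau> a) \<omega> * Y \<omega> \<partial>M)"
    by (rule expectation_kernel_eq_projection[OF generic_comp_\<tau>[OF gen a] J(1,2) _ Y(1) int\<Phi>[OF tuple_comp_\<tau>[OF i a]]])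
       (rule separated_mono[OF J(3) comp_\<tau>_image[OF a] subset_refl])
  finally have 1: "(\<integral>\<omega>. \<Phi> i \<omega> * Y \<omega> \<partial>M) = (\<integral>\<omega>. pr (i \<circ> \<tau> a) \<omega> * Y \<omega> \<partial>M)" .
  have 0: "(\<integral>\<omega>. pr (i \<circ> \<tau> c) \<omega> * Y \<omega> \<partial>M) = 0" if c: "c \<in> {1..k} - {a}" for c
  proof -
    have c': "c \<in> {1..k}" using c by simp
    have "{i c} \<subseteq> {1..}" using tuple_pos[OF i, of "{c}"] c' by auto
    moreover have "separated m {i c} J" by (rule separated_mono[OF J(3)]) (use c in auto)
    moreover have "integrable M Y" by (rule square_integrable_imp_integrable[OF YM Y(2)])
    ultimately show ?thesis
      using expectation_mult_alg(2)[of "{i c}" J "pr (i \<circ> \<tau> c)" Y] J(1,2) Y(1) pr_comp_alg[OF i c']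
        pr_moments(3)[OF tuple_comp_\<tau>[OF i c']] pr_centred[OF generic_comp_\<tau>[OF gen c']] by simp
  qed
  have "(\<integral>\<omega>. degenerate_part i \<omega> * Y \<omega> \<partial>M)
      = (\<integral>\<omega>. \<Phi> i \<omega> * Y \<omega> - (\<Sum>c\<in>{1..k}. pr (i \<circ> \<tau> c) \<omega> * Y \<omega>) \<partial>M)"
    unfolding degenerate_part_def left_diff_distrib sum_distrib_right ..
  also have "\<dots> = (\<integral>\<omega>. \<Phi> i \<omega> * Y \<omega> \<partial>M) - (\<Sum>c\<in>{1..k}. \<integral>\<omega>. pr (i \<circ> \<tau> c) \<omega> * Y \<omega> \<partial>M)"
    using int\<Phi>[OF i] intpr
    by (subst Bochner_Integration.integral_diff) (auto simp: Bochner_Integration.integral_sum)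
  also have "(\<Sum>c\<in>{1..k}. \<integral>\<omega>. pr (i \<circ> \<tau> c) \<omega> * Y \<omega> \<partial>M) = (\<integral>\<omega>. pr (i \<circ> \<tau> a) \<omega> * Y \<omega> \<partial>M)"
    using 0 by (subst sum.remove[OF _ a]) auto
  finally show ?thesis using 1 by simp
qed

text \<open>Deliberately asymmetric: two positions of \<open>i\<close> are involved, but both may be
  close to the same position of \<open>j\<close>. For fixed \<open>j\<close> this already costs
  \<open>i\<close> two free coordinates.\<close>

definition doubly_linked :: "(nat \<Rightarrow> nat) \<Rightarrow> (nat \<Rightarrow> nat) \<Rightarrow> bool" where
  "doubly_linked j i \<longleftrightarrow> (\<exists>a\<in>{1..k}. \<exists>b\<in>{1..k}. a \<noteq> b \<and>
      (\<exists>c\<in>{1..k}. \<bar>int (i a) - int (j c)\<bar> \<le> int m) \<and> (\<exists>c\<in>{1..k}. \<bar>int (i b) - int (j c)\<bar> \<le> int m))"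

lemma degenerate_parts_orthogonal:
  assumes i: "generic i" and j: "generic j" and nl: "\<not> doubly_linked j i"
  shows "(\<integral>\<omega>. degenerate_part i \<omega> * degenerate_part j \<omega> \<partial>M) = 0"
proof -
  let ?L = "{a\<in>{1..k}. \<exists>c\<in>{1..k}. \<bar>int (i a) - int (j c)\<bar> \<le> int m}"
  \<comment> \<open>Without a double link at most one position of \<open>i\<close> is close to
    \<open>j\<close>. That position is left out of the separation requirement; if there is none,
    position 1 serves.\<close>
  obtain a where a: "a \<in> {1..k}" "?L \<subseteq> {a}"
  proof (cases "?L = {}")
    case True
    then have "?L \<subseteq> {1}" by blast
    then show ?thesis using that one_in by blast
  next
    case False
    then obtain a where "a \<in> ?L" by blast
    moreover have "?L \<subseteq> {a}"
    proof
      fix b assume b: "b \<in> ?L"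
      show "b \<in> {a}"
      proof (rule ccontr)
        assume "b \<notin> {a}"
        then have "doubly_linked j i" unfolding doubly_linked_def using \<open>a \<in> ?L\<close> b by blast
        then show False using nl by contradiction
      qed
    qed
    ultimately show ?thesis using that by blast
  qed
  have jt: "j \<in> tuples" using j by (rule generic_tuple)
  show ?thesis
  proof (rule degenerate_part_orthogonal[OF i a(1) _ tuple_pos[OF jt subset_refl] _ degenerate_part_alg[OF jt] degenerate_part_L2(1)[OF jt]])
    show "separated m (i ` ({1..k} - {a})) (j ` {1..k})"
      unfolding separated_def
    proof clarify
      fix b c assume bc: "b \<in> {1..k}" "b \<noteq> a" "c \<in> {1..k}"
      then have "b \<notin> ?L" using a(2) by blast
      then have "\<not> \<bar>int (i b) - int (j c)\<bar> \<le> int m" using bc by blast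
      then show "int m < \<bar>int (i b) - int (j c)\<bar>" by linarith
    qed
  qed simp
qed

lemma sum_degenerate_part_L2:
  "(\<integral>\<omega>. (\<Sum>i\<in>generic_tuples n. degenerate_part i \<omega>)\<^sup>2 \<partial>M)
    \<le> (real (k ^ 4 * (2 * m + 1)\<^sup>2) * ((2 + 2 * (real k)\<^sup>2) * (1 + C))) * (real n ^ (k - 1))\<^sup>2"
proof -
  let ?K = "(2 + 2 * (real k)\<^sup>2) * (1 + C)" and ?D = degenerate_part
  have K0: "0 \<le> ?K" using C_nonneg by simp
  note mm = degenerate_part_measurable[OF generic_tuple[OF generic_tuples_generic]]
    and L2 = degenerate_part_L2[OF generic_tuple[OF generic_tuples_generic]]
  have inner: "(\<Sum>i\<in>generic_tuples n. \<integral>\<omega>. ?D i \<omega> * ?D j \<omega> \<partial>M) \<le> real (k ^ 4 * ((2 * m + 1)\<^sup>2 * n ^ (k - 2))) * ?K"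
    if j: "j \<in> generic_tuples n" for j
  proof -
    have "(\<Sum>i\<in>generic_tuples n. \<integral>\<omega>. ?D i \<omega> * ?D j \<omega> \<partial>M) \<le> (\<Sum>i\<in>generic_tuples n. if doubly_linked j i then ?K else 0)"
    proof (rule sum_mono)
      fix i assume i: "i \<in> generic_tuples n"
      show "(\<integral>\<omega>. ?D i \<omega> * ?D j \<omega> \<partial>M) \<le> (if doubly_linked j i then ?K else 0)"
        using degenerate_parts_orthogonal[OF generic_tuples_generic[OF i] generic_tuples_generic[OF j]]
          integral_mult_le_of_squares[OF mm[OF i] mm[OF j] L2[OF i] L2[OF j]] by simp
    qed
    also have "\<dots> = real (card {i \<in> generic_tuples n. doubly_linked j i}) * ?K"
      by (simp flip: sum.inter_filter)
    also have "\<dots> \<le> real (k ^ 4 * ((2 * m + 1)\<^sup>2 * n ^ (k - 2))) * ?K"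
    proof (rule mult_right_mono[OF _ K0])
      have "finite {i \<in> {1..k} \<rightarrow>\<^sub>E {1..n}. doubly_linked j i}"
        by (rule finite_subset[of _ "{1..k} \<rightarrow>\<^sub>E {1..n}"], blast, rule finite_PiE, simp_all)
      then have "card {i \<in> generic_tuples n. doubly_linked j i} \<le> card {i \<in> {1..k} \<rightarrow>\<^sub>E {1..n}. doubly_linked j i}"
        by (rule card_mono) (auto simp: generic_tuples_def)
      also have "\<dots> \<le> k ^ 4 * ((2 * m + 1)\<^sup>2 * n ^ (k - 2))"
        unfolding doubly_linked_def using card_doubly_linked_le[OF k2] .
      finally show "real (card {i \<in> generic_tuples n. doubly_linked j i}) \<le> real (k ^ 4 * ((2 * m + 1)\<^sup>2 * n ^ (k - 2)))"
        by (rule of_nat_mono)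
    qed
    finally show ?thesis .
  qed
  have "(\<integral>\<omega>. (\<Sum>i\<in>generic_tuples n. ?D i \<omega>)\<^sup>2 \<partial>M) = (\<Sum>j\<in>generic_tuples n. \<Sum>i\<in>generic_tuples n. \<integral>\<omega>. ?D i \<omega> * ?D j \<omega> \<partial>M)"
    by (rule integral_sum_square) (use mm L2 in auto)
  also have "\<dots> \<le> (\<Sum>j\<in>generic_tuples n. real (k ^ 4 * ((2 * m + 1)\<^sup>2 * n ^ (k - 2))) * ?K)"
    by (rule sum_mono) (rule inner)
  also have "\<dots> = real (card (generic_tuples n)) * (real (k ^ 4 * ((2 * m + 1)\<^sup>2 * n ^ (k - 2))) * ?K)" by simp
  also have "\<dots> \<le> real (n ^ k) * (real (k ^ 4 * ((2 * m + 1)\<^sup>2 * n ^ (k - 2))) * ?K)"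
    using K0 by (intro mult_right_mono[OF of_nat_mono[OF card_generic_tuples_le]] mult_nonneg_nonneg[OF _ K0]) simp
  also have "\<dots> = (real (k ^ 4 * (2 * m + 1)\<^sup>2) * ?K) * (real n ^ k * real n ^ (k - 2))" by simp
  \<comment> \<open>Written as a square so that \<open>L1_le_of_L2\<close> applies with the scale
    \<open>n^(k - 1)\<close>, one order below the number of tuples.\<close>
  also have "real n ^ k * real n ^ (k - 2) = (real n ^ (k - 1))\<^sup>2"
  proof -
    have "k + (k - 2) = (k - 1) * 2" using k2 by simp
    then show ?thesis by (simp flip: power_add power_mult)
  qed
  finally show ?thesis .
qed

section \<open>The averaged projections and their sum\<close>

abbreviation avg :: "nat \<Rightarrow> nat \<Rightarrow> 'a \<Rightarrow> real" where
  "avg n i \<equiv> avg_proj1 M S m k \<phi> W n i"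

abbreviation Q :: "nat \<Rightarrow> nat \<Rightarrow> nat" where
  "Q n i \<equiv> card (generic_completions m k n i)"

lemma finite_generic_completions [simp]: "finite (generic_completions m k n i)"
  unfolding generic_completions_def
  by (rule finite_subset[of _ "{2..k} \<rightarrow>\<^sub>E {1..n}"]) (auto intro: finite_PiE)

lemma proj1_eq_pr: "proj1 M S k \<phi> W i js = pr (js(1 := i))"
  unfolding proj1_def pr_def by simp

lemma completion_tuple:
  assumes "js \<in> {2..k} \<rightarrow>\<^sub>E B" "i \<in> B" shows "js(1 := i) \<in> {1..k} \<rightarrow>\<^sub>E B"
proof -
  have "insert 1 {2..k} = {1..k}" using k2 by auto
  then show ?thesis using PiE_fun_upd[of i "\<lambda>_. B" 1 js "{2..k}"] assms by simp
qed

lemma generic_completion: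
  assumes "js \<in> generic_completions m k n i" "1 \<le> i" shows "generic (js(1 := i))"
proof -
  have "js \<in> {2..k} \<rightarrow>\<^sub>E {1..}" using assms(1) unfolding generic_completions_def
    by (auto intro: subsetD[OF PiE_mono])
  then show ?thesis
    using assms completion_tuple[of js "{1..}" i] unfolding generic_def generic_completions_def by auto
qed

lemma avg_alg:
  assumes "1 \<le> i" shows "avg n i \<in> borel_measurable (alg {i})"
proof -
  have "pr (js(1 := i)) \<in> borel_measurable (alg {i})" if "js \<in> generic_completions m k n i" for js
    using pr_alg[OF generic_tuple[OF generic_completion[OF that assms]]] by simp
  then have "(\<lambda>\<omega>. 1 / real (Q n i) * (\<Sum>js\<in>generic_completions m k n i. pr (js(1 := i)) \<omega>)) \<in> borel_measurable (alg {i})"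
    by (intro borel_measurable_times borel_measurable_sum) auto
  then show ?thesis unfolding avg_proj1_def[abs_def] proj1_eq_pr .
qed

lemma avg_measurable: "1 \<le> i \<Longrightarrow> avg n i \<in> borel_measurable M"
  by (rule measurable_alg_M[OF avg_alg]) auto

lemma avg_powr:
  assumes i: "1 \<le> i"
  shows "integrable M (\<lambda>\<omega>. \<bar>avg n i \<omega>\<bar> powr p)" "(\<integral>\<omega>. \<bar>avg n i \<omega>\<bar> powr p \<partial>M) \<le> C"
proof -
  let ?G = "generic_completions m k n i"
  note pr = pr_powr[OF generic_tuple[OF generic_completion[OF _ i]]]
  have le: "\<bar>avg n i \<omega>\<bar> powr p \<le> 1 / real (Q n i) * (\<Sum>js\<in>?G. \<bar>pr (js(1 := i)) \<omega>\<bar> powr p)" for \<omega>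
    unfolding avg_proj1_def proj1_eq_pr using p2 by (intro abs_average_powr_le) auto
  have int: "integrable M (\<lambda>\<omega>. 1 / real (Q n i) * (\<Sum>js\<in>?G. \<bar>pr (js(1 := i)) \<omega>\<bar> powr p))"
    by (intro integrable_mult_right Bochner_Integration.integrable_sum pr(1))
  show 1: "integrable M (\<lambda>\<omega>. \<bar>avg n i \<omega>\<bar> powr p)"
  proof (rule Bochner_Integration.integrable_bound[OF int])
    show "(\<lambda>\<omega>. \<bar>avg n i \<omega>\<bar> powr p) \<in> borel_measurable M"
      using avg_measurable[OF i] by measurable
    show "AE \<omega> in M. norm (\<bar>avg n i \<omega>\<bar> powr p)
        \<le> norm (1 / real (Q n i) * (\<Sum>js\<in>?G. \<bar>pr (js(1 := i)) \<omega>\<bar> powr p))"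
      unfolding real_norm_def abs_of_nonneg[OF powr_ge_zero]
      by (intro AE_I2 order_trans[OF le abs_ge_self])
  qed
  have "(\<integral>\<omega>. \<bar>avg n i \<omega>\<bar> powr p \<partial>M) \<le> (\<integral>\<omega>. 1 / real (Q n i) * (\<Sum>js\<in>?G. \<bar>pr (js(1 := i)) \<omega>\<bar> powr p) \<partial>M)"
    by (intro integral_mono 1 int le)
  also have "\<dots> = 1 / real (Q n i) * (\<Sum>js\<in>?G. \<integral>\<omega>. \<bar>pr (js(1 := i)) \<omega>\<bar> powr p \<partial>M)"
    using pr(1) by (simp add: Bochner_Integration.integral_sum)
  also have "\<dots> \<le> 1 / real (Q n i) * (\<Sum>js\<in>?G. C)"
    using pr(2) by (intro mult_left_mono sum_mono) auto
  \<comment> \<open>Equality unless there are no completions; then the convention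
    \<open>1 / 0 = 0\<close> leaves 0 on the left, which is where nonnegativity of \<open>C\<close>
    is used.\<close>
  also have "\<dots> \<le> C" using C_nonneg by simp
  finally show "(\<integral>\<omega>. \<bar>avg n i \<omega>\<bar> powr p \<partial>M) \<le> C" .
qed

lemma avg_moments:
  assumes i: "1 \<le> i"
  shows "integrable M (\<lambda>\<omega>. (avg n i \<omega>)\<^sup>2)" "(\<integral>\<omega>. (avg n i \<omega>)\<^sup>2 \<partial>M) \<le> 1 + C"
    "integrable M (avg n i)" "(\<integral>\<omega>. \<bar>avg n i \<omega>\<bar> \<partial>M) \<le> 1 + C"
  using moments[OF avg_measurable[OF i] avg_powr[OF i]] by auto

lemma avg_centred:
  assumes i: "1 \<le> i" shows "(\<integral>\<omega>. avg n i \<omega> \<partial>M) = 0"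
proof -
  have "(\<integral>\<omega>. avg n i \<omega> \<partial>M) = 1 / real (Q n i) * (\<Sum>js\<in>generic_completions m k n i. \<integral>\<omega>. pr (js(1 := i)) \<omega> \<partial>M)"
    unfolding avg_proj1_def proj1_eq_pr
    using pr_moments(3)[OF generic_tuple[OF generic_completion[OF _ i]]]
    by (simp add: Bochner_Integration.integral_sum)
  also have "(\<Sum>js\<in>generic_completions m k n i. \<integral>\<omega>. pr (js(1 := i)) \<omega> \<partial>M) = 0"
    by (intro sum.neutral ballI pr_centred generic_completion[OF _ i])
  finally show ?thesis by simp
qed

abbreviation linear_part :: "nat \<Rightarrow> 'a \<Rightarrow> real" where
  "linear_part n \<omega> \<equiv> \<Sum>i=1..n. avg n i \<omega>"

text \<open>Each row of the covariance matrix has at most \<open>2 * m + 1\<close> nonzero entries,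
  those in the \<open>m\<close>-window, so the second moment grows linearly in
  \<open>n\<close>.\<close>

lemma sum_avg_L2:
  "(\<integral>\<omega>. (linear_part n \<omega>)\<^sup>2 \<partial>M) \<le> real n * (real (2 * m + 1) * (1 + C))"
proof -
  have C: "0 \<le> 1 + C" using C_nonneg by simp
  have pos: "1 \<le> i" if "i \<in> {1..n}" for i using that by simp
  have inner: "(\<Sum>i=1..n. \<integral>\<omega>. avg n i \<omega> * avg n j \<omega> \<partial>M) \<le> real (2 * m + 1) * (1 + C)" if j: "j \<in> {1..n}" for j
  proof -
    have "(\<Sum>i=1..n. \<integral>\<omega>. avg n i \<omega> * avg n j \<omega> \<partial>M) \<le> (\<Sum>i=1..n. if i \<in> near n m j then 1 + C else 0)"
    proof (rule sum_mono)
      fix i assume i: "i \<in> {1..n}"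
      show "(\<integral>\<omega>. avg n i \<omega> * avg n j \<omega> \<partial>M) \<le> (if i \<in> near n m j then 1 + C else 0)"
      proof (cases "i \<in> near n m j")
        case True
        then show ?thesis
          using integral_mult_le_of_squares[OF avg_measurable[OF pos[OF i]] avg_measurable[OF pos[OF j]]
              avg_moments(1,2)[OF pos[OF i]] avg_moments(1,2)[OF pos[OF j]]] by simp
      next
        case False
        then have "separated m {i} {j}" using i unfolding separated_def near_def by auto
        then have "(\<integral>\<omega>. avg n i \<omega> * avg n j \<omega> \<partial>M) = (\<integral>\<omega>. avg n i \<omega> \<partial>M) * (\<integral>\<omega>. avg n j \<omega> \<partial>M)"
          using i j by (intro expectation_mult_alg(2)[OF _ _ _ _ _ avg_alg avg_alg] avg_moments(3)) auto
        then show ?thesis using False avg_centred[OF pos[OF i]] by simp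
      qed
    qed
    also have "\<dots> = real (card (near n m j)) * (1 + C)"
      using near_subset[of n m j] by (simp add: Int_absorb1 flip: sum.inter_restrict)
    also have "\<dots> \<le> real (2 * m + 1) * (1 + C)"
      using card_near_le[of n m j] C by (intro mult_right_mono) (simp_all only: of_nat_le_iff)
    finally show ?thesis .
  qed
  have "(\<integral>\<omega>. (linear_part n \<omega>)\<^sup>2 \<partial>M) = (\<Sum>j=1..n. \<Sum>i=1..n. \<integral>\<omega>. avg n i \<omega> * avg n j \<omega> \<partial>M)"
    by (rule integral_sum_square) (use avg_measurable avg_moments(1) in auto)
  also have "\<dots> \<le> (\<Sum>j=1..n. real (2 * m + 1) * (1 + C))"
    by (rule sum_mono) (rule inner)
  finally show ?thesis by simp
qed

end

section \<open>The linearization error\<close>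

context U_statistic
begin

definition remainder :: "nat \<Rightarrow> 'a \<Rightarrow> real" where
  "remainder n \<omega> = U_stat k \<phi> W n \<omega> - real k / real n * linear_part n \<omega>"

text \<open>Composition with a transposition is an involution of the generic tuples. Hence all
  \<open>k\<close> positions contribute the same total, which produces the factor \<open>k\<close>
  of the linear part.\<close>

lemma sum_generic_tuples_comp_\<tau>:
  assumes a: "a \<in> {1..k}" shows "(\<Sum>i\<in>generic_tuples n. f (i \<circ> \<tau> a)) = (\<Sum>i\<in>generic_tuples n. f i)"
proof -
  have mem: "i \<circ> \<tau> a \<in> generic_tuples n" if "i \<in> generic_tuples n" for i
    using that PiE_comp_permutes[OF _ permutes_transpose_1[OF a]]
      lag_generic_comp_permutes[OF _ permutes_transpose_1[OF a]]
    unfolding generic_tuples_def by blast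
  show ?thesis
    by (rule sum.reindex_bij_witness[of _ "\<lambda>i. i \<circ> \<tau> a" "\<lambda>i. i \<circ> \<tau> a"])
       (simp_all add: mem comp_assoc del: One_nat_def)
qed

text \<open>The generic tuples are fibred over their first coordinate, and the fibre over
  \<open>i\<close> has \<open>Q n i\<close> elements. This is how the averages with their unequal
  weights arise.\<close>

lemma sum_generic_tuples_proj: "(\<Sum>i\<in>generic_tuples n. pr i \<omega>) = (\<Sum>i=1..n. real (Q n i) * avg n i \<omega>)"
proof -
  let ?G = "generic_completions m k n"
  \<comment> \<open>For \<open>Q n i = 0\<close> the division inside \<open>avg\<close> is by zero,
    but then the sum on the right is empty as well.\<close>
  have "real (Q n i) * avg n i \<omega> = (\<Sum>js\<in>?G i. pr (js(1 := i)) \<omega>)" for i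
  proof (cases "Q n i = 0")
    case True
    then have "?G i = {}" by simp
    then show ?thesis by simp
  next
    case False
    then show ?thesis unfolding avg_proj1_def proj1_eq_pr by simp
  qed
  then have "(\<Sum>i=1..n. real (Q n i) * avg n i \<omega>) = (\<Sum>i=1..n. \<Sum>js\<in>?G i. pr (js(1 := i)) \<omega>)" by simp
  also have "\<dots> = (\<Sum>(i, js)\<in>(SIGMA i:{1..n}. ?G i). pr (js(1 := i)) \<omega>)"
    by (rule sum.Sigma) auto
  also have "\<dots> = (\<Sum>i\<in>generic_tuples n. pr i \<omega>)"
  \<comment> \<open>Restriction and update at 1 are mutually inverse because both kinds of tuples
    are extensional.\<close>
  proof (rule sum.reindex_bij_witness[of _ "\<lambda>i. (i 1, restrict i {2..k})" "\<lambda>(i, js). js(1 := i)"])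
    fix q assume q: "q \<in> (SIGMA i:{1..n}. ?G i)"
    obtain i js where [simp]: "q = (i, js)" by force
    have js: "js \<in> {2..k} \<rightarrow>\<^sub>E {1..n}" "lag_generic m k (js(1 := i))" and i: "i \<in> {1..n}"
      using q by (auto simp: generic_completions_def)
    have "restrict (js(1 := i)) {2..k} = js"
    proof
      fix x show "restrict (js(1 := i)) {2..k} x = js x"
        using PiE_arb[OF js(1), of x] by (cases "x \<in> {2..k}") auto
    qed
    then show "(\<lambda>i. (i 1, restrict i {2..k})) (case q of (i, js) \<Rightarrow> js(1 := i)) = q" by simp
    show "(case q of (i, js) \<Rightarrow> js(1 := i)) \<in> generic_tuples n"
      using completion_tuple[OF js(1) i] js(2) unfolding generic_tuples_def by simp
    show "pr (case q of (i, js) \<Rightarrow> js(1 := i)) \<omega> = (case q of (i, js) \<Rightarrow> pr (js(1 := i)) \<omega>)" by simp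
  next
    fix i assume "i \<in> generic_tuples n"
    then have i: "i \<in> {1..k} \<rightarrow>\<^sub>E {1..n}" "lag_generic m k i" unfolding generic_tuples_def by auto
    have upd: "(restrict i {2..k})(1 := i 1) = i"
    proof
      fix x
      show "((restrict i {2..k})(1 := i 1)) x = i x"
        using PiE_arb[OF i(1), of x] by (cases "x = 1"; cases "x \<in> {2..k}") auto
    qed
    then show "(case (i 1, restrict i {2..k}) of (i, js) \<Rightarrow> js(1 := i)) = i" by simp
    have "restrict i {2..k} \<in> {2..k} \<rightarrow>\<^sub>E {1..n}" using i(1) by auto
    moreover have "i 1 \<in> {1..n}" using i(1) one_in by (rule PiE_mem)
    ultimately show "(i 1, restrict i {2..k}) \<in> (SIGMA i:{1..n}. ?G i)"
      unfolding generic_completions_def using upd i(2) by simp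
  qed
  finally show ?thesis ..
qed

lemma sum_generic_tuples_kernel:
  "(\<Sum>i\<in>generic_tuples n. \<Phi> i \<omega>) = (\<Sum>i\<in>generic_tuples n. degenerate_part i \<omega>) + real k * (\<Sum>i=1..n. real (Q n i) * avg n i \<omega>)"
proof -
  have "(\<Sum>i\<in>generic_tuples n. \<Sum>a\<in>{1..k}. pr (i \<circ> \<tau> a) \<omega>) = (\<Sum>a\<in>{1..k}. \<Sum>i\<in>generic_tuples n. pr (i \<circ> \<tau> a) \<omega>)"
    by (rule sum.swap)
  also have "\<dots> = (\<Sum>a\<in>{1..k}. \<Sum>i\<in>generic_tuples n. pr i \<omega>)"
    by (intro sum.cong refl sum_generic_tuples_comp_\<tau>[of _ "\<lambda>i. pr i \<omega>"])
  also have "\<dots> = real k * (\<Sum>i\<in>generic_tuples n. pr i \<omega>)" by simp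
  finally show ?thesis unfolding degenerate_part_def sum_subtractf sum_generic_tuples_proj by simp
qed

definition non_generic :: "nat \<Rightarrow> (nat \<Rightarrow> nat) set" where
  "non_generic n = {i \<in> {1..k} \<rightarrow>\<^sub>E {1..n}. inj_on i {1..k} \<and> \<not> lag_generic m k i}"

lemma finite_non_generic [simp]: "finite (non_generic n)"
  unfolding non_generic_def by (rule finite_subset[of _ "{1..k} \<rightarrow>\<^sub>E {1..n}"], blast, rule finite_PiE, simp_all)

lemma sum_tuples_split:
  "(\<Sum>i | i \<in> {1..k} \<rightarrow>\<^sub>E {1..n} \<and> inj_on i {1..k}. \<Phi> i \<omega>) = (\<Sum>i\<in>generic_tuples n. \<Phi> i \<omega>) + (\<Sum>i\<in>non_generic n. \<Phi> i \<omega>)"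
proof -
  have "{i. i \<in> {1..k} \<rightarrow>\<^sub>E {1..n} \<and> inj_on i {1..k}} = generic_tuples n \<union> non_generic n"
    using lag_generic_inj unfolding generic_tuples_def non_generic_def by blast
  moreover have "generic_tuples n \<inter> non_generic n = {}" unfolding generic_tuples_def non_generic_def by blast
  ultimately show ?thesis by (simp add: sum.union_disjoint)
qed

text \<open>An exact identity for every \<open>n\<close>, the convention \<open>1 / 0 = 0\<close>
  covering \<open>n < k\<close> as well; integrability of the remainder therefore needs no threshold
  on \<open>n\<close>.\<close>

lemma remainder_eq:
  "remainder n \<omega> = 1 / (\<Prod>l<k. real n - real l) * ((\<Sum>i\<in>non_generic n. \<Phi> i \<omega>) + (\<Sum>i\<in>generic_tuples n. degenerate_part i \<omega>))
     + real k * (\<Sum>i=1..n. (real (Q n i) / (\<Prod>l<k. real n - real l) - 1 / real n) * avg n i \<omega>)"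
proof -
  let ?P = "\<Prod>l<k. real n - real l"
  have eq: "(\<Sum>i=1..n. (real (Q n i) / ?P - 1 / real n) * avg n i \<omega>)
      = 1 / ?P * (\<Sum>i=1..n. real (Q n i) * avg n i \<omega>) - 1 / real n * linear_part n \<omega>"
    by (simp add: left_diff_distrib sum_subtractf sum_distrib_left)
  show ?thesis
    unfolding remainder_def U_stat_def sum_tuples_split sum_generic_tuples_kernel eq by (simp add: algebra_simps)
qed

lemma integrable_sum_kernel: "integrable M (\<lambda>\<omega>. \<Sum>i\<in>non_generic n. \<Phi> i \<omega>)"
  by (intro Bochner_Integration.integrable_sum \<Phi>_moments(3) tuples_pos) (auto simp: non_generic_def)

lemma integrable_degenerate_part: "i \<in> generic_tuples n \<Longrightarrow> integrable M (degenerate_part i)"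
  by (rule square_integrable_imp_integrable[OF degenerate_part_measurable degenerate_part_L2(1)])
     (rule generic_tuple[OF generic_tuples_generic], assumption)+

lemma integrable_remainder: "integrable M (remainder n)"
  unfolding remainder_eq[abs_def]
  by (intro Bochner_Integration.integrable_add integrable_mult_right integrable_sum_kernel
      Bochner_Integration.integrable_sum integrable_degenerate_part avg_moments(3)) auto

lemma U_stat_eq: "U_stat k \<phi> W n \<omega> = remainder n \<omega> + real k / real n * linear_part n \<omega>"
  unfolding remainder_def by simp

lemma sum_avg_measurable: "linear_part n \<in> borel_measurable M"
  by (intro borel_measurable_sum avg_measurable) auto

lemma integrable_sum_avg: "integrable M (linear_part n)"
  by (intro Bochner_Integration.integrable_sum avg_moments(3)) auto

lemma square_integrable_sum_avg: "integrable M (\<lambda>\<omega>. (linear_part n \<omega>)\<^sup>2)"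
  by (intro square_integrable_sum avg_measurable avg_moments(1)) auto

lemma integrable_U_stat: "integrable M (U_stat k \<phi> W n)"
  unfolding U_stat_eq[abs_def]
  by (intro Bochner_Integration.integrable_add integrable_mult_right integrable_remainder integrable_sum_avg)

text \<open>Both \<open>n * Q n i\<close> and the falling factorial differ from \<open>n^k\<close>
  by \<open>O(n^(k - 1))\<close>. Division by \<open>n\<close> times the falling factorial, which is
  at least \<open>n^(k + 1) / 2\<close>, leaves \<open>O(n^(-2))\<close> uniformly in
  \<open>i\<close>; the leading factor 2 comes from this denominator.\<close>

lemma weight_error:
  assumes n: "2 * k\<^sup>2 \<le> n"
  shows "\<bar>real (Q n i) / (\<Prod>l<k. real n - real l) - 1 / real n\<bar>
    \<le> 2 * (2 * (real k)\<^sup>2 * (2 * real m + 1) + (real k)\<^sup>2) / (real n)\<^sup>2"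
proof -
  let ?P = "\<Prod>l<k. real n - real l" and ?A = "2 * (real k)\<^sup>2 * (2 * real m + 1) + (real k)\<^sup>2"
  note P = falling_factorial_bounds[OF n]
  have n0: "0 < n" using n k2 by (cases n) auto
  have nk: "real n ^ k = real n * real n ^ (k - 1)" and nk1: "real n ^ (k - 1) = real n * real n ^ (k - 2)"
  proof -
    have "k = Suc (k - 1)" "k - 1 = Suc (k - 2)" using k2 by auto
    then show "real n ^ k = real n * real n ^ (k - 1)" "real n ^ (k - 1) = real n * real n ^ (k - 2)"
      by (metis power_Suc)+
  qed
  have P0: "0 < ?P" using P(3) n0 by (smt (verit) zero_less_power of_nat_0_less_iff half_gt_zero)
  have q1: "real (Q n i) \<le> real n ^ (k - 1)"
    using generic_completions_bounds(1)[OF k2, of m n i] by (metis of_nat_le_iff of_nat_power)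
  have "real (n ^ (k - 1)) \<le> real (Q n i + 2 * k\<^sup>2 * ((2 * m + 1) * n ^ (k - 2)))"
    using generic_completions_bounds(2)[OF k2, of n m i] by (rule of_nat_mono)
  then have q2: "real n ^ (k - 1) \<le> real (Q n i) + 2 * (real k)\<^sup>2 * (2 * real m + 1) * real n ^ (k - 2)"
    by (simp add: algebra_simps)
  have "real n * real (Q n i) \<le> real n ^ k" unfolding nk using q1 by (intro mult_left_mono) auto
  moreover have "real n ^ k \<le> real n * real (Q n i) + 2 * (real k)\<^sup>2 * (2 * real m + 1) * real n ^ (k - 1)"
    using mult_left_mono[OF q2, of "real n"] unfolding nk nk1 by (simp add: algebra_simps)
  moreover have "0 \<le> 2 * (real k)\<^sup>2 * (2 * real m + 1) * real n ^ (k - 1)" "0 \<le> (real k)\<^sup>2 * real n ^ (k - 1)" by auto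
  ultimately have A: "\<bar>real n * real (Q n i) - ?P\<bar> \<le> ?A * real n ^ (k - 1)"
    using P(1,2) unfolding distrib_right abs_le_iff by linarith
  have "\<bar>real (Q n i) / ?P - 1 / real n\<bar> = \<bar>real n * real (Q n i) - ?P\<bar> / (real n * ?P)"
  proof -
    have "real (Q n i) / ?P - 1 / real n = (real n * real (Q n i) - ?P) / (real n * ?P)"
    proof -
      have ne: "?P \<noteq> 0" "real n \<noteq> 0" using P0 n0 by linarith+
      show ?thesis
        using diff_frac_eq[OF ne, of "real (Q n i)" 1]
        by (simp only: mult_1_left mult_1_right mult.commute)
    qed
    then show ?thesis using P0 n0 by (simp add: abs_divide abs_mult)
  qed
  also have "\<dots> \<le> (?A * real n ^ (k - 1)) / (real n * (real n ^ k / 2))"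
    using A P(3) P0 n0 by (intro frac_le mult_left_mono) auto
  also have "\<dots> = 2 * ?A / (real n)\<^sup>2"
    unfolding nk using n0 by (simp add: field_simps power2_eq_square)
  finally show ?thesis .
qed

lemma L1_remainder:
  obtains K where "0 \<le> K" "\<And>n. 2 * k\<^sup>2 \<le> n \<Longrightarrow> (\<integral>\<omega>. \<bar>remainder n \<omega>\<bar> \<partial>M) \<le> K / real n"
proof -
  \<comment> \<open>One constant per error source: \<open>K1\<close> for non-generic tuples,
    \<open>K2\<close> for degenerate parts, \<open>K3\<close> for the weights. The summand 1 in
    \<open>K2\<close> is the price of passing from second to first moments.\<close>
  define K1 where "K1 = real (k\<^sup>2 * (2 * m + 1)) * (1 + C)"
  define K2 where "K2 = 1 + real (k ^ 4 * (2 * m + 1)\<^sup>2) * ((2 + 2 * (real k)\<^sup>2) * (1 + C))"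
  define K3 where "K3 = 2 * (2 * (real k)\<^sup>2 * (2 * real m + 1) + (real k)\<^sup>2)"
  have K0: "0 \<le> K1" "0 \<le> K2" "0 \<le> K3" using C_nonneg by (auto simp: K1_def K2_def K3_def)
  show ?thesis
  proof (rule that[of "2 * (K1 + K2) + real k * (K3 * (1 + C))"])
    show "0 \<le> 2 * (K1 + K2) + real k * (K3 * (1 + C))" using K0 C_nonneg by simp
    fix n assume n: "2 * k\<^sup>2 \<le> n"
    let ?P = "\<Prod>l<k. real n - real l"
    let ?w = "\<lambda>i. real (Q n i) / ?P - 1 / real n"
    let ?N = "\<lambda>\<omega>. \<Sum>i\<in>non_generic n. \<Phi> i \<omega>" and ?D = "\<lambda>\<omega>. \<Sum>i\<in>generic_tuples n. degenerate_part i \<omega>"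
    have n0: "0 < n" using n k2 by (cases n) auto
    note P = falling_factorial_bounds(3)[OF n]
    have P0: "0 < ?P" using P n0 by (smt (verit) zero_less_power of_nat_0_less_iff half_gt_zero)
    have N: "(\<integral>\<omega>. \<bar>?N \<omega>\<bar> \<partial>M) \<le> K1 * real n ^ (k - 1)"
    proof -
      have tup: "i \<in> tuples" if "i \<in> non_generic n" for i
        using that tuples_pos unfolding non_generic_def by blast
      have "(\<integral>\<omega>. \<bar>?N \<omega>\<bar> \<partial>M) \<le> (\<integral>\<omega>. (\<Sum>i\<in>non_generic n. \<bar>\<Phi> i \<omega>\<bar>) \<partial>M)"
        by (intro integral_mono integrable_abs integrable_sum_kernel Bochner_Integration.integrable_sum
            \<Phi>_moments(3) tup sum_abs)
      also have "\<dots> = (\<Sum>i\<in>non_generic n. \<integral>\<omega>. \<bar>\<Phi> i \<omega>\<bar> \<partial>M)"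
        by (intro Bochner_Integration.integral_sum integrable_abs \<Phi>_moments(3) tup)
      also have "\<dots> \<le> (\<Sum>i\<in>non_generic n. 1 + C)" by (intro sum_mono \<Phi>_moments(4) tup)
      also have "\<dots> = real (card (non_generic n)) * (1 + C)" by simp
      also have "\<dots> \<le> real (k\<^sup>2 * ((2 * m + 1) * n ^ (k - 1))) * (1 + C)"
      proof (rule mult_right_mono[OF of_nat_mono])
        have "card (non_generic n) \<le> card {i \<in> {1..k} \<rightarrow>\<^sub>E {1..n}. \<not> lag_generic m k i}"
        proof (rule card_mono)
          show "finite {i \<in> {1..k} \<rightarrow>\<^sub>E {1..n}. \<not> lag_generic m k i}"
            by (rule finite_subset[of _ "{1..k} \<rightarrow>\<^sub>E {1..n}"], blast, rule finite_PiE, simp_all)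
        qed (auto simp: non_generic_def)
        then show "card (non_generic n) \<le> k\<^sup>2 * ((2 * m + 1) * n ^ (k - 1))"
          using card_not_lag_generic_le[of k n m] by linarith
      qed (use C_nonneg in simp)
      also have "\<dots> = K1 * real n ^ (k - 1)" by (simp add: K1_def algebra_simps)
      finally show ?thesis .
    qed
    have tup: "i \<in> tuples" if "i \<in> generic_tuples n" for i using generic_tuple[OF generic_tuples_generic[OF that]] .
    have DM: "?D \<in> borel_measurable M" by (intro borel_measurable_sum degenerate_part_measurable tup)
    have D2: "integrable M (\<lambda>\<omega>. (?D \<omega>)\<^sup>2)"
      by (intro square_integrable_sum degenerate_part_measurable degenerate_part_L2(1) tup)
    \<comment> \<open>Instance of \<open>L1_le_of_L2\<close> with scale \<open>n^(k - 1)\<close>;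
      the second-moment constant is \<open>K2 - 1\<close>.\<close>
    have "(\<integral>\<omega>. \<bar>?D \<omega>\<bar> \<partial>M) \<le> (1 + (K2 - 1)) * real n ^ (k - 1)"
      by (rule L1_le_of_L2(2)[OF DM D2]) (use sum_degenerate_part_L2[of n] n0 in \<open>simp_all add: K2_def\<close>)
    then have D: "integrable M ?D" "(\<integral>\<omega>. \<bar>?D \<omega>\<bar> \<partial>M) \<le> K2 * real n ^ (k - 1)"
      using square_integrable_imp_integrable[OF DM D2] by simp_all
    have avgint: "integrable M (avg n i)" if "i \<in> {1..n}" for i using that by (intro avg_moments(3)) simp
    have le: "\<bar>remainder n \<omega>\<bar> \<le> 1 / ?P * (\<bar>?N \<omega>\<bar> + \<bar>?D \<omega>\<bar>) + real k * (\<Sum>i=1..n. \<bar>?w i\<bar> * \<bar>avg n i \<omega>\<bar>)" for \<omega>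
    proof -
      have "\<bar>remainder n \<omega>\<bar> \<le> \<bar>1 / ?P * (?N \<omega> + ?D \<omega>)\<bar> + \<bar>real k * (\<Sum>i=1..n. ?w i * avg n i \<omega>)\<bar>"
        unfolding remainder_eq by (rule abs_triangle_ineq)
      also have "\<bar>1 / ?P * (?N \<omega> + ?D \<omega>)\<bar> \<le> 1 / ?P * (\<bar>?N \<omega>\<bar> + \<bar>?D \<omega>\<bar>)"
      proof -
        have "\<bar>1 / ?P * (?N \<omega> + ?D \<omega>)\<bar> = 1 / ?P * \<bar>?N \<omega> + ?D \<omega>\<bar>" using P0 by (simp add: abs_mult abs_divide)
        also have "\<dots> \<le> 1 / ?P * (\<bar>?N \<omega>\<bar> + \<bar>?D \<omega>\<bar>)" using P0 by (intro mult_left_mono abs_triangle_ineq) simp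
        finally show ?thesis .
      qed
      also have "\<bar>real k * (\<Sum>i=1..n. ?w i * avg n i \<omega>)\<bar> \<le> real k * (\<Sum>i=1..n. \<bar>?w i\<bar> * \<bar>avg n i \<omega>\<bar>)"
        using sum_abs[of "\<lambda>i. ?w i * avg n i \<omega>" "{1..n}"] by (simp add: abs_mult mult_left_mono)
      finally show ?thesis by simp
    qed
    have int1: "integrable M (\<lambda>\<omega>. 1 / ?P * (\<bar>?N \<omega>\<bar> + \<bar>?D \<omega>\<bar>))"
      by (intro integrable_mult_right Bochner_Integration.integrable_add integrable_abs integrable_sum_kernel D(1))
    have int2: "integrable M (\<lambda>\<omega>. real k * (\<Sum>i=1..n. \<bar>?w i\<bar> * \<bar>avg n i \<omega>\<bar>))"
      by (intro integrable_mult_right Bochner_Integration.integrable_sum integrable_abs avgint)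
    have "(\<integral>\<omega>. \<bar>remainder n \<omega>\<bar> \<partial>M)
        \<le> (\<integral>\<omega>. 1 / ?P * (\<bar>?N \<omega>\<bar> + \<bar>?D \<omega>\<bar>) + real k * (\<Sum>i=1..n. \<bar>?w i\<bar> * \<bar>avg n i \<omega>\<bar>) \<partial>M)"
      by (intro integral_mono integrable_abs integrable_remainder Bochner_Integration.integrable_add int1 int2 le)
    also have "\<dots> = (\<integral>\<omega>. 1 / ?P * (\<bar>?N \<omega>\<bar> + \<bar>?D \<omega>\<bar>) \<partial>M) + (\<integral>\<omega>. real k * (\<Sum>i=1..n. \<bar>?w i\<bar> * \<bar>avg n i \<omega>\<bar>) \<partial>M)"
      by (rule Bochner_Integration.integral_add[OF int1 int2])
    also have "(\<integral>\<omega>. 1 / ?P * (\<bar>?N \<omega>\<bar> + \<bar>?D \<omega>\<bar>) \<partial>M) = 1 / ?P * ((\<integral>\<omega>. \<bar>?N \<omega>\<bar> \<partial>M) + (\<integral>\<omega>. \<bar>?D \<omega>\<bar> \<partial>M))"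
      unfolding integral_mult_right_zero
      by (subst Bochner_Integration.integral_add[OF integrable_abs[OF integrable_sum_kernel] integrable_abs[OF D(1)]]) simp
    also have "\<dots> \<le> 1 / (real n ^ k / 2) * (K1 * real n ^ (k - 1) + K2 * real n ^ (k - 1))"
      using N D(2) P P0 n0 K0 by (intro mult_mono add_mono frac_le) (auto intro!: integral_nonneg add_nonneg_nonneg)
    also have "\<dots> = 2 * (K1 + K2) / real n"
    proof -
      have "k = Suc (k - 1)" using k2 by simp
      then have "real n ^ k = real n * real n ^ (k - 1)" by (metis power_Suc)
      then show ?thesis using n0 by (simp add: field_simps)
    qed
    also have "(\<integral>\<omega>. real k * (\<Sum>i=1..n. \<bar>?w i\<bar> * \<bar>avg n i \<omega>\<bar>) \<partial>M)
        = real k * (\<Sum>i=1..n. \<bar>?w i\<bar> * (\<integral>\<omega>. \<bar>avg n i \<omega>\<bar> \<partial>M))"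
      unfolding integral_mult_right_zero
      by (subst Bochner_Integration.integral_sum) (intro integrable_mult_right integrable_abs avgint, assumption, simp)
    \<comment> \<open>There are \<open>n\<close> weights, each off by \<open>O(n^(-2))\<close>, so
      their absolute errors can be summed without any cancellation between the averages.\<close>
    also have "\<dots> \<le> real k * (\<Sum>i=1..n. K3 / (real n)\<^sup>2 * (1 + C))"
    proof (intro mult_left_mono sum_mono mult_mono)
      show "\<bar>?w i\<bar> \<le> K3 / (real n)\<^sup>2" for i unfolding K3_def by (rule weight_error[OF n])
      show "(\<integral>\<omega>. \<bar>avg n i \<omega>\<bar> \<partial>M) \<le> 1 + C" if "i \<in> {1..n}" for i
        using that by (intro avg_moments(4)) simp
    qed (use K0 in \<open>auto intro!: integral_nonneg\<close>)
    also have "\<dots> = real k * (K3 * (1 + C)) / real n"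
      using n0 by (simp add: field_simps power2_eq_square)
    finally show "(\<integral>\<omega>. \<bar>remainder n \<omega>\<bar> \<partial>M) \<le> (2 * (K1 + K2) + real k * (K3 * (1 + C))) / real n"
      by (simp add: add_divide_distrib)
  qed
qed

lemma L1_U_stat:
  obtains K where "0 \<le> K" "\<And>n. 2 * k\<^sup>2 \<le> n \<Longrightarrow> (\<integral>\<omega>. \<bar>U_stat k \<phi> W n \<omega>\<bar> \<partial>M) \<le> K / sqrt (real n)"
proof -
  obtain K where K: "0 \<le> K" "\<And>n. 2 * k\<^sup>2 \<le> n \<Longrightarrow> (\<integral>\<omega>. \<bar>remainder n \<omega>\<bar> \<partial>M) \<le> K / real n"
    using L1_remainder by blast
  define K' where "K' = real (2 * m + 1) * (1 + C)"
  have K'0: "0 \<le> K'" using C_nonneg by (simp add: K'_def)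
  show ?thesis
  proof (rule that[of "K + real k * (1 + K')"])
    show "0 \<le> K + real k * (1 + K')" using K(1) K'0 by simp
    fix n assume n: "2 * k\<^sup>2 \<le> n"
    let ?S = "linear_part n"
    have n0: "1 \<le> n" using n k2 by (cases n) auto
    \<comment> \<open>Here the scale is \<open>sqrt n\<close>, which after the factor
      \<open>k / n\<close> dominates the \<open>O(1/n)\<close> of the remainder and fixes the rate
      in (b).\<close>
    have S: "(\<integral>\<omega>. \<bar>?S \<omega>\<bar> \<partial>M) \<le> (1 + K') * sqrt (real n)"
      by (rule L1_le_of_L2(2)[OF sum_avg_measurable square_integrable_sum_avg])
         (use sum_avg_L2[of n] n0 in \<open>simp_all add: K'_def mult.commute\<close>)
    have "(\<integral>\<omega>. \<bar>U_stat k \<phi> W n \<omega>\<bar> \<partial>M) \<le> (\<integral>\<omega>. \<bar>remainder n \<omega>\<bar> + real k / real n * \<bar>?S \<omega>\<bar> \<partial>M)"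
    proof (intro integral_mono integrable_abs integrable_U_stat Bochner_Integration.integrable_add
        integrable_mult_right integrable_remainder integrable_sum_avg)
      fix \<omega>
      show "\<bar>U_stat k \<phi> W n \<omega>\<bar> \<le> \<bar>remainder n \<omega>\<bar> + real k / real n * \<bar>?S \<omega>\<bar>"
        unfolding U_stat_eq using abs_triangle_ineq[of "remainder n \<omega>" "real k / real n * ?S \<omega>"]
        by (simp add: abs_mult)
    qed
    also have "\<dots> = (\<integral>\<omega>. \<bar>remainder n \<omega>\<bar> \<partial>M) + real k / real n * (\<integral>\<omega>. \<bar>?S \<omega>\<bar> \<partial>M)"
      using integrable_remainder[of n] integrable_sum_avg[of n] by simp
    also have "\<dots> \<le> K / real n + real k / real n * ((1 + K') * sqrt (real n))"
      using K(2)[OF n] S by (intro add_mono mult_left_mono) auto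
    also have "\<dots> \<le> K / sqrt (real n) + real k * (1 + K') / sqrt (real n)"
    proof (intro add_mono)
      have "sqrt (real n) \<le> real n"
      proof (rule real_le_lsqrt)
        show "real n \<le> (real n)\<^sup>2" using n0 by (simp add: power2_eq_square)
      qed simp
      then show "K / real n \<le> K / sqrt (real n)" using K(1) n0 by (intro divide_left_mono) auto
      have "sqrt (real n) / real n = 1 / sqrt (real n)"
        using n0 by (simp add: field_simps)
      then have "real k / real n * ((1 + K') * sqrt (real n)) = real k * (1 + K') * (1 / sqrt (real n))"
        by (metis (no_types, lifting) mult.assoc mult.commute times_divide_eq_left times_divide_eq_right)
      then show "real k / real n * ((1 + K') * sqrt (real n)) \<le> real k * (1 + K') / sqrt (real n)" by simp
    qed
    finally show "(\<integral>\<omega>. \<bar>U_stat k \<phi> W n \<omega>\<bar> \<partial>M) \<le> (K + real k * (1 + K')) / sqrt (real n)"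
      by (simp add: add_divide_distrib)
  qed
qed

end

section \<open>Limit theorems\<close>

lemma (in prob_space) prob_abs_gt_le:
  assumes X: "integrable M X" and c: "0 < c"
  shows "measure M {\<omega> \<in> space M. \<bar>X \<omega>\<bar> > c} \<le> (\<integral>\<omega>. \<bar>X \<omega>\<bar> \<partial>M) / (c :: real)"
proof -
  have [measurable]: "X \<in> borel_measurable M" using X by (rule borel_measurable_integrable)
  have "measure M {\<omega> \<in> space M. \<bar>X \<omega>\<bar> > c} \<le> measure M {\<omega> \<in> space M. c \<le> \<bar>X \<omega>\<bar>}"
    by (intro finite_measure_mono) auto
  also have "\<dots> \<le> (\<integral>\<omega>. \<bar>X \<omega>\<bar> \<partial>M) / c"
    by (rule integral_Markov_inequality_measure[OF integrable_abs[OF X] sets.top _ c]) simp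
  finally show ?thesis .
qed

lemma (in prob_space) bigO_p_of_L1:
  assumes X: "\<And>n. integrable M (X n)" and K: "0 \<le> K"
    and le: "\<forall>\<^sub>F n in sequentially. (\<integral>\<omega>. \<bar>X n \<omega>\<bar> \<partial>M) \<le> K * \<bar>a n\<bar> \<and> a n \<noteq> 0"
  shows "bigO_p M X a"
  unfolding bigO_p_def
proof (intro allI impI)
  fix \<epsilon> :: real assume \<epsilon>: "0 < \<epsilon>"
  \<comment> \<open>Markov's inequality needs \<open>K / c \<le> \<epsilon>\<close>; the added 1
    keeps \<open>c\<close> positive when \<open>K = 0\<close>.\<close>
  define c where "c = K / \<epsilon> + 1"
  have c: "0 < c" using K \<epsilon> by (simp add: c_def add_nonneg_pos)
  have "K \<le> \<epsilon> * c" using \<epsilon> by (simp add: c_def field_simps)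
  have "\<forall>\<^sub>F n in sequentially. measure M {\<omega> \<in> space M. \<bar>X n \<omega>\<bar> > c * \<bar>a n\<bar>} \<le> \<epsilon>"
    using le
  proof eventually_elim
    case (elim n)
    have "measure M {\<omega> \<in> space M. \<bar>X n \<omega>\<bar> > c * \<bar>a n\<bar>} \<le> (\<integral>\<omega>. \<bar>X n \<omega>\<bar> \<partial>M) / (c * \<bar>a n\<bar>)"
      using elim c by (intro prob_abs_gt_le X) simp
    also have "\<dots> \<le> (K * \<bar>a n\<bar>) / (c * \<bar>a n\<bar>)"
      using elim c by (intro divide_right_mono) auto
    also have "\<dots> = K / c" using elim by simp
    also have "\<dots> \<le> \<epsilon>" using \<open>K \<le> \<epsilon> * c\<close> c by (simp add: divide_le_eq)
    finally show ?case .
  qed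
  with c show "\<exists>C>0. \<forall>\<^sub>F n in sequentially. measure M {\<omega> \<in> space M. \<bar>X n \<omega>\<bar> > C * \<bar>a n\<bar>} \<le> \<epsilon>"
    by blast
qed

lemma (in prob_space) smallo_p_one_of_L1:
  assumes X: "\<And>n. integrable M (X n)" and lim: "(\<lambda>n. \<integral>\<omega>. \<bar>X n \<omega>\<bar> \<partial>M) \<longlonglongrightarrow> 0"
  shows "smallo_p M X (\<lambda>n. 1)"
  unfolding smallo_p_def
proof (intro allI impI)
  fix \<epsilon> :: real assume \<epsilon>: "0 < \<epsilon>"
  show "(\<lambda>n. measure M {\<omega> \<in> space M. \<bar>X n \<omega>\<bar> > \<epsilon> * \<bar>1\<bar>}) \<longlonglongrightarrow> 0"
  proof (rule tendsto_sandwich[of "\<lambda>_. 0" _ _ "\<lambda>n. (\<integral>\<omega>. \<bar>X n \<omega>\<bar> \<partial>M) / \<epsilon>"])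
    show "\<forall>\<^sub>F n in sequentially. measure M {\<omega> \<in> space M. \<bar>X n \<omega>\<bar> > \<epsilon> * \<bar>1\<bar>} \<le> (\<integral>\<omega>. \<bar>X n \<omega>\<bar> \<partial>M) / \<epsilon>"
      using prob_abs_gt_le[OF X \<epsilon>] by simp
    show "(\<lambda>n. (\<integral>\<omega>. \<bar>X n \<omega>\<bar> \<partial>M) / \<epsilon>) \<longlonglongrightarrow> 0"
      using tendsto_divide[OF lim tendsto_const, of \<epsilon>] \<epsilon> by simp
  qed simp_all
qed

text \<open>Some threshold makes every tail integral at most 1, and below the threshold the power is
  bounded. The supremum over \<open>n\<close> covers all tuples at once, since each one has its
  entries below some \<open>n\<close>.\<close>

lemma kernel_unif_integrable_imp_moments:
  assumes M: "prob_space M" and UI: "kernel_unif_integrable M k \<phi> W r" and r: "0 \<le> r"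
    and meas: "\<And>i. i \<in> {1..k} \<rightarrow>\<^sub>E {1..} \<Longrightarrow> kernel_at k \<phi> W i \<in> borel_measurable M"
  obtains C where "\<And>i. i \<in> {1..k} \<rightarrow>\<^sub>E {1..} \<Longrightarrow> integrable M (\<lambda>\<omega>. \<bar>kernel_at k \<phi> W i \<omega>\<bar> powr r)"
    and "\<And>i. i \<in> {1..k} \<rightarrow>\<^sub>E {1..} \<Longrightarrow> (\<integral>\<omega>. \<bar>kernel_at k \<phi> W i \<omega>\<bar> powr r \<partial>M) \<le> C"
proof -
  interpret prob_space M by (rule M)
  let ?X = "kernel_at k \<phi> W"
  let ?t = "\<lambda>K i \<omega>. ennreal (\<bar>?X i \<omega>\<bar> powr r) * indicator {\<omega>. \<bar>?X i \<omega>\<bar> > K} \<omega>"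
  let ?F = "\<lambda>K::real. SUP n::nat. SUP i \<in> {1..k} \<rightarrow>\<^sub>E {1..n}. \<integral>\<^sup>+\<omega>. ?t K i \<omega> \<partial>M"
  have "(?F \<longlongrightarrow> 0) at_top" using UI unfolding kernel_unif_integrable_def .
  then have "\<forall>\<^sub>F K in at_top. ?F K < 1" by (rule order_tendstoD(2)) simp
  then have "\<forall>\<^sub>F K in at_top. ?F K < 1 \<and> 0 < K" using eventually_gt_at_top by (rule eventually_conj)
  then obtain K where K: "?F K < 1" "0 < K" 
    using eventually_happens[of _ "at_top :: real filter"] by auto
  have le: "(\<integral>\<^sup>+\<omega>. ennreal (\<bar>?X i \<omega>\<bar> powr r) \<partial>M) \<le> ennreal (K powr r + 1)"
    if i: "i \<in> {1..k} \<rightarrow>\<^sub>E {1..}" for i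
  proof -
    note [measurable] = meas[OF i]
    \<comment> \<open>The inserted 0 keeps the maximum meaningful for \<open>k = 0\<close>, which
      this lemma does not exclude.\<close>
    define n where "n = Max (insert 0 (i ` {1..k}))"
    have "i \<in> {1..k} \<rightarrow>\<^sub>E {1..n}"
    proof (rule PiE_I)
      show "i x \<in> {1..n}" if "x \<in> {1..k}" for x
        using PiE_mem[OF i that] that unfolding n_def by (auto intro!: Max_ge)
      show "i x = undefined" if "x \<notin> {1..k}" for x using PiE_arb[OF i that] .
    qed
    then have "(\<integral>\<^sup>+\<omega>. ?t K i \<omega> \<partial>M) \<le> (SUP i \<in> {1..k} \<rightarrow>\<^sub>E {1..n}. \<integral>\<^sup>+\<omega>. ?t K i \<omega> \<partial>M)"
      by (rule SUP_upper)
    also have "\<dots> \<le> ?F K" by (rule SUP_upper) simp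
    also have "\<dots> \<le> 1" using K(1) by simp
    finally have tail: "(\<integral>\<^sup>+\<omega>. ?t K i \<omega> \<partial>M) \<le> 1" .
    have "(\<integral>\<^sup>+\<omega>. ennreal (\<bar>?X i \<omega>\<bar> powr r) \<partial>M) \<le> (\<integral>\<^sup>+\<omega>. ennreal (K powr r) + ?t K i \<omega> \<partial>M)"
    proof (rule nn_integral_mono)
      fix \<omega>
      show "ennreal (\<bar>?X i \<omega>\<bar> powr r) \<le> ennreal (K powr r) + ?t K i \<omega>"
      proof (cases "\<bar>?X i \<omega>\<bar> > K")
        case False
        then have "\<bar>?X i \<omega>\<bar> powr r \<le> K powr r" using r by (intro powr_mono2) auto
        then show ?thesis using False by (simp add: ennreal_leI)
      qed simp
    qed
    also have "\<dots> = ennreal (K powr r) + (\<integral>\<^sup>+\<omega>. ?t K i \<omega> \<partial>M)"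
      by (subst nn_integral_add) (auto simp: emeasure_space_1)
    also have "\<dots> \<le> ennreal (K powr r) + 1" using tail by (rule add_left_mono)
    also have "\<dots> = ennreal (K powr r + 1)" by (simp add: ennreal_plus)
    finally show ?thesis .
  qed
  show ?thesis
  proof (rule that[of "K powr r + 1"])
    fix i :: "nat \<Rightarrow> nat" assume i: "i \<in> {1..k} \<rightarrow>\<^sub>E {1..}"
    note [measurable] = meas[OF i]
    show int: "integrable M (\<lambda>\<omega>. \<bar>?X i \<omega>\<bar> powr r)"
    proof (rule integrableI_bounded)
      have "(\<integral>\<^sup>+\<omega>. ennreal (norm (\<bar>?X i \<omega>\<bar> powr r)) \<partial>M) \<le> ennreal (K powr r + 1)"
        using le[OF i] by simp
      also have "\<dots> < \<infinity>" by simp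
      finally show "(\<integral>\<^sup>+\<omega>. ennreal (norm (\<bar>?X i \<omega>\<bar> powr r)) \<partial>M) < \<infinity>" .
    qed measurable
    have "ennreal (\<integral>\<omega>. \<bar>?X i \<omega>\<bar> powr r \<partial>M) \<le> ennreal (K powr r + 1)"
      using le[OF i] nn_integral_eq_integral[OF int] by simp
    then show "(\<integral>\<omega>. \<bar>?X i \<omega>\<bar> powr r \<partial>M) \<le> K powr r + 1"
      by (subst (asm) ennreal_le_iff) auto
  qed
qed

context U_statistic
begin

lemma U_stat_linearization:
  "bigO_p M (\<lambda>n \<omega>. U_stat k \<phi> W n \<omega> - real k / real n * linear_part n \<omega>) (\<lambda>n. (real m + 1) / real n)"
proof -
  obtain K where K: "0 \<le> K" "\<And>n. 2 * k\<^sup>2 \<le> n \<Longrightarrow> (\<integral>\<omega>. \<bar>remainder n \<omega>\<bar> \<partial>M) \<le> K / real n"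
    using L1_remainder by blast
  have "bigO_p M remainder (\<lambda>n. (real m + 1) / real n)"
  proof (rule bigO_p_of_L1[OF integrable_remainder K(1)], intro eventually_sequentiallyI[of "2 * k\<^sup>2"] conjI)
    fix n assume n: "2 * k\<^sup>2 \<le> n"
    then have n0: "0 < n" using k2 by (cases n) auto
    \<comment> \<open>With \<open>m\<close> fixed, the factor \<open>m + 1 \<ge> 1\<close> only
      enlarges the scale; the constants in \<open>K\<close> may depend on \<open>m\<close>.\<close>
    have "K * 1 \<le> K * (real m + 1)" using K(1) by (intro mult_left_mono) auto
    then have "K / real n \<le> K * (real m + 1) / real n" by (intro divide_right_mono) auto
    then show "(\<integral>\<omega>. \<bar>remainder n \<omega>\<bar> \<partial>M) \<le> K * \<bar>(real m + 1) / real n\<bar>"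
      using K(2)[OF n] by simp
    show "(real m + 1) / real n \<noteq> 0" using n0 by simp
  qed
  then show ?thesis unfolding remainder_def[abs_def] .
qed

lemma U_stat_rate: "bigO_p M (U_stat k \<phi> W) (\<lambda>n. sqrt ((real m + 1) / real n))"
proof -
  obtain K where K: "0 \<le> K" "\<And>n. 2 * k\<^sup>2 \<le> n \<Longrightarrow> (\<integral>\<omega>. \<bar>U_stat k \<phi> W n \<omega>\<bar> \<partial>M) \<le> K / sqrt (real n)"
    using L1_U_stat by blast
  show ?thesis
  proof (rule bigO_p_of_L1[OF integrable_U_stat K(1)], intro eventually_sequentiallyI[of "2 * k\<^sup>2"] conjI)
    fix n assume n: "2 * k\<^sup>2 \<le> n"
    then have n0: "0 < n" using k2 by (cases n) auto
    have "1 / sqrt (real n) \<le> sqrt (real m + 1) / sqrt (real n)" by (intro divide_right_mono) auto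
    then have "K * (1 / sqrt (real n)) \<le> K * (sqrt (real m + 1) / sqrt (real n))" using K(1) by (rule mult_left_mono)
    then show "(\<integral>\<omega>. \<bar>U_stat k \<phi> W n \<omega>\<bar> \<partial>M) \<le> K * \<bar>sqrt ((real m + 1) / real n)\<bar>"
      using K(2)[OF n] by (simp add: real_sqrt_divide)
    show "sqrt ((real m + 1) / real n) \<noteq> 0" using n0 by simp
  qed
qed

lemma tendsto_const_div_sqrt: "(\<lambda>n. c / sqrt (real n)) \<longlonglongrightarrow> 0"
  by (intro real_tendsto_divide_at_top[OF tendsto_const] filterlim_compose[OF sqrt_at_top filterlim_real_sequentially])

lemma U_stat_consistent: "smallo_p M (U_stat k \<phi> W) (\<lambda>n. 1)"
proof -
  obtain K where K: "0 \<le> K" "\<And>n. 2 * k\<^sup>2 \<le> n \<Longrightarrow> (\<integral>\<omega>. \<bar>U_stat k \<phi> W n \<omega>\<bar> \<partial>M) \<le> K / sqrt (real n)"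
    using L1_U_stat by blast
  show ?thesis
  proof (rule smallo_p_one_of_L1[OF integrable_U_stat])
    show "(\<lambda>n. \<integral>\<omega>. \<bar>U_stat k \<phi> W n \<omega>\<bar> \<partial>M) \<longlonglongrightarrow> 0"
    proof (rule tendsto_sandwich[OF _ _ tendsto_const tendsto_const_div_sqrt[of K]])
      show "\<forall>\<^sub>F n in sequentially. 0 \<le> (\<integral>\<omega>. \<bar>U_stat k \<phi> W n \<omega>\<bar> \<partial>M)" by (simp add: integral_nonneg)
      show "\<forall>\<^sub>F n in sequentially. (\<integral>\<omega>. \<bar>U_stat k \<phi> W n \<omega>\<bar> \<partial>M) \<le> K / sqrt (real n)"
        using K(2) by (rule eventually_sequentiallyI)
    qed
  qed
qed

section \<open>Asymptotic normality\<close>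

abbreviation \<sigma> :: "nat \<Rightarrow> real" where "\<sigma> n \<equiv> sigma_U M S m k \<phi> W n"

text \<open>The linear part is centred, so its variance is the second moment that
  \<open>m_dependent_gaussian_bound\<close> normalizes.\<close>

lemma sigma_U_square: "(\<sigma> n)\<^sup>2 = (real k)\<^sup>2 / real n * (\<integral>\<omega>. (linear_part n \<omega>)\<^sup>2 \<partial>M)"
proof -
  let ?S = "linear_part n"
  have "(\<integral>\<omega>. ?S \<omega> \<partial>M) = (\<Sum>i=1..n. \<integral>\<omega>. avg n i \<omega> \<partial>M)"
    by (intro Bochner_Integration.integral_sum avg_moments(3)) auto
  also have "\<dots> = 0" by (intro sum.neutral ballI avg_centred) auto
  finally have 0: "(\<integral>\<omega>. ?S \<omega> \<partial>M) = 0" .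
  have "0 \<le> (real k)\<^sup>2 / real n * (\<integral>\<omega>. (?S \<omega>)\<^sup>2 \<partial>M)" by (intro mult_nonneg_nonneg integral_nonneg) auto
  then show ?thesis unfolding sigma_U_def 0 by simp
qed

abbreviation standardized :: "nat \<Rightarrow> 'a \<Rightarrow> real" where
  "standardized n \<omega> \<equiv> 1 / \<sigma> n * sqrt (real n) * U_stat k \<phi> W n \<omega>"

text \<open>Slutsky's step is carried out on characteristic functions: the standardized statistic
  and its linear part differ by \<open>sqrt n / \<sigma> n\<close> times the remainder, which is
  \<open>O(n^(-1/2))\<close> in mean, and the exponential is Lipschitz.\<close>

lemma U_stat_char_tendsto:
  assumes d: "0 < d" "d \<le> 1" "p = 2 + d" and lam: "0 < lam" "\<forall>\<^sub>F n in sequentially. lam \<le> \<sigma> n"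
  shows "(\<lambda>n. \<integral>\<omega>. iexp (t * standardized n \<omega>) \<partial>M)
    \<longlonglongrightarrow> complex_of_real (exp (- (t\<^sup>2) / 2))"
proof -
  obtain K where K: "0 \<le> K" "\<And>n. 2 * k\<^sup>2 \<le> n \<Longrightarrow> (\<integral>\<omega>. \<bar>remainder n \<omega>\<bar> \<partial>M) \<le> K / real n"
    using L1_remainder by blast
  define D where "D = real (4 * m + 1) powr (2 + d) * (real (4 * m + 1) * C)"
  have D0: "0 \<le> D" using C_nonneg by (simp add: D_def)
  \<comment> \<open>\<open>b n = c / sqrt n\<close> will dominate the true normalizing factor
    \<open>a\<close>, in which \<open>\<sigma> n\<close> stands in place of its lower bound
    \<open>lam\<close>.\<close>
  define c where "c = real k / lam"
  have c0: "0 < c" using lam k2 by (simp add: c_def)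
  define b where "b = (\<lambda>n. c / sqrt (real n))"
  have b0: "b \<longlonglongrightarrow> 0" unfolding b_def by (rule tendsto_const_div_sqrt)
  define e where "e = (\<lambda>n. \<bar>t\<bar> / lam * (K / sqrt (real n))
      + \<bar>t\<bar> * (4 * \<bar>t\<bar> powr (1 + d) * (c\<^sup>2 * b n powr d * D) + t\<^sup>2 * (c\<^sup>2 * b n * (1 + D)\<^sup>2)))"
  have bd0: "(\<lambda>n. b n powr d) \<longlonglongrightarrow> 0"
    using d c0 by (intro tendsto_zero_powrI[OF b0 tendsto_const]) (auto simp: b_def)
  have "e \<longlonglongrightarrow> \<bar>t\<bar> / lam * 0
      + \<bar>t\<bar> * (4 * \<bar>t\<bar> powr (1 + d) * (c\<^sup>2 * 0 * D) + t\<^sup>2 * (c\<^sup>2 * 0 * (1 + D)\<^sup>2))"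
    unfolding e_def by (intro tendsto_add tendsto_mult tendsto_const b0 bd0 tendsto_const_div_sqrt)
  then have e0: "e \<longlonglongrightarrow> 0" by simp
  have bound: "\<forall>\<^sub>F n in sequentially. norm ((\<integral>\<omega>. iexp (t * standardized n \<omega>) \<partial>M)
      - complex_of_real (exp (- (t\<^sup>2) / 2))) \<le> e n"
    using lam(2) eventually_ge_at_top[of "2 * k\<^sup>2"]
  proof eventually_elim
    case (elim n)
    have n0: "0 < n" using elim(2) k2 by (cases n) auto
    have sq: "sqrt (real n) / real n = 1 / sqrt (real n)" using n0 by (simp add: field_simps)
    have \<sigma>0: "0 < \<sigma> n" using lam(1) elim(1) by linarith
    \<comment> \<open>The factor that turns the linear part into a variable of variance 1; it equals
      \<open>sqrt n / \<sigma> n\<close> times \<open>k / n\<close>.\<close>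
    define a where "a = real k / (sqrt (real n) * \<sigma> n)"
    have a0: "0 < a" using n0 \<sigma>0 k2 by (simp add: a_def)
    have ab: "a \<le> b n"
    proof -
      have "a = real k / \<sigma> n / sqrt (real n)" by (simp add: a_def)
      also have "\<dots> \<le> real k / lam / sqrt (real n)"
        using elim(1) lam(1) by (intro divide_right_mono divide_left_mono) auto
      finally show ?thesis by (simp add: b_def c_def)
    qed
    let ?S = "linear_part n"
    let ?X = "\<lambda>\<omega>. t * standardized n \<omega>"
    let ?Y = "\<lambda>\<omega>. t * (a * ?S \<omega>)"
    have var: "a\<^sup>2 * (\<integral>\<omega>. (?S \<omega>)\<^sup>2 \<partial>M) = 1"
    proof -
      have "a\<^sup>2 = (real k)\<^sup>2 / real n / (\<sigma> n)\<^sup>2"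
        unfolding a_def by (simp add: power_divide power_mult_distrib)
      then have "a\<^sup>2 * (\<integral>\<omega>. (?S \<omega>)\<^sup>2 \<partial>M) = ((real k)\<^sup>2 / real n * (\<integral>\<omega>. (?S \<omega>)\<^sup>2 \<partial>M)) / (\<sigma> n)\<^sup>2"
        by simp
      also have "\<dots> = 1" unfolding sigma_U_square[symmetric] using \<sigma>0 by simp
      finally show ?thesis .
    qed
    have "cmod ((\<integral>\<omega>. iexp (?X \<omega>) \<partial>M) - (\<integral>\<omega>. iexp (?Y \<omega>) \<partial>M)) \<le> (\<integral>\<omega>. \<bar>t\<bar> / \<sigma> n * sqrt (real n) * \<bar>remainder n \<omega>\<bar> \<partial>M)"
    proof (rule norm_expectation_iexp_diff_le)
      show "?X \<in> borel_measurable M"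
        using borel_measurable_integrable[OF integrable_U_stat[of n]] by measurable
      show "?Y \<in> borel_measurable M"
        using sum_avg_measurable[of n] by measurable
      show "integrable M (\<lambda>\<omega>. \<bar>t\<bar> / \<sigma> n * sqrt (real n) * \<bar>remainder n \<omega>\<bar>)"
        using integrable_remainder[of n] by simp
      fix \<omega>
      have "1 / \<sigma> n * sqrt (real n) * (real k / real n * ?S \<omega>) = a * ?S \<omega>"
      proof -
        have "1 / \<sigma> n * real k * (sqrt (real n) / real n) = a"
          unfolding sq by (simp add: a_def)
        moreover have "1 / \<sigma> n * sqrt (real n) * (real k / real n * ?S \<omega>)
            = (1 / \<sigma> n * real k * (sqrt (real n) / real n)) * ?S \<omega>"
          by (simp add: ac_simps)
        ultimately show ?thesis by (simp only:)
      qed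
      then have "?X \<omega> - ?Y \<omega> = t * (1 / \<sigma> n * sqrt (real n) * remainder n \<omega>)"
        unfolding U_stat_eq by (simp add: algebra_simps)
      then show "\<bar>?X \<omega> - ?Y \<omega>\<bar> \<le> \<bar>t\<bar> / \<sigma> n * sqrt (real n) * \<bar>remainder n \<omega>\<bar>"
        using \<sigma>0 by (simp add: abs_mult)
    qed
    also have "\<dots> = \<bar>t\<bar> / \<sigma> n * sqrt (real n) * (\<integral>\<omega>. \<bar>remainder n \<omega>\<bar> \<partial>M)" by simp
    also have "\<dots> \<le> \<bar>t\<bar> / lam * sqrt (real n) * (K / real n)"
      using elim lam(1) K \<sigma>0 by (intro mult_mono divide_left_mono) (auto intro!: integral_nonneg)
    also have "\<dots> = \<bar>t\<bar> / lam * (K * (sqrt (real n) / real n))" by simp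
    also have "\<dots> = \<bar>t\<bar> / lam * (K / sqrt (real n))" unfolding sq by simp
    finally have 1: "cmod ((\<integral>\<omega>. iexp (?X \<omega>) \<partial>M) - (\<integral>\<omega>. iexp (?Y \<omega>) \<partial>M)) \<le> \<bar>t\<bar> / lam * (K / sqrt (real n))" .
    have "cmod ((\<integral>\<omega>. iexp (?Y \<omega>) \<partial>M) - complex_of_real (exp (- (t\<^sup>2) / 2)))
        \<le> \<bar>t\<bar> * (real n * (4 * \<bar>t\<bar> powr (1 + d) * (a powr (2 + d) * D) + t\<^sup>2 * (a ^ 3 * (1 + D)\<^sup>2)))"
    proof (rule m_dependent_gaussian_bound[OF _ d(1,2) _ _ _ C_nonneg _ var D_def])
      fix i assume "i \<in> {1..n}"
      then have i: "1 \<le> i" by simp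
      show "avg n i \<in> borel_measurable (alg {i})" by (rule avg_alg[OF i])
      show "integrable M (\<lambda>\<omega>. \<bar>avg n i \<omega>\<bar> powr (2 + d))" "(\<integral>\<omega>. \<bar>avg n i \<omega>\<bar> powr (2 + d) \<partial>M) \<le> C"
        using avg_powr[OF i] d(3) by simp_all
      show "(\<integral>\<omega>. avg n i \<omega> \<partial>M) = 0" by (rule avg_centred[OF i])
    qed (use a0 in simp)
    also have "\<dots> = \<bar>t\<bar> * (4 * \<bar>t\<bar> powr (1 + d) * (real n * a powr (2 + d) * D) + t\<^sup>2 * (real n * a ^ 3 * (1 + D)\<^sup>2))"
      by (simp add: algebra_simps)
    also have "\<dots> \<le> \<bar>t\<bar> * (4 * \<bar>t\<bar> powr (1 + d) * (c\<^sup>2 * b n powr d * D) + t\<^sup>2 * (c\<^sup>2 * b n * (1 + D)\<^sup>2))"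
    proof -
      \<comment> \<open>Two of the powers of \<open>a\<close> absorb the number \<open>n\<close> of
        summands; the surplus \<open>a powr d\<close>, or \<open>a\<close>, tends to 0.\<close>
      have na: "real n * a\<^sup>2 \<le> c\<^sup>2"
      proof -
        have "a\<^sup>2 \<le> (b n)\<^sup>2" using ab a0 by (intro power_mono) auto
        then have "real n * a\<^sup>2 \<le> real n * (b n)\<^sup>2" by (intro mult_left_mono) auto
        also have "\<dots> = c\<^sup>2" using n0 by (simp add: b_def power_divide)
        finally show ?thesis .
      qed
      have "a powr (2 + d) = a\<^sup>2 * a powr d" using a0 by (simp add: powr_add)
      then have "real n * a powr (2 + d) = (real n * a\<^sup>2) * a powr d" by simp
      also have "\<dots> \<le> c\<^sup>2 * b n powr d"
        using na ab a0 d by (intro mult_mono powr_mono2) auto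
      finally have p1: "real n * a powr (2 + d) \<le> c\<^sup>2 * b n powr d" .
      have "real n * a ^ 3 = (real n * a\<^sup>2) * a" by (simp add: power2_eq_square power3_eq_cube)
      also have "\<dots> \<le> c\<^sup>2 * b n" using na ab a0 by (intro mult_mono) auto
      finally have p2: "real n * a ^ 3 \<le> c\<^sup>2 * b n" .
      show ?thesis
        using p1 p2 D0 by (intro mult_left_mono add_mono mult_right_mono) auto
    qed
    finally have 2: "cmod ((\<integral>\<omega>. iexp (?Y \<omega>) \<partial>M) - complex_of_real (exp (- (t\<^sup>2) / 2)))
        \<le> \<bar>t\<bar> * (4 * \<bar>t\<bar> powr (1 + d) * (c\<^sup>2 * b n powr d * D) + t\<^sup>2 * (c\<^sup>2 * b n * (1 + D)\<^sup>2))" .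
    show ?case
      unfolding e_def using norm_triangle_le[OF add_mono[OF 1 2]] by simp
  qed
  have "(\<lambda>n. (\<integral>\<omega>. iexp (t * standardized n \<omega>) \<partial>M)
      - complex_of_real (exp (- (t\<^sup>2) / 2))) \<longlonglongrightarrow> 0"
    by (rule Lim_null_comparison[OF bound e0])
  then show ?thesis by (simp add: LIM_zero_iff)
qed

lemma U_stat_weak_conv:
  assumes "0 < d" "d \<le> 1" "p = 2 + d" "0 < lam" "\<forall>\<^sub>F n in sequentially. lam \<le> \<sigma> n"
  shows "weak_conv_m (\<lambda>n. distr M borel (standardized n)) std_normal_distribution"
proof (rule levy_continuity)
  have meas: "standardized n \<in> borel_measurable M" for n
    using borel_measurable_integrable[OF integrable_U_stat[of n]] by measurable
  show "real_distribution (distr M borel (standardized n))" for n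
    using meas by (rule real_distribution_distr)
  show "real_distribution std_normal_distribution" by (rule real_dist_normal_dist)
  fix t
  have "char (distr M borel (standardized n)) t
      = (\<integral>\<omega>. iexp (t * standardized n \<omega>) \<partial>M)" for n
    unfolding char_def by (rule integral_distr[OF meas]) measurable
  then show "(\<lambda>n. char (distr M borel (standardized n)) t)
      \<longlonglongrightarrow> char std_normal_distribution t"
    using U_stat_char_tendsto[OF assms, of t] by (simp only: char_std_normal_distribution)
qed

end

theorem theorem2:
  fixes M :: "'a measure" and S :: "'b measure" and W :: "nat \<Rightarrow> 'a \<Rightarrow> 'b"
    and k m :: nat and \<phi> :: "(nat \<Rightarrow> 'b) \<Rightarrow> real" and r :: real
  assumes "prob_space M"
    and "standard_borel S"
    and "k \<ge> 2"
    and "\<And>i. i \<ge> 1 \<Longrightarrow> W i \<in> measurable M S"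
    and "m_dependent M S m W"
    and "\<phi> \<in> borel_measurable (\<Pi>\<^sub>M l\<in>{1..k}. S)"
    and "symmetric_kernel S k \<phi>"
    and "centred_on_lag_generic M m k \<phi> W"
    and "r \<ge> 2"
    and "kernel_unif_integrable M k \<phi> W r"
  shows
    "bigO_p M
       (\<lambda>n \<omega>. U_stat k \<phi> W n \<omega> - real k / real n * (\<Sum>i=1..n. avg_proj1 M S m k \<phi> W n i \<omega>))
       (\<lambda>n. (real m + 1) / real n)
     \<and> (bigO_p M (U_stat k \<phi> W) (\<lambda>n. sqrt ((real m + 1) / real n))
        \<and> smallo_p M (U_stat k \<phi> W) (\<lambda>n. 1))
     \<and> ((\<exists>r'>2. kernel_unif_integrable M k \<phi> W r')
        \<and> (\<exists>lam>0. \<forall>\<^sub>F n in sequentially. lam \<le> sigma_U M S m k \<phi> W n)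
        \<longrightarrow> weak_conv_m
              (\<lambda>n. distr M borel (\<lambda>\<omega>. 1 / sigma_U M S m k \<phi> W n * sqrt (real n) * U_stat k \<phi> W n \<omega>))
              std_normal_distribution)"
proof -
  let ?X = "kernel_at k \<phi> W"
  interpret P: prob_space M by (rule assms(1))
  have meas: "kernel_at k \<phi> W i \<in> borel_measurable M" if i: "i \<in> {1..k} \<rightarrow>\<^sub>E {1..}" for i
  proof -
    have "(\<lambda>\<omega>. \<lambda>l\<in>{1..k}. W (i l) \<omega>) \<in> measurable M (\<Pi>\<^sub>M l\<in>{1..k}. S)"
    proof (rule measurable_restrict)
      fix l assume "l \<in> {1..k}"
      then have "i l \<in> {1..}" by (rule PiE_mem[OF i])
      then show "W (i l) \<in> measurable M S" using assms(4) by simp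
    qed
    from measurable_comp[OF this assms(6)] show ?thesis unfolding comp_def kernel_at_def .
  qed
  have U: "U_statistic M S m W k \<phi> p C"
    if "2 \<le> p" "\<And>i. i \<in> {1..k} \<rightarrow>\<^sub>E {1..} \<Longrightarrow> integrable M (\<lambda>\<omega>. \<bar>?X i \<omega>\<bar> powr p)"
      "\<And>i. i \<in> {1..k} \<rightarrow>\<^sub>E {1..} \<Longrightarrow> (\<integral>\<omega>. \<bar>?X i \<omega>\<bar> powr p \<partial>M) \<le> C" for p C
    by unfold_locales (use assms that in simp_all)
  obtain C where C: "\<And>i. i \<in> {1..k} \<rightarrow>\<^sub>E {1..} \<Longrightarrow> integrable M (\<lambda>\<omega>. \<bar>?X i \<omega>\<bar> powr r)"
      "\<And>i. i \<in> {1..k} \<rightarrow>\<^sub>E {1..} \<Longrightarrow> (\<integral>\<omega>. \<bar>?X i \<omega>\<bar> powr r \<partial>M) \<le> C"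
    using kernel_unif_integrable_imp_moments[OF assms(1,10) _ meas] assms(9) by (smt (verit))
  interpret U: U_statistic M S m W k \<phi> r C by (rule U[OF assms(9) C])
  have "weak_conv_m
          (\<lambda>n. distr M borel (\<lambda>\<omega>. 1 / sigma_U M S m k \<phi> W n * sqrt (real n) * U_stat k \<phi> W n \<omega>))
          std_normal_distribution"
    if r': "r' > 2" "kernel_unif_integrable M k \<phi> W r'"
      and lam: "lam > 0" "\<forall>\<^sub>F n in sequentially. lam \<le> sigma_U M S m k \<phi> W n" for r' lam
  proof -
    obtain C' where C': "\<And>i. i \<in> {1..k} \<rightarrow>\<^sub>E {1..} \<Longrightarrow> integrable M (\<lambda>\<omega>. \<bar>?X i \<omega>\<bar> powr r')"
        "\<And>i. i \<in> {1..k} \<rightarrow>\<^sub>E {1..} \<Longrightarrow> (\<integral>\<omega>. \<bar>?X i \<omega>\<bar> powr r' \<partial>M) \<le> C'"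
      using kernel_unif_integrable_imp_moments[OF assms(1) r'(2) _ meas] r'(1) by (smt (verit))
    \<comment> \<open>Capped at 1 because the interpolated exponential bounds require
      \<open>d \<le> 1\<close>. The moment of order \<open>2 + d\<close> is then controlled by the
      one of order \<open>r'\<close>, which gives the bound \<open>1 + C'\<close>.\<close>
    define d where "d = min 1 (r' - 2)"
    have d: "0 < d" "d \<le> 1" "2 + d \<le> r'" using r'(1) by (auto simp: d_def)
    have le: "\<bar>?X i \<omega>\<bar> powr (2 + d) \<le> 1 + \<bar>?X i \<omega>\<bar> powr r'" for i \<omega>
      using d by (intro le_one_plus_powr) auto
    interpret V: U_statistic M S m W k \<phi> "2 + d" "1 + C'"
    proof (rule U)
      fix i :: "nat \<Rightarrow> nat" assume i: "i \<in> {1..k} \<rightarrow>\<^sub>E {1..}"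
      note [measurable] = meas[OF i]
      have int: "integrable M (\<lambda>\<omega>. 1 + \<bar>?X i \<omega>\<bar> powr r')" using C'(1)[OF i] by simp
      show 1: "integrable M (\<lambda>\<omega>. \<bar>?X i \<omega>\<bar> powr (2 + d))"
        by (rule Bochner_Integration.integrable_bound[OF int])
           (use le in \<open>auto intro!: AE_I2 order_trans[OF _ abs_ge_self]\<close>)
      have "(\<integral>\<omega>. \<bar>?X i \<omega>\<bar> powr (2 + d) \<partial>M) \<le> (\<integral>\<omega>. 1 + \<bar>?X i \<omega>\<bar> powr r' \<partial>M)"
        by (intro integral_mono 1 int le)
      also have "\<dots> \<le> 1 + C'" using C'[OF i] by (simp add: P.prob_space)
      finally show "(\<integral>\<omega>. \<bar>?X i \<omega>\<bar> powr (2 + d) \<partial>M) \<le> 1 + C'" .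
    qed (use d in simp)
    show ?thesis by (rule V.U_stat_weak_conv[OF d(1,2) refl lam])
  qed
  then show ?thesis
    using U.U_stat_linearization U.U_stat_rate U.U_stat_consistent by blast
qed

end
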